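(* Let $G$ and $H$ be simple directed graphs such that $I:=I_{G\to H}$ is unmixed. Then $$\operatorname{depth} S/I\geq \operatorname{depth} S/I^{(2)}\geq \operatorname{depth} S/I^{(3)}\geq\cdots.$$ In particular, for each simple directed graph $G$ (and each integer $m\ge 1$), $$\operatorname{depth} S/I_{G\to D_m}\geq \operatorname{depth} S/I_{G\to D_m}^{(2)}\geq \operatorname{depth} S/I_{G\to D_m}^{(3)}\geq\cdots.$$
   Context: Directed graphs are finite with nonempty vertex sets and simple: the underlying graph has no loops and no multiple edges. $D_m$ is the directed graph on $[m]=\{1,\dots,m\}$ in which $(i,j)$ is an edge if and only if $i<j$. For directed graphs $G$ on $[n]$ and $H$ on $[m]$, a weak graph homomorphism from $G$ to $H$ is a map $\phi:V(G)\to V(H)$ such that for every $(x,y)\in E(G)$ either $\phi(x)=\phi(y)$ or $(\phi(x),\phi(y))\in E(H)$; the set of these is $\mathrm{WHom}(G,H)$. Let $K$ be a field, $S=K[x_{ij}: i\in[n], j\in[m]]$, $u_\phi=\prod_{i=1}^n x_{i\phi(i)}$ and $I_{G\to H}=(u_\phi:\phi\in\mathrm{WHom}(G,H))\subseteq S$, a squarefree monomial ideal. A monomial ideal is unmixed if all its associated primes have the same height. For a squarefree monomial ideal $I$ with irredundant primary decomposition $I=\mathfrak p_1\cap\cdots\cap\mathfrak p_r$ (each $\mathfrak p_i$ generated by variables), $I^{(k)}=\mathfrak p_1^k\cap\cdots\cap\mathfrak p_r^k$. Depth is taken with respect to the graded maximal ideal of $S$. *)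

theory Defs
  imports
    "HOL-Library.FuncSet"
    "HOL-Library.Extended_Nat"
    "HOL-Library.Poly_Mapping"
    "HOL-Algebra.Ideal_Product"
    "HOL-Algebra.QuotRing"
    "HOL-Algebra.Module"
    "Graph_Theory.Pair_Digraph"
begin

section \<open>Commutative algebra\<close>

text \<open>The cyclic module \<open>R/I\<close> over \<open>R\<close>; the fields \<open>mult\<close> and \<open>one\<close> only fill the record.\<close>

definition quot_module :: "('a, 'b) ring_scheme \<Rightarrow> 'a set \<Rightarrow> ('a, 'a set) module" where
  "quot_module R I =
    \<lparr>carrier = carrier (R Quot I), monoid.mult = (\<otimes>\<^bsub>R Quot I\<^esub>), one = \<one>\<^bsub>R Quot I\<^esub>,
     zero = \<zero>\<^bsub>R Quot I\<^esub>, add = (\<oplus>\<^bsub>R Quot I\<^esub>),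
     smult = (\<lambda>r C. (I +>\<^bsub>R\<^esub> r) \<otimes>\<^bsub>R Quot I\<^esub> C)\<rparr>"

lemma quot_module_is_module:
  assumes "cring R" and "ideal I R"
  shows "Module.module R (quot_module R I)"
proof -
  interpret R: cring R by (fact assms(1))
  interpret I: ideal I R by (fact assms(2))
  interpret Q: cring "R Quot I" by (rule I.quotient_is_cring[OF assms(1)])
  interpret h: ring_hom_ring R "R Quot I" "(+>\<^bsub>R\<^esub>) I" by (rule I.rcos_ring_hom_ring)
  have one: "I +>\<^bsub>R\<^esub> \<one>\<^bsub>R\<^esub> = \<one>\<^bsub>R Quot I\<^esub>"
    using h.hom_one by simp
  have "abelian_group (quot_module R I)"
  proof (rule abelian_groupI)
    fix C assume "C \<in> carrier (quot_module R I)"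
    then show "\<exists>D \<in> carrier (quot_module R I). D \<oplus>\<^bsub>quot_module R I\<^esub> C = \<zero>\<^bsub>quot_module R I\<^esub>"
      using Q.l_neg[of C] Q.a_inv_closed[of C] by (auto simp: quot_module_def)
  qed (simp_all add: quot_module_def Q.a_ac)
  then show ?thesis
  proof (rule moduleI[OF assms(1)])
    fix C assume "C \<in> carrier (quot_module R I)"
    then show "\<one>\<^bsub>R\<^esub> \<odot>\<^bsub>quot_module R I\<^esub> C = C"
      unfolding quot_module_def by (simp only: one module.simps partial_object.simps ring.simps Q.l_one)
  qed (simp_all add: quot_module_def h.hom_closed h.hom_add h.hom_mult
         Q.l_distr Q.r_distr Q.m_assoc)
qed

text \<open>\<open>seq_smult M [x\<^sub>1, \<dots>, x\<^sub>r]\<close> is the submodule \<open>(x\<^sub>1, \<dots>, x\<^sub>r)M\<close> of \<open>M\<close>.\<close>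

fun seq_smult :: "('a, 'b, 'c) module_scheme \<Rightarrow> 'a list \<Rightarrow> 'b set" where
  "seq_smult M [] = {\<zero>\<^bsub>M\<^esub>}"
| "seq_smult M (x # xs) = {x \<odot>\<^bsub>M\<^esub> v \<oplus>\<^bsub>M\<^esub> w | v w. v \<in> carrier M \<and> w \<in> seq_smult M xs}"

text \<open>Each \<open>x\<^sub>i\<close> is a nonzerodivisor on \<open>M/(x\<^sub>1, \<dots>, x\<^sub>i\<^sub>-\<^sub>1)M\<close>, and
  \<open>M \<noteq> (x\<^sub>1, \<dots>, x\<^sub>r)M\<close>; both are expressed by membership in the submodules.\<close>

definition regular_seq :: "('a, 'b, 'c) module_scheme \<Rightarrow> 'a list \<Rightarrow> bool" where
  "regular_seq M xs \<longleftrightarrow>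
    (\<forall>i < length xs. \<forall>v \<in> carrier M.
       (xs ! i) \<odot>\<^bsub>M\<^esub> v \<in> seq_smult M (take i xs) \<longrightarrow> v \<in> seq_smult M (take i xs)) \<and>
    seq_smult M xs \<noteq> carrier M"

definition depth :: "'a set \<Rightarrow> ('a, 'b, 'c) module_scheme \<Rightarrow> enat" where
  "depth J M = Sup {enat (length xs) | xs. set xs \<subseteq> J \<and> regular_seq M xs}"

definition assoc_primes ::
  "('a, 'b) ring_scheme \<Rightarrow> ('a, 'c, 'd) module_scheme \<Rightarrow> 'a set set" where
  "assoc_primes R M =
    {P. primeideal P R \<and> (\<exists>v \<in> carrier M. P = {r \<in> carrier R. r \<odot>\<^bsub>M\<^esub> v = \<zero>\<^bsub>M\<^esub>})}"

text \<open>The supremum of the lengths \<open>r\<close> of chains of primes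
  \<open>P\<^sub>0 \<subset> \<dots> \<subset> P\<^sub>r = P\<close>; the list \<open>Ps\<close> is \<open>[P\<^sub>0, \<dots>, P\<^sub>r\<^sub>-\<^sub>1]\<close>.\<close>

definition height :: "('a, 'b) ring_scheme \<Rightarrow> 'a set \<Rightarrow> enat" where
  "height R P =
    Sup {enat (length Ps) | Ps. (\<forall>Q \<in> set Ps. primeideal Q R) \<and> sorted_wrt (\<subset>) (Ps @ [P])}"

definition unmixed :: "('a, 'b) ring_scheme \<Rightarrow> 'a set \<Rightarrow> bool" where
  "unmixed R I \<longleftrightarrow>
    (\<forall>P \<in> assoc_primes R (quot_module R I). \<forall>Q \<in> assoc_primes R (quot_module R I).
       height R P = height R Q)"


section \<open>Polynomial rings and symbolic powers\<close>

text \<open>Exponent vectors are finitely supported maps \<open>'v \<Rightarrow>\<^sub>0 nat\<close>, and a polynomial is a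
  finitely supported family of coefficients indexed by them.\<close>

type_synonym ('v, 'k) mpoly = "('v \<Rightarrow>\<^sub>0 nat) \<Rightarrow>\<^sub>0 'k"

definition poly_ring :: "'v set \<Rightarrow> ('v, 'k::field) mpoly ring" where
  "poly_ring V =
    \<lparr>carrier = {p. \<forall>t \<in> Poly_Mapping.keys p. Poly_Mapping.keys t \<subseteq> V},
     monoid.mult = (*), one = 1, zero = 0, add = (+)\<rparr>"

lemma cring_poly_ring: "cring (poly_ring V :: ('v, 'k::field) mpoly ring)"
proof (rule cringI)
  show "abelian_group (poly_ring V :: ('v, 'k) mpoly ring)"
  proof (rule abelian_groupI)
    fix p :: "('v, 'k) mpoly" assume "p \<in> carrier (poly_ring V)"
    then show "\<exists>q \<in> carrier (poly_ring V). q \<oplus>\<^bsub>poly_ring V\<^esub> p = \<zero>\<^bsub>poly_ring V\<^esub>"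
      by (intro bexI[of _ "- p"]) (auto simp: poly_ring_def in_keys_iff)
  qed (use keys_add in \<open>fastforce simp: poly_ring_def add_ac\<close>)+
  show "Group.comm_monoid (poly_ring V :: ('v, 'k) mpoly ring)"
  proof (rule comm_monoidI)
    fix p q :: "('v, 'k) mpoly"
    assume *: "p \<in> carrier (poly_ring V)" "q \<in> carrier (poly_ring V)"
    show "p \<otimes>\<^bsub>poly_ring V\<^esub> q \<in> carrier (poly_ring V)"
    proof (clarsimp simp: poly_ring_def)
      fix t v assume "t \<in> Poly_Mapping.keys (p * q)" and v: "v \<in> Poly_Mapping.keys t"
      then obtain a b where ab: "t = a + b" "a \<in> Poly_Mapping.keys p" "b \<in> Poly_Mapping.keys q"
        using keys_mult[of p q] by blast
      then have "v \<in> Poly_Mapping.keys a \<union> Poly_Mapping.keys b"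
        using v keys_add[of a b] by blast
      then show "v \<in> V" using ab * by (auto simp: poly_ring_def)
    qed
  qed (auto simp: poly_ring_def mult_ac)
qed (auto simp: poly_ring_def algebra_simps)

definition pvar :: "'v \<Rightarrow> ('v, 'k::field) mpoly" where
  "pvar v = Poly_Mapping.single (Poly_Mapping.single v 1) 1"

definition var_ideal :: "'v set \<Rightarrow> 'v set \<Rightarrow> ('v, 'k::field) mpoly set" where
  "var_ideal V W = Idl\<^bsub>poly_ring V\<^esub> (pvar ` W)"

text \<open>\<open>depth S/I\<close> for \<open>S = K[V]\<close>, with respect to the graded maximal ideal.\<close>

definition depth_quot :: "'v set \<Rightarrow> ('v, 'k::field) mpoly set \<Rightarrow> enat" where
  "depth_quot V I = depth (var_ideal V V) (quot_module (poly_ring V) I)"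

text \<open>The intersections are taken inside \<open>S\<close>, so the empty family has intersection \<open>S\<close>.\<close>

definition irredundant_var_decomp ::
  "'v set \<Rightarrow> ('v, 'k::field) mpoly set \<Rightarrow> ('v, 'k) mpoly set set \<Rightarrow> bool" where
  "irredundant_var_decomp V I \<P> \<longleftrightarrow>
    finite \<P> \<and> (\<forall>P \<in> \<P>. \<exists>W \<subseteq> V. P = var_ideal V W) \<and>
    I = carrier (poly_ring V) \<inter> \<Inter>\<P> \<and>
    (\<forall>P \<in> \<P>. I \<noteq> carrier (poly_ring V) \<inter> \<Inter>(\<P> - {P}))"

text \<open>Meant for squarefree monomial ideals in finitely many variables, where the irredundant
  decomposition exists and is unique. Powers of ideals are taken in the library's monoid of
  ideals under the ideal product.\<close>

definition symbolic_power ::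
  "'v set \<Rightarrow> ('v, 'k::field) mpoly set \<Rightarrow> nat \<Rightarrow> ('v, 'k) mpoly set" where
  "symbolic_power V I k =
    carrier (poly_ring V) \<inter>
    (\<Inter>P \<in> (THE \<P>. irredundant_var_decomp V I \<P>). P [^]\<^bsub>ideals_set (poly_ring V)\<^esub> k)"


section \<open>Directed graphs and weak homomorphisms\<close>

text \<open>The locale \<open>pair_digraph\<close> gives finiteness and absence of loops. Since the underlying
  undirected graph has no multiple edges, at most one of \<open>(x, y)\<close> and \<open>(y, x)\<close> is an edge.\<close>

definition simple_digraph_on :: "'a set \<Rightarrow> 'a pair_pre_digraph \<Rightarrow> bool" where
  "simple_digraph_on A G \<longleftrightarrow>
    pair_digraph G \<and> pverts G = A \<and> A \<noteq> {} \<and> asym (parcs G)"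

definition D_graph :: "nat \<Rightarrow> nat pair_pre_digraph" where
  "D_graph m = \<lparr>pverts = {1..m}, parcs = {(i, j). i \<in> {1..m} \<and> j \<in> {1..m} \<and> i < j}\<rparr>"

definition WHom :: "'a pair_pre_digraph \<Rightarrow> 'b pair_pre_digraph \<Rightarrow> ('a \<Rightarrow> 'b) set" where
  "WHom G H =
    {\<phi> \<in> pverts G \<rightarrow>\<^sub>E pverts H.
       \<forall>(x, y) \<in> parcs G. \<phi> x = \<phi> y \<or> (\<phi> x, \<phi> y) \<in> parcs H}"

definition hom_vars :: "'a pair_pre_digraph \<Rightarrow> 'b pair_pre_digraph \<Rightarrow> ('a \<times> 'b) set" where
  "hom_vars G H = pverts G \<times> pverts H"

definition hom_monom :: "'a pair_pre_digraph \<Rightarrow> ('a \<Rightarrow> 'b) \<Rightarrow> ('a \<times> 'b, 'k::field) mpoly" where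
  "hom_monom G \<phi> = (\<Prod>i \<in> pverts G. pvar (i, \<phi> i))"

definition hom_ideal ::
  "'a pair_pre_digraph \<Rightarrow> 'b pair_pre_digraph \<Rightarrow> ('a \<times> 'b, 'k::field) mpoly set" where
  "hom_ideal G H = Idl\<^bsub>poly_ring (hom_vars G H)\<^esub> (hom_monom G ` WHom G H)"

end

theory Submission
  imports Defs "HOL-Library.Function_Algebras" "HOL-Library.Product_Lexorder"
begin

text \<open>Every minimal vertex cover of the generators meets each column
  \<open>{(i, j) | i \<in> V(G)}\<close>, because the constant maps are weak homomorphisms, and a row is a
  cover. Since a prime generated by \<open>r\<close> variables has height \<open>r\<close>, every minimal cover
  meets every column exactly once if \<open>I\<close> is unmixed; for
  \<open>H = D\<^sub>m\<close> this is seen directly, as every cover contains a cover lying along a path of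
  \<open>G\<close>. Hence the product \<open>f\<close> of the variables of a column has order one along every
  minimal prime, and \<open>I\<^sup>(\<^sup>k\<^sup>+\<^sup>1\<^sup>) : f = I\<^sup>(\<^sup>k\<^sup>)\<close>. It remains to see that passing from a
  monomial ideal to its colon by a variable does not lower the depth: depth is measured by the
  vanishing of Koszul homology, and the grading by the degree in that variable shows that vanishing
  is inherited by the colon ideal.\<close>

section \<open>The Koszul complex\<close>

text \<open>A regular sequence on \<open>S/J\<close> need not stay regular on
  \<open>S/(J : x)\<close>, so a number is transported instead. For \<open>J\<close> inside the
  maximal ideal of \<open>S = K[V]\<close>, a regular sequence of length \<open>r\<close> in that
  ideal exists exactly if the Koszul homology of all \<open>n\<close> variables on
  \<open>S/J\<close> vanishes in degrees above \<open>n - r\<close>. One direction follows from long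
  exact sequences; the other builds the sequence by prime avoidance and so needs the Noetherian
  property. Homology is never formed as a quotient: chains have coefficients in \<open>S\<close>,
  and cycles and boundaries are compared modulo \<open>J\<close>. The colon step rests on the fact
  that the differential of the other variables preserves the degree in \<open>x\<close>, while
  multiplication by \<open>x\<close> raises it by one. Heights are suprema over all chains of
  primes, so the height of a variable prime needs a bound on arbitrary chains; it comes from
  counting linearly independent polynomials with bounded exponents. The linear order on the
  variables supplies a monomial order and the absence of zero divisors.\<close>

text \<open>A chain of the Koszul complex of \<open>xs\<close> is a function on the boolean lists of length
  \<open>length xs\<close>, which encode the subsets of \<open>xs\<close>. Splitting off the first entry by \<open>lo\<close>
  and \<open>hi\<close> makes the complex of \<open>x # xs\<close> the mapping cone of \<open>x\<close> on that of \<open>xs\<close>.\<close>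

definition lo :: "(bool list \<Rightarrow> 'a) \<Rightarrow> bool list \<Rightarrow> 'a" where
  "lo c = (\<lambda>L. c (False # L))"

definition hi :: "(bool list \<Rightarrow> 'a) \<Rightarrow> bool list \<Rightarrow> 'a" where
  "hi c = (\<lambda>L. c (True # L))"

definition bjoin :: "(bool list \<Rightarrow> 'a) \<Rightarrow> (bool list \<Rightarrow> 'a) \<Rightarrow> bool list \<Rightarrow> 'a::zero" where
  "bjoin u w = (\<lambda>L. case L of [] \<Rightarrow> 0 | b # M \<Rightarrow> if b then w M else u M)"

definition smul :: "'a \<Rightarrow> ('i \<Rightarrow> 'a) \<Rightarrow> 'i \<Rightarrow> 'a::times" where
  "smul a c = (\<lambda>L. a * c L)"

fun koszul_d :: "'a list \<Rightarrow> (bool list \<Rightarrow> 'a) \<Rightarrow> bool list \<Rightarrow> 'a::comm_ring_1" where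
  "koszul_d [] c = 0"
| "koszul_d (x # xs) c = bjoin (koszul_d xs (lo c) + smul x (hi c)) (- koszul_d xs (hi c))"

text \<open>Exterior multiplication by the basis vector of entry \<open>k\<close>; the sign on the
  \<open>hi\<close> part matches the sign of the mapping cone in \<open>koszul_d\<close>.\<close>

fun koszul_h :: "nat \<Rightarrow> (bool list \<Rightarrow> 'a) \<Rightarrow> bool list \<Rightarrow> 'a::comm_ring_1" where
  "koszul_h 0 c = bjoin 0 (lo c)"
| "koszul_h (Suc k) c = bjoin (koszul_h k (lo c)) (- koszul_h k (hi c))"

text \<open>The multiple by \<open>v\<close> of the generator in top exterior degree.\<close>

fun koszul_top :: "nat \<Rightarrow> 'a \<Rightarrow> bool list \<Rightarrow> 'a::comm_ring_1" where
  "koszul_top 0 v = (\<lambda>L. if L = [] then v else 0)"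
| "koszul_top (Suc n) v = bjoin 0 (koszul_top n v)"

lemma lo_simps [simp]:
  "lo (c + e) = lo c + lo e" "lo (- c') = - lo c'" "lo (c' - e') = lo c' - lo e'"
  "lo (bjoin u w) = u" "lo (smul a d) = smul a (lo d)" "lo 0 = 0"
  for c' :: "bool list \<Rightarrow> 'b::group_add"
  by (auto simp: lo_def bjoin_def smul_def fun_eq_iff)

lemma hi_simps [simp]:
  "hi (c + e) = hi c + hi e" "hi (- c') = - hi c'" "hi (c' - e') = hi c' - hi e'"
  "hi (bjoin u w) = w" "hi (smul a d) = smul a (hi d)" "hi 0 = 0"
  for c' :: "bool list \<Rightarrow> 'b::group_add"
  by (auto simp: hi_def bjoin_def smul_def fun_eq_iff)

lemma bjoin_simps:
  fixes u :: "bool list \<Rightarrow> 'a::comm_ring_1"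
  shows "bjoin u w + bjoin u' w' = bjoin (u + u') (w + w')"
    "- bjoin u w = bjoin (- u) (- w)"
    "bjoin u w - bjoin u' w' = bjoin (u - u') (w - w')"
    "smul a (bjoin u w) = bjoin (smul a u) (smul a w)"
    "bjoin 0 0 = (0 :: bool list \<Rightarrow> 'a)"
  by (auto simp: bjoin_def smul_def fun_eq_iff split: list.splits)

lemma smul_simps:
  fixes c :: "'i \<Rightarrow> 'a::comm_ring_1"
  shows "smul a (c + e) = smul a c + smul a e" "smul a (- c) = - smul a c"
    "smul a (c - e) = smul a c - smul a e" "smul a 0 = 0"
    "smul (a + b) c = smul a c + smul b c"
    "smul a (smul b c) = smul (a * b) c" "smul 0 c = 0"
  by (auto simp: smul_def fun_eq_iff algebra_simps)

lemma bjoin_lo_hi: "bjoin (lo c) (hi c) = c" if "c [] = 0"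
  using that by (auto simp: bjoin_def lo_def hi_def fun_eq_iff split: list.splits)

lemma koszul_d_0 [simp]: "koszul_d xs 0 = 0"
  by (induction xs)
    (simp_all only: koszul_d.simps lo_simps hi_simps smul_simps bjoin_simps add_0_left minus_zero)

lemma koszul_d_add: "koszul_d xs (c + e) = koszul_d xs c + koszul_d xs e"
  by (induction xs arbitrary: c e) (simp_all add: bjoin_simps smul_simps ac_simps)

lemma koszul_d_uminus: "koszul_d xs (- c) = - koszul_d xs c"
  by (induction xs arbitrary: c) (simp_all add: bjoin_simps smul_simps ac_simps)

lemma koszul_d_diff: "koszul_d xs (c - e) = koszul_d xs c - koszul_d xs e"
  using koszul_d_add[of xs c "- e"] by (simp add: koszul_d_uminus)

lemma koszul_d_smul: "koszul_d xs (smul a c) = smul a (koszul_d xs c)"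
  by (induction xs arbitrary: c) (simp_all add: bjoin_simps smul_simps mult.commute)

lemma koszul_d_d: "koszul_d xs (koszul_d xs c) = 0"
  by (induction xs arbitrary: c)
    (simp_all add: bjoin_simps koszul_d_add koszul_d_uminus koszul_d_smul smul_simps)

lemma koszul_h_add: "koszul_h k (c + e) = koszul_h k c + koszul_h k e"
  by (induction k arbitrary: c e) (simp_all add: bjoin_simps smul_simps)

lemma koszul_h_uminus: "koszul_h k (- c) = - koszul_h k c"
  by (induction k arbitrary: c) (simp_all add: bjoin_simps smul_simps)

lemma koszul_h_smul: "koszul_h k (smul a c) = smul a (koszul_h k c)"
  by (induction k arbitrary: c) (simp_all add: bjoin_simps smul_simps)

text \<open>Ring theory relative to a carrier \<open>S\<close> inside a type class ring: all
  arithmetic is that of the type, so its simplification rules apply, and \<open>S\<close> enters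
  only through membership.\<close>

locale subring_of_type =
  fixes S :: "'a::comm_ring_1 set"
  assumes zero_in [simp, intro]: "0 \<in> S" and one_in [simp, intro]: "1 \<in> S"
    and add_in [simp, intro]: "a \<in> S \<Longrightarrow> b \<in> S \<Longrightarrow> a + b \<in> S"
    and uminus_in [simp, intro]: "a \<in> S \<Longrightarrow> - a \<in> S"
    and mult_in [simp, intro]: "a \<in> S \<Longrightarrow> b \<in> S \<Longrightarrow> a * b \<in> S"
begin

lemma diff_in [simp, intro]: "a \<in> S \<Longrightarrow> b \<in> S \<Longrightarrow> a - b \<in> S"
  using add_in[of a "- b"] by simp

definition ideal_in :: "'a set \<Rightarrow> bool" where
  "ideal_in J \<longleftrightarrow> J \<subseteq> S \<and> 0 \<in> J \<and> (\<forall>a\<in>J. \<forall>b\<in>J. a + b \<in> J) \<and> (\<forall>s\<in>S. \<forall>a\<in>J. s * a \<in> J)"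

lemma ideal_inD:
  assumes "ideal_in J"
  shows "J \<subseteq> S" "0 \<in> J" "\<And>a b. a \<in> J \<Longrightarrow> b \<in> J \<Longrightarrow> a + b \<in> J"
    "\<And>s a. s \<in> S \<Longrightarrow> a \<in> J \<Longrightarrow> s * a \<in> J" "\<And>s a. s \<in> S \<Longrightarrow> a \<in> J \<Longrightarrow> a * s \<in> J"
    "\<And>a. a \<in> J \<Longrightarrow> a \<in> S"
  using assms by (auto simp: ideal_in_def mult.commute)

lemma ideal_in_uminus: "ideal_in J \<Longrightarrow> a \<in> J \<Longrightarrow> - a \<in> J"
  using ideal_inD(4)[of J "- 1" a] by simp

lemma ideal_in_diff: "ideal_in J \<Longrightarrow> a \<in> J \<Longrightarrow> b \<in> J \<Longrightarrow> a - b \<in> J"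
  using ideal_inD(3)[of J a "- b"] ideal_in_uminus by simp

definition plus_mult :: "'a set \<Rightarrow> 'a \<Rightarrow> 'a set" where
  "plus_mult J a = {a * s + j | s j. s \<in> S \<and> j \<in> J}"

lemma ideal_in_plus_mult:
  assumes "ideal_in J" "a \<in> S"
  shows "ideal_in (plus_mult J a)"
  unfolding ideal_in_def
proof (intro conjI ballI)
  note J = ideal_inD[OF assms(1)]
  show "plus_mult J a \<subseteq> S"
    using J(1) assms(2) by (auto simp: plus_mult_def)
  show "0 \<in> plus_mult J a"
    using J(2) by (force simp: plus_mult_def)
  fix p q assume p: "p \<in> plus_mult J a"
  { assume "q \<in> plus_mult J a"
    then obtain s j s' j' where "s \<in> S" "j \<in> J" "s' \<in> S" "j' \<in> J"
      "p = a * s + j" "q = a * s' + j'"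
      using p by (auto simp: plus_mult_def)
    then have "p + q = a * (s + s') + (j + j')" "s + s' \<in> S" "j + j' \<in> J"
      using J by (auto simp: algebra_simps)
    then show "p + q \<in> plus_mult J a" unfolding plus_mult_def by blast }
next
  note J = ideal_inD[OF assms(1)]
  fix s p assume s: "s \<in> S" and p: "p \<in> plus_mult J a"
  obtain t j where "t \<in> S" "j \<in> J" "p = a * t + j"
    using p by (auto simp: plus_mult_def)
  then have "s * p = a * (s * t) + s * j" "s * t \<in> S" "s * j \<in> J"
    using J s by (auto simp: distrib_left mult.left_commute)
  then show "s * p \<in> plus_mult J a" unfolding plus_mult_def by blast
qed

lemma plus_mult_superset: "J \<subseteq> plus_mult J a"
proof
  fix j assume "j \<in> J"
  then have "j = a * 0 + j \<and> 0 \<in> S \<and> j \<in> J" by simp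
  then show "j \<in> plus_mult J a" unfolding plus_mult_def by blast
qed

lemma plus_mult_gen: "ideal_in J \<Longrightarrow> s \<in> S \<Longrightarrow> a * s \<in> plus_mult J a"
proof -
  assume "ideal_in J" "s \<in> S"
  then have "a * s = a * s + 0 \<and> s \<in> S \<and> 0 \<in> J" using ideal_inD(2) by simp
  then show ?thesis unfolding plus_mult_def by blast
qed

definition fn_in :: "'a set \<Rightarrow> ('i \<Rightarrow> 'a) \<Rightarrow> bool" where
  "fn_in J c \<longleftrightarrow> (\<forall>L. c L \<in> J)"

lemma fn_in_mono: "fn_in J c \<Longrightarrow> J \<subseteq> J' \<Longrightarrow> fn_in J' c"
  by (auto simp: fn_in_def)

lemma ideal_in_S: "ideal_in S"
  by (auto simp: ideal_in_def)

lemma fn_in_ops: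
  assumes "ideal_in J"
  shows "fn_in J c \<Longrightarrow> fn_in J e \<Longrightarrow> fn_in J (c + e)"
    "fn_in J c \<Longrightarrow> fn_in J e \<Longrightarrow> fn_in J (c - e)"
    "fn_in J c \<Longrightarrow> fn_in J (- c)" "fn_in J 0" "a \<in> S \<Longrightarrow> fn_in J c \<Longrightarrow> fn_in J (smul a c)"
  using ideal_inD[OF assms] ideal_in_diff[OF assms] ideal_in_uminus[OF assms]
  by (auto simp: fn_in_def smul_def)

lemma fn_in_bjoin: "ideal_in J \<Longrightarrow> fn_in J (bjoin u w) \<longleftrightarrow> fn_in J u \<and> fn_in J w"
  unfolding fn_in_def bjoin_def using ideal_inD(2)[of J]
  by (auto split: list.splits if_splits)

lemma fn_in_lo: "fn_in J c \<Longrightarrow> fn_in J (lo c)" and fn_in_hi: "fn_in J c \<Longrightarrow> fn_in J (hi c)"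
  by (auto simp: fn_in_def lo_def hi_def)

lemma fn_in_koszul_d:
  assumes "ideal_in J" "set xs \<subseteq> S"
  shows "fn_in J c \<Longrightarrow> fn_in J (koszul_d xs c)"
  using assms(2)
  by (induction xs arbitrary: c)
    (simp_all add: fn_in_bjoin[OF assms(1)] fn_in_lo fn_in_hi fn_in_ops[OF assms(1)])

lemma fn_in_koszul_h:
  assumes "ideal_in J"
  shows "fn_in J c \<Longrightarrow> fn_in J (koszul_h k c)"
  by (induction k arbitrary: c)
    (simp_all add: fn_in_bjoin[OF assms(1)] fn_in_lo fn_in_hi fn_in_ops[OF assms(1)])

text \<open>Degrees are integers so that the boundary can always be said to lie in degree
  \<open>i - 1\<close>; negative degrees contain only the zero chain.\<close>

definition chain :: "nat \<Rightarrow> int \<Rightarrow> (bool list \<Rightarrow> 'a) set" where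
  "chain n i = {c. fn_in S c \<and> (\<forall>L. c L \<noteq> 0 \<longrightarrow> length L = n \<and> int (count_list L True) = i)}"

lemma chain_ops:
  "c \<in> chain n i \<Longrightarrow> e \<in> chain n i \<Longrightarrow> c + e \<in> chain n i"
  "c \<in> chain n i \<Longrightarrow> e \<in> chain n i \<Longrightarrow> c - e \<in> chain n i"
  "c \<in> chain n i \<Longrightarrow> - c \<in> chain n i"
  "0 \<in> chain n i"
  "a \<in> S \<Longrightarrow> c \<in> chain n i \<Longrightarrow> smul a c \<in> chain n i"
  unfolding chain_def
  by (auto simp: smul_def fn_in_def) (metis add.right_neutral, metis add.right_neutral, force, force, force, force)

lemma chain_bjoin:
  assumes "u \<in> chain n i" "w \<in> chain n (i - 1)"
  shows "bjoin u w \<in> chain (Suc n) i"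
  using assms fn_in_bjoin[OF ideal_in_S] unfolding chain_def
  by (fastforce simp: bjoin_def split: list.splits if_splits)

lemma chain_lo: "c \<in> chain (Suc n) i \<Longrightarrow> lo c \<in> chain n i"
  and chain_hi: "c \<in> chain (Suc n) i \<Longrightarrow> hi c \<in> chain n (i - 1)"
  unfolding chain_def by (fastforce simp: lo_def hi_def fn_in_def)+

lemma chain_Nil: "c \<in> chain (Suc n) i \<Longrightarrow> c [] = 0"
  unfolding chain_def by force

lemma chain_bjoin_lo_hi: "c \<in> chain (Suc n) i \<Longrightarrow> bjoin (lo c) (hi c) = c"
  using bjoin_lo_hi chain_Nil by blast

lemma chain_fn_in: "c \<in> chain n i \<Longrightarrow> fn_in S c"
  by (auto simp: chain_def)

lemma chain_beyond: "c = 0" if "c \<in> chain n i" "i > int n"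
proof
  fix L
  have "count_list L True \<le> length L" by (rule count_le_length)
  then show "c L = 0 L" using that by (force simp: chain_def)
qed

lemma chain_koszul_d:
  "set xs \<subseteq> S \<Longrightarrow> c \<in> chain (length xs) i \<Longrightarrow> koszul_d xs c \<in> chain (length xs) (i - 1)"
proof (induction xs arbitrary: c i)
  case (Cons x xs)
  then show ?case
    using Cons.IH[of "lo c" i] Cons.IH[of "hi c" "i - 1"] chain_lo chain_hi
    by (auto intro!: chain_bjoin chain_ops)
qed (simp add: chain_ops)

lemma chain_koszul_h:
  "k < n \<Longrightarrow> c \<in> chain n i \<Longrightarrow> koszul_h k c \<in> chain n (i + 1)"
proof (induction k arbitrary: c i n)
  case 0
  then obtain m where "n = Suc m" by (cases n) auto
  then show ?case using 0 by (auto intro!: chain_bjoin chain_ops chain_lo)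
next
  case (Suc k)
  then obtain m where "n = Suc m" "k < m" by (cases n) auto
  then show ?case using Suc.prems Suc.IH[of m "lo c" i] Suc.IH[of m "hi c" "i - 1"]
      chain_lo[of c m i] chain_hi[of c m i]
    by (auto intro!: chain_bjoin chain_ops)
qed

text \<open>For the head of the list this is the standard homotopy of a mapping cone. Deeper in the
  list the homotopy acts on both halves, and the two mixed terms containing the head cancel because
  of the sign on \<open>hi\<close>.\<close>

lemma koszul_homotopy:
  "k < length xs \<Longrightarrow> c \<in> chain (length xs) i \<Longrightarrow>
    koszul_d xs (koszul_h k c) + koszul_h k (koszul_d xs c) = smul (xs ! k) c"
proof (induction k arbitrary: xs c i)
  case 0
  then obtain x ys where xs: "xs = x # ys" by (cases xs) auto
  then have "bjoin (lo c) (hi c) = c" using 0 by (auto intro: chain_bjoin_lo_hi)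
  then have "smul x c = bjoin (smul x (lo c)) (smul x (hi c))" by (metis bjoin_simps(4))
  then show ?case by (simp add: xs bjoin_simps)
next
  case (Suc k)
  then obtain x ys where xs: "xs = x # ys" "k < length ys" by (cases xs) auto
  have c: "bjoin (lo c) (hi c) = c" using Suc.prems xs by (auto intro: chain_bjoin_lo_hi)
  have lh: "lo c \<in> chain (length ys) i" "hi c \<in> chain (length ys) (i - 1)"
    using Suc.prems xs by (auto intro: chain_lo chain_hi)
  have "koszul_d xs (koszul_h (Suc k) c) + koszul_h (Suc k) (koszul_d xs c) =
      bjoin (koszul_d ys (koszul_h k (lo c)) + koszul_h k (koszul_d ys (lo c)))
        (koszul_d ys (koszul_h k (hi c)) + koszul_h k (koszul_d ys (hi c)))"
    by (simp add: xs bjoin_simps koszul_d_uminus koszul_h_add koszul_h_uminus koszul_h_smul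
        smul_simps add_ac)
  also have "\<dots> = smul (ys ! k) c"
    by (subst (3) c[symmetric]) (simp only: Suc.IH[OF xs(2) lh(1)] Suc.IH[OF xs(2) lh(2)] bjoin_simps)
  finally show ?case by (simp add: xs)
qed

lemma koszul_top_chain: "v \<in> S \<Longrightarrow> koszul_top n v \<in> chain n (int n)"
proof (induction n)
  case (Suc n)
  then show ?case by (auto intro!: chain_bjoin chain_ops)
qed (auto simp: chain_def fn_in_def)

lemma koszul_top_cycle:
  assumes "ideal_in J" "\<forall>x\<in>set xs. x * v \<in> J" "set xs \<subseteq> S" "v \<in> S"
  shows "fn_in J (koszul_d xs (koszul_top (length xs) v))"
  using assms(2,3)
proof (induction xs)
  case (Cons x xs)
  have "fn_in J (smul x (koszul_top n v))" for n
    using Cons.prems ideal_inD(2)[OF assms(1)]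
    by (induction n) (auto simp: bjoin_simps fn_in_bjoin[OF assms(1)] smul_simps fn_in_ops[OF assms(1)],
      auto simp: fn_in_def smul_def)
  then show ?case using Cons
    by (auto simp: fn_in_bjoin[OF assms(1)] intro!: fn_in_ops[OF assms(1)])
qed (auto simp: fn_in_ops[OF assms(1)])

lemma koszul_top_value: "koszul_top n v (replicate n True) = v"
  by (induction n) (auto simp: bjoin_def)

section \<open>Vanishing of Koszul homology and its behaviour modulo a regular element\<close>

definition koszul_exact :: "'a list \<Rightarrow> 'a set \<Rightarrow> int \<Rightarrow> bool" where
  "koszul_exact xs J i \<longleftrightarrow>
    (\<forall>c \<in> chain (length xs) i. fn_in J (koszul_d xs c) \<longrightarrow>
      (\<exists>e \<in> chain (length xs) (i + 1). fn_in J (c - koszul_d xs e)))"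

lemma koszul_exact_beyond:
  "ideal_in J \<Longrightarrow> i > int (length xs) \<Longrightarrow> koszul_exact xs J i"
  unfolding koszul_exact_def
  by (intro ballI impI bexI[of _ 0]) (auto dest: chain_beyond simp: fn_in_ops chain_ops)

text \<open>Top homology consists of the elements of \<open>S/J\<close> killed by \<open>xs\<close>:
  there is no nonzero chain in higher degree, so a top cycle bounds modulo \<open>J\<close> only if
  its coefficient lies in \<open>J\<close>.\<close>

lemma koszul_exact_no_socle:
  assumes "ideal_in J" "set xs \<subseteq> S" "koszul_exact xs J (int (length xs))"
    "\<forall>x\<in>set xs. x * v \<in> J" "v \<in> S"
  shows "v \<in> J"
proof -
  let ?t = "koszul_top (length xs) v"
  obtain e where e: "e \<in> chain (length xs) (int (length xs) + 1)" "fn_in J (?t - koszul_d xs e)"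
    using assms koszul_top_cycle koszul_top_chain unfolding koszul_exact_def by blast
  then have "e = 0" using chain_beyond by simp
  then have "?t (replicate (length xs) True) \<in> J" using e(2) by (simp add: fn_in_def)
  then show ?thesis by (simp add: koszul_top_value)
qed

text \<open>Elements of the ideal generated by \<open>xs\<close> act as zero on Koszul homology.\<close>

definition null_homotopic :: "'a list \<Rightarrow> 'a set \<Rightarrow> 'a \<Rightarrow> bool" where
  "null_homotopic xs J a \<longleftrightarrow>
    (\<forall>i. \<forall>c \<in> chain (length xs) i. fn_in J (koszul_d xs c) \<longrightarrow>
      (\<exists>h \<in> chain (length xs) (i + 1). fn_in J (koszul_d xs h - smul a c)))"

lemma null_homotopic_ideal:
  assumes "ideal_in J" "set xs \<subseteq> S"
  shows "ideal_in {a \<in> S. null_homotopic xs J a}"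
proof -
  note ops = fn_in_ops[OF assms(1)]
  have 0: "null_homotopic xs J 0"
    unfolding null_homotopic_def
    by (intro allI ballI impI bexI[of _ 0]) (auto simp: smul_simps ops chain_ops)
  have add: "null_homotopic xs J (a + b)" if "null_homotopic xs J a" "null_homotopic xs J b" for a b
    unfolding null_homotopic_def
  proof (intro allI ballI impI)
    fix i c assume "c \<in> chain (length xs) i" "fn_in J (koszul_d xs c)"
    then have "\<exists>h \<in> chain (length xs) (i + 1). fn_in J (koszul_d xs h - smul a c)"
      "\<exists>g \<in> chain (length xs) (i + 1). fn_in J (koszul_d xs g - smul b c)"
      using that unfolding null_homotopic_def by blast+
    then obtain h g where h: "h \<in> chain (length xs) (i + 1)" "fn_in J (koszul_d xs h - smul a c)"
      "g \<in> chain (length xs) (i + 1)" "fn_in J (koszul_d xs g - smul b c)"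
      by blast
    have "koszul_d xs (h + g) - smul (a + b) c
      = (koszul_d xs h - smul a c) + (koszul_d xs g - smul b c)"
      by (simp add: koszul_d_add smul_simps)
    then have "fn_in J (koszul_d xs (h + g) - smul (a + b) c)"
      using ops(1)[OF h(2,4)] by simp
    then show "\<exists>h \<in> chain (length xs) (i + 1). fn_in J (koszul_d xs h - smul (a + b) c)"
      using chain_ops(1)[OF h(1,3)] by blast
  qed
  have mul: "null_homotopic xs J (s * a)" if "null_homotopic xs J a" "s \<in> S" for a s
    unfolding null_homotopic_def
  proof (intro allI ballI impI)
    fix i c assume "c \<in> chain (length xs) i" "fn_in J (koszul_d xs c)"
    then have "\<exists>h \<in> chain (length xs) (i + 1). fn_in J (koszul_d xs h - smul a c)"
      using that unfolding null_homotopic_def by blast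
    then obtain h where h: "h \<in> chain (length xs) (i + 1)" "fn_in J (koszul_d xs h - smul a c)"
      by blast
    have "koszul_d xs (smul s h) - smul (s * a) c = smul s (koszul_d xs h - smul a c)"
      by (simp add: koszul_d_smul smul_simps)
    then have "fn_in J (koszul_d xs (smul s h) - smul (s * a) c)"
      using ops(5)[OF that(2) h(2)] by simp
    then show "\<exists>h \<in> chain (length xs) (i + 1). fn_in J (koszul_d xs h - smul (s * a) c)"
      using chain_ops(5)[OF that(2) h(1)] by blast
  qed
  show ?thesis unfolding ideal_in_def using 0 add mul by auto
qed

lemma null_homotopic_gen:
  assumes "ideal_in J" "set xs \<subseteq> S" "x \<in> set xs"
  shows "null_homotopic xs J x"
  unfolding null_homotopic_def
proof (intro allI ballI impI)
  fix i c assume c: "c \<in> chain (length xs) i" "fn_in J (koszul_d xs c)"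
  obtain k where k: "k < length xs" "x = xs ! k" using assms(3) by (auto simp: in_set_conv_nth)
  have "koszul_d xs (koszul_h k c) - smul x c = - koszul_h k (koszul_d xs c)"
    using koszul_homotopy[OF k(1) c(1)] k(2) by (simp add: algebra_simps)
  moreover have "fn_in J (- koszul_h k (koszul_d xs c))"
    using c fn_in_koszul_h[OF assms(1)] fn_in_ops(3)[OF assms(1)] by blast
  ultimately have "fn_in J (koszul_d xs (koszul_h k c) - smul x c)" by simp
  then show "\<exists>h \<in> chain (length xs) (i + 1). fn_in J (koszul_d xs h - smul x c)"
    using chain_koszul_h[OF k(1) c(1)] by blast
qed

lemma choose_quotient:
  assumes "ideal_in J" "fn_in (plus_mult J a) c" "c \<in> chain n i"
  obtains k where "k \<in> chain n i" "fn_in J (c - smul a k)"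
proof -
  \<comment> \<open>The last conjunct fixes the quotient to be zero where \<open>c\<close> is zero,
    so that the chosen quotients again form a chain of the same degree.\<close>
  have "\<exists>s. s \<in> S \<and> c L - a * s \<in> J \<and> (c L = 0 \<longrightarrow> s = 0)" for L
  proof (cases "c L = 0")
    case True
    then show ?thesis using ideal_inD(2)[OF assms(1)] by auto
  next
    case False
    have "c L \<in> plus_mult J a" using assms(2) by (auto simp: fn_in_def)
    then show ?thesis using False by (auto simp: plus_mult_def)
  qed
  then obtain k where k: "\<And>L. k L \<in> S \<and> c L - a * k L \<in> J \<and> (c L = 0 \<longrightarrow> k L = 0)" by metis
  have "k \<in> chain n i" using k assms(3) by (auto simp: chain_def fn_in_def)
  moreover have "fn_in J (c - smul a k)" using k by (auto simp: fn_in_def smul_def)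
  ultimately show ?thesis by (rule that)
qed

definition regular_on :: "'a set \<Rightarrow> 'a \<Rightarrow> bool" where
  "regular_on J a \<longleftrightarrow> (\<forall>s\<in>S. a * s \<in> J \<longrightarrow> s \<in> J)"

lemma regular_on_fn: "regular_on J a \<Longrightarrow> fn_in S c \<Longrightarrow> fn_in J (smul a c) \<Longrightarrow> fn_in J c"
  by (auto simp: regular_on_def fn_in_def smul_def)

text \<open>In the long exact sequence of multiplication by \<open>a\<close> on \<open>S/J\<close>,
  the kernel of \<open>a\<close> on degree \<open>i\<close> is the image of degree
  \<open>i + 1\<close> over \<open>S/(J, a)\<close>. Here \<open>a\<close> acts as zero, so that
  kernel is all of degree \<open>i\<close>.\<close>

lemma koszul_exact_lift:
  assumes J: "ideal_in J" and xs: "set xs \<subseteq> S" and a: "a \<in> S" "regular_on J a"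
    and nh: "null_homotopic xs J a" and ex: "koszul_exact xs (plus_mult J a) (i + 1)"
  shows "koszul_exact xs J i"
  unfolding koszul_exact_def
proof (intro ballI impI)
  note ops = fn_in_ops[OF J]
  fix c assume c: "c \<in> chain (length xs) i" "fn_in J (koszul_d xs c)"
  obtain h where h: "h \<in> chain (length xs) (i + 1)" "fn_in J (koszul_d xs h - smul a c)"
    using nh c unfolding null_homotopic_def by blast
  have "fn_in (plus_mult J a) (koszul_d xs h)"
  proof -
    have "fn_in (plus_mult J a) (smul a c)"
      using plus_mult_gen[OF J] chain_fn_in[OF c(1)] by (auto simp: fn_in_def smul_def)
    moreover have "fn_in (plus_mult J a) (koszul_d xs h - smul a c)"
      by (rule fn_in_mono[OF h(2) plus_mult_superset])
    ultimately have "fn_in (plus_mult J a) ((koszul_d xs h - smul a c) + smul a c)"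
      by (intro fn_in_ops(1)[OF ideal_in_plus_mult[OF J a(1)]])
    then show ?thesis by simp
  qed
  then obtain g where g: "g \<in> chain (length xs) (i + 1 + 1)"
    "fn_in (plus_mult J a) (h - koszul_d xs g)"
    using ex h(1) unfolding koszul_exact_def by blast
  have "h - koszul_d xs g \<in> chain (length xs) (i + 1)"
    using chain_ops(2)[OF h(1), of "koszul_d xs g"] chain_koszul_d[OF xs g(1)]
    by (simp add: add.commute)
  \<comment> \<open>Here \<open>a c\<close> is the boundary of \<open>h\<close> modulo
    \<open>J\<close>. Removing a boundary from \<open>h\<close> leaves a multiple
    \<open>a k\<close>, so \<open>a c\<close> and \<open>a d k\<close> agree modulo
    \<open>J\<close>, and regularity cancels \<open>a\<close>.\<close>
  from choose_quotient[OF J g(2) this] obtain k where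
    k: "k \<in> chain (length xs) (i + 1)" "fn_in J (h - koszul_d xs g - smul a k)" by blast
  have "fn_in J (koszul_d xs (h - koszul_d xs g - smul a k))"
    using fn_in_koszul_d[OF J xs] k(2) .
  then have "fn_in J (koszul_d xs h - smul a (koszul_d xs k))"
    by (simp add: koszul_d_diff koszul_d_d koszul_d_smul)
  then have "fn_in J ((koszul_d xs h - smul a (koszul_d xs k)) - (koszul_d xs h - smul a c))"
    using h(2) ops by blast
  then have "fn_in J (smul a (c - koszul_d xs k))" by (simp add: smul_simps)
  moreover have "fn_in S (c - koszul_d xs k)"
    using chain_fn_in[OF c(1)] chain_fn_in[OF chain_koszul_d[OF xs k(1)]] fn_in_ops[OF ideal_in_S]
    by blast
  ultimately have "fn_in J (c - koszul_d xs k)" using regular_on_fn[OF a(2)] by blast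
  then show "\<exists>e \<in> chain (length xs) (i + 1). fn_in J (c - koszul_d xs e)" using k(1) by blast
qed

text \<open>The same long exact sequence places degree \<open>i\<close> over \<open>S/(J, a)\<close>
  between degrees \<open>i\<close> and \<open>i - 1\<close> over \<open>S/J\<close>.\<close>

lemma koszul_exact_quotient:
  assumes J: "ideal_in J" and xs: "set xs \<subseteq> S" and a: "a \<in> S" "regular_on J a"
    and ex: "koszul_exact xs J i" "koszul_exact xs J (i - 1)"
  shows "koszul_exact xs (plus_mult J a) i"
  unfolding koszul_exact_def
proof (intro ballI impI)
  note ops = fn_in_ops[OF J]
  fix c assume c: "c \<in> chain (length xs) i" "fn_in (plus_mult J a) (koszul_d xs c)"
  from choose_quotient[OF J c(2) chain_koszul_d[OF xs c(1)]] obtain k where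
    k: "k \<in> chain (length xs) (i - 1)" "fn_in J (koszul_d xs c - smul a k)" by blast
  have "fn_in J (koszul_d xs (koszul_d xs c - smul a k))"
    using fn_in_koszul_d[OF J xs] k(2) .
  then have "fn_in J (- smul a (koszul_d xs k))"
    by (simp add: koszul_d_diff koszul_d_d koszul_d_smul)
  then have "fn_in J (smul a (koszul_d xs k))" using ops(3) by fastforce
  then have "fn_in J (koszul_d xs k)"
    using regular_on_fn[OF a(2)] chain_fn_in[OF chain_koszul_d[OF xs k(1)]] by blast
  then obtain g where g: "g \<in> chain (length xs) i" "fn_in J (k - koszul_d xs g)"
    using ex(2) k(1) unfolding koszul_exact_def by fastforce
  \<comment> \<open>The correction \<open>a g\<close> is invisible modulo \<open>(J, a)\<close> and
    turns \<open>c\<close> into a cycle modulo \<open>J\<close>.\<close>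
  have "koszul_d xs (c - smul a g) = (koszul_d xs c - smul a k) + smul a (k - koszul_d xs g)"
    by (simp add: koszul_d_diff koszul_d_smul smul_simps)
  then have "fn_in J (koszul_d xs (c - smul a g))"
    using ops(1)[OF k(2) ops(5)[OF a(1) g(2)]] by simp
  moreover have "c - smul a g \<in> chain (length xs) i" using c(1) g(1) a(1) by (blast intro: chain_ops)
  ultimately obtain e where e: "e \<in> chain (length xs) (i + 1)"
    "fn_in J (c - smul a g - koszul_d xs e)"
    using ex(1) unfolding koszul_exact_def by blast
  have "fn_in (plus_mult J a) (smul a g)"
    using plus_mult_gen[OF J] chain_fn_in[OF g(1)] by (auto simp: fn_in_def smul_def)
  moreover have "fn_in (plus_mult J a) (c - smul a g - koszul_d xs e)"
    by (rule fn_in_mono[OF e(2) plus_mult_superset])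
  ultimately have "fn_in (plus_mult J a) ((c - smul a g - koszul_d xs e) + smul a g)"
    by (intro fn_in_ops(1)[OF ideal_in_plus_mult[OF J a(1)]])
  then have "fn_in (plus_mult J a) (c - koszul_d xs e)" by (simp add: algebra_simps)
  then show "\<exists>e \<in> chain (length xs) (i + 1). fn_in (plus_mult J a) (c - koszul_d xs e)"
    using e(1) by blast
qed

end

section \<open>Regular sequences and Koszul homology over Noetherian rings\<close>

context subring_of_type
begin

section \<open>Maximal annihilators and the existence of regular elements\<close>

definition acc_ideals :: bool where
  "acc_ideals \<longleftrightarrow> \<not> (\<exists>I. \<forall>n::nat. ideal_in (I n) \<and> I n \<subset> I (Suc n))"

definition annih :: "'a set \<Rightarrow> 'a \<Rightarrow> 'a set" where
  "annih J v = {s \<in> S. s * v \<in> J}"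

lemma ideal_in_annih: "ideal_in J \<Longrightarrow> v \<in> S \<Longrightarrow> ideal_in (annih J v)"
  by (auto simp: ideal_in_def annih_def distrib_right mult.assoc)

lemma prod_in: "finite A \<Longrightarrow> (\<And>x. x \<in> A \<Longrightarrow> f x \<in> S) \<Longrightarrow> prod f A \<in> S"
  by (induction A rule: finite_induct) auto

lemma ideal_in_sum: "ideal_in J \<Longrightarrow> (\<And>x. x \<in> A \<Longrightarrow> f x \<in> J) \<Longrightarrow> sum f A \<in> J"
  by (induction A rule: infinite_finite_induct) (auto dest: ideal_inD)

lemma ideal_in_prod:
  assumes "ideal_in J" "finite A" "x \<in> A" "f x \<in> J" "\<And>y. y \<in> A \<Longrightarrow> f y \<in> S"
  shows "prod f A \<in> J"
proof -
  have "prod f A = f x * prod f (A - {x})" using assms by (simp add: prod.remove)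
  moreover have "prod f (A - {x}) \<in> S" using assms by (intro prod_in) auto
  ultimately show ?thesis using assms ideal_inD(5) by metis
qed

text \<open>The maximal associated primes of \<open>S/J\<close>; under the ascending chain condition
  their union is the set of zero divisors on \<open>S/J\<close>.\<close>

definition max_annihs :: "'a set \<Rightarrow> 'a set set" where
  "max_annihs J = {annih J v | v. v \<in> S - J \<and>
     (\<forall>w \<in> S - J. annih J v \<subseteq> annih J w \<longrightarrow> annih J w = annih J v)}"

text \<open>Otherwise every annihilator above that of \<open>v\<close> could be enlarged, and
  iterating a choice would give an infinite strictly ascending chain of ideals.\<close>

lemma annih_subset_max:
  assumes "acc_ideals" "ideal_in J" "v \<in> S - J"
  shows "\<exists>P \<in> max_annihs J. annih J v \<subseteq> P"
proof (rule ccontr)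
  assume not: "\<not> ?thesis"
  define Q where "Q = {w \<in> S - J. annih J v \<subseteq> annih J w}"
  define R where "R w w' \<longleftrightarrow> w' \<in> Q \<and> annih J w \<subset> annih J w'" for w w'
  have step: "\<exists>w'. R w w'" if w: "w \<in> Q" for w
  proof (rule ccontr)
    assume no: "\<not> ?thesis"
    have wQ: "w \<in> S - J" "annih J v \<subseteq> annih J w" using w by (auto simp: Q_def)
    have "annih J u = annih J w" if u: "u \<in> S - J" "annih J w \<subseteq> annih J u" for u
    proof -
      have "u \<in> Q" using u wQ by (simp add: Q_def subset_trans[OF wQ(2)])
      then show ?thesis using no u(2) by (auto simp: R_def)
    qed
    then have "annih J w \<in> max_annihs J" unfolding max_annihs_def using wQ(1) by blast
    then show False using not wQ(2) by blast
  qed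
  define f where "f w = (SOME w'. R w w')" for w
  have f: "R w (f w)" if "w \<in> Q" for w
    unfolding f_def using step[OF that] by (rule someI_ex)
  define g where "g = (\<lambda>n. (f ^^ n) v)"
  have Q: "g n \<in> Q" for n
  proof (induction n)
    case 0
    show ?case using assms(3) by (simp add: g_def Q_def)
  next
    case (Suc n)
    show ?case using f[OF Suc] by (simp add: g_def R_def)
  qed
  then have "ideal_in (annih J (g n)) \<and> annih J (g n) \<subset> annih J (g (Suc n))" for n
    using f[OF Q[of n]] ideal_in_annih[OF assms(2), of "g n"] Q[of n] by (simp add: g_def R_def Q_def)
  then have "\<exists>I. \<forall>n::nat. ideal_in (I n) \<and> I n \<subset> I (Suc n)"
    by (intro exI[of _ "\<lambda>n. annih J (g n)"]) blast
  then show False using assms(1) unfolding acc_ideals_def by blast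
qed

text \<open>If \<open>a\<close> does not kill \<open>v\<close>, then \<open>a * v\<close> is nonzero
  modulo \<open>J\<close> and its annihilator contains that of \<open>v\<close>. By maximality they
  agree, and \<open>b\<close> kills \<open>a * v\<close>.\<close>

lemma max_annihs_prime:
  assumes "ideal_in J" "P \<in> max_annihs J" "a \<in> S" "b \<in> S" "a * b \<in> P"
  shows "a \<in> P \<or> b \<in> P"
proof (rule ccontr)
  assume n: "\<not> (a \<in> P \<or> b \<in> P)"
  obtain v where v: "v \<in> S - J" "P = annih J v"
    "\<And>w. w \<in> S - J \<Longrightarrow> annih J v \<subseteq> annih J w \<Longrightarrow> annih J w = annih J v"
    using assms(2) unfolding max_annihs_def by blast
  have "a * v \<in> S - J" using n v assms(3) by (auto simp: annih_def)
  moreover have "annih J v \<subseteq> annih J (a * v)"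
  proof
    fix t assume "t \<in> annih J v"
    then show "t \<in> annih J (a * v)"
      using ideal_inD(4)[OF assms(1) assms(3), of "t * v"] by (simp add: annih_def mult_ac)
  qed
  ultimately have "annih J (a * v) = P" using v by blast
  moreover have "b \<in> annih J (a * v)" using assms(4,5) v(2) by (auto simp: annih_def mult_ac)
  ultimately show False using n by blast
qed

lemma max_annihs_props:
  assumes "ideal_in J" "P \<in> max_annihs J"
  shows "ideal_in P" "1 \<notin> P"
  using assms ideal_in_annih unfolding max_annihs_def by (auto simp: annih_def)

lemma max_annihs_incomparable:
  assumes "P \<in> max_annihs J" "Q \<in> max_annihs J" "P \<noteq> Q"
  shows "\<not> P \<subseteq> Q"
  using assms unfolding max_annihs_def by auto

lemma max_annihs_prod:
  assumes "ideal_in J" "P \<in> max_annihs J" "finite A" "\<And>x. x \<in> A \<Longrightarrow> f x \<in> S - P"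
  shows "prod f A \<notin> P"
  using assms(3,4)
proof (induction A rule: finite_induct)
  case empty
  then show ?case using max_annihs_props[OF assms(1,2)] by simp
next
  case (insert x A)
  then have "prod f A \<in> S" by (intro prod_in) auto
  then show ?case using insert max_annihs_prime[OF assms(1,2), of "f x" "prod f A"] by auto
qed

text \<open>Among infinitely many witnesses, some \<open>v n\<close> lies in the ideal of
  \<open>J\<close> and the earlier ones. A product of elements of the earlier primes avoiding
  \<open>P n\<close> kills those earlier witnesses, hence also \<open>v n\<close>, which contradicts
  primality of \<open>P n\<close>.\<close>

lemma finite_max_annihs:
  assumes "acc_ideals" "ideal_in J"
  shows "finite (max_annihs J)"
proof (rule ccontr)
  assume "infinite (max_annihs J)"
  then obtain P :: "nat \<Rightarrow> 'a set" where P: "inj P" "range P \<subseteq> max_annihs J"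
    using infinite_countable_subset by blast
  have "\<exists>v. v \<in> S - J \<and> P n = annih J v" for n
    using P(2) unfolding max_annihs_def by blast
  then obtain v where v: "\<And>n. v n \<in> S - J" "\<And>n. P n = annih J (v n)" by metis
  \<comment> \<open>\<open>L n\<close> is the ideal generated by \<open>J\<close> and
    \<open>v 0, ..., v (n - 1)\<close>.\<close>
  define L where "L = rec_nat J (\<lambda>n A. plus_mult A (v n))"
  have L: "L 0 = J" "L (Suc n) = plus_mult (L n) (v n)" for n by (auto simp: L_def)
  have idl: "ideal_in (L n)" for n
    by (induction n) (use assms(2) v(1) in \<open>auto simp: L intro!: ideal_in_plus_mult\<close>)
  have "\<exists>n. L n = L (Suc n)"
  proof (rule ccontr)
    assume "\<nexists>n. L n = L (Suc n)"
    then have "\<forall>n. ideal_in (L n) \<and> L n \<subset> L (Suc n)"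
      using idl plus_mult_superset L(2) by blast
    then show False using assms(1) unfolding acc_ideals_def by blast
  qed
  then obtain n where "L n = L (Suc n)" by blast
  then have vn: "v n \<in> L n"
    using plus_mult_gen[OF idl[of n], of 1 "v n"] by (simp add: L)
  have "\<exists>c. c \<in> P i - P n" if "i < n" for i
  proof -
    have "P i \<noteq> P n" using that P(1) by (auto simp: inj_eq)
    then show ?thesis using P(2) max_annihs_incomparable[of "P i" J "P n"] by blast
  qed
  then obtain c where c: "\<And>i. i < n \<Longrightarrow> c i \<in> P i - P n" by metis
  have cS: "c i \<in> S" if "i < n" for i using c[OF that] v by (auto simp: annih_def)
  define s where "s = prod c {..<n}"
  have s: "s \<in> S" unfolding s_def using cS by (intro prod_in) auto
  have sv: "s * v i \<in> J" if "i < n" for i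
  proof -
    have "ideal_in (P i)" using assms(2) P(2) max_annihs_props by blast
    then have "s \<in> P i" unfolding s_def using that cS c by (intro ideal_in_prod[of _ _ i]) auto
    then show ?thesis by (simp add: v(2) annih_def)
  qed
  have "s * x \<in> J" if "k \<le> n" "x \<in> L k" for k x
    using that
  proof (induction k arbitrary: x)
    case 0
    then show ?case using s assms(2) ideal_inD(4) by (auto simp: L)
  next
    case (Suc k)
    then obtain t y where ty: "t \<in> S" "y \<in> L k" "x = v k * t + y" by (auto simp: L plus_mult_def)
    then have "s * x = t * (s * v k) + s * y" by (simp add: algebra_simps)
    moreover have "s * v k \<in> J" "s * y \<in> J" using sv Suc ty by auto
    ultimately show ?case using ideal_inD(3,4)[OF assms(2)] ty(1) by metis
  qed
  then have "s * v n \<in> J" using vn by blast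
  then have "s \<in> P n" using s by (simp add: v(2) annih_def)
  moreover have "P n \<in> max_annihs J" using P(2) by blast
  then have "s \<notin> P n" unfolding s_def
    using c cS by (intro max_annihs_prod[OF assms(2)]) auto
  ultimately show False by blast
qed

text \<open>Prime avoidance: without a socle no maximal annihilator contains \<open>M\<close>, and
  since there are finitely many of them, one element of \<open>M\<close> avoids them all.\<close>

lemma exists_regular_element:
  assumes acc: "acc_ideals" and J: "ideal_in J" and M: "ideal_in M"
    and socle: "\<And>v. v \<in> S \<Longrightarrow> (\<And>a. a \<in> M \<Longrightarrow> a * v \<in> J) \<Longrightarrow> v \<in> J"
  shows "\<exists>a \<in> M. regular_on J a"
proof -
  let ?P = "max_annihs J"
  have fin: "finite ?P" by (rule finite_max_annihs[OF acc J])
  have "\<exists>m. m \<in> M - P" if "P \<in> ?P" for P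
  proof (rule ccontr)
    assume "\<nexists>m. m \<in> M - P"
    moreover obtain v where "v \<in> S - J" "P = annih J v"
      using \<open>P \<in> ?P\<close> unfolding max_annihs_def by blast
    ultimately show False using socle[of v] by (auto simp: annih_def)
  qed
  then obtain m where m: "\<And>P. P \<in> ?P \<Longrightarrow> m P \<in> M - P" by metis
  have "\<exists>c. c \<in> Q - P" if "P \<in> ?P" "Q \<in> ?P" "P \<noteq> Q" for P Q
    using max_annihs_incomparable[of Q J P] that by blast
  then obtain c where c: "\<And>P Q. P \<in> ?P \<Longrightarrow> Q \<in> ?P \<Longrightarrow> P \<noteq> Q \<Longrightarrow> c P Q \<in> Q - P" by metis
  have inS: "x \<in> S" if "x \<in> P" "P \<in> ?P" for x P
    using that max_annihs_props(1)[OF J] ideal_inD(6) by blast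
  \<comment> \<open>The summand \<open>b P\<close> lies outside \<open>P\<close> but in every other
    maximal annihilator, so the sum of all summands lies in none.\<close>
  define b where "b P = m P * prod (c P) (?P - {P})" for P
  define a where "a = sum b ?P"
  have pS: "prod (c P) (?P - {P}) \<in> S" if "P \<in> ?P" for P
    using fin that c inS by (intro prod_in) blast+
  have bM: "b P \<in> M" if "P \<in> ?P" for P
    unfolding b_def using ideal_inD(5)[OF M pS[OF that]] m[OF that] by blast
  then have "a \<in> M" unfolding a_def by (intro ideal_in_sum[OF M])
  moreover have nP: "a \<notin> P" if P: "P \<in> ?P" for P
  proof
    assume aP: "a \<in> P"
    have idP: "ideal_in P" using max_annihs_props(1)[OF J P] .
    have "b Q \<in> P" if "Q \<in> ?P - {P}" for Q
    proof -
      have "prod (c Q) (?P - {Q}) \<in> P"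
        using fin that P c inS by (intro ideal_in_prod[OF idP, of _ P]) blast+
      then show ?thesis unfolding b_def using m[of Q] that ideal_inD(4)[OF idP] ideal_inD(6)[OF M] by blast
    qed
    then have "sum b (?P - {P}) \<in> P" by (intro ideal_in_sum[OF idP])
    moreover have "a = b P + sum b (?P - {P})" unfolding a_def using fin P by (simp add: sum.remove)
    ultimately have "b P \<in> P" using ideal_in_diff[OF idP aP] by (metis add_diff_cancel_right')
    moreover have "prod (c P) (?P - {P}) \<notin> P"
      using fin c P inS by (intro max_annihs_prod[OF J P]) blast+
    ultimately show False
      using max_annihs_prime[OF J P, of "m P"] m[OF P] pS[OF P] ideal_inD(6)[OF M] unfolding b_def by blast
  qed
  have "regular_on J a"
    unfolding regular_on_def
  proof (intro ballI impI, rule ccontr)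
    fix s assume s: "s \<in> S" "a * s \<in> J" "s \<notin> J"
    then obtain P where "P \<in> ?P" "annih J s \<subseteq> P" using annih_subset_max[OF acc J] by blast
    moreover have "a \<in> annih J s" using s ideal_inD(6)[OF M \<open>a \<in> M\<close>] by (simp add: annih_def)
    ultimately show False using nP by blast
  qed
  ultimately show ?thesis by blast
qed

section \<open>Regular sequences and the degrees in which Koszul homology vanishes\<close>

fun seq_ideal :: "'a set \<Rightarrow> 'a list \<Rightarrow> 'a set" where
  "seq_ideal J [] = J"
| "seq_ideal J (a # as) = plus_mult (seq_ideal J as) a"

fun regular_list :: "'a set \<Rightarrow> 'a list \<Rightarrow> bool" where
  "regular_list J [] \<longleftrightarrow> True"
| "regular_list J (a # as) \<longleftrightarrow> regular_on J a \<and> regular_list (plus_mult J a) as"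

lemma plus_mult_commute: "plus_mult (plus_mult J a) b = plus_mult (plus_mult J b) a"
proof -
  have "plus_mult (plus_mult J a) b \<subseteq> plus_mult (plus_mult J b) a" for a b
  proof
    fix x assume "x \<in> plus_mult (plus_mult J a) b"
    then obtain s t j where "s \<in> S" "t \<in> S" "j \<in> J" "x = b * s + (a * t + j)"
      unfolding plus_mult_def by blast
    moreover from this have "x = a * t + (b * s + j)" by (simp add: add_ac)
    moreover from calculation have "b * s + j \<in> plus_mult J b" unfolding plus_mult_def by blast
    ultimately show "x \<in> plus_mult (plus_mult J b) a"
      unfolding plus_mult_def[of "plus_mult J b"] by blast
  qed
  then show ?thesis by blast
qed

text \<open>Reconciles two recursions: \<open>seq_smult\<close> adjoins the head last, whereas
  \<open>regular_list\<close> passes to the quotient by the head first.\<close>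

lemma seq_ideal_Cons: "seq_ideal J (a # as) = seq_ideal (plus_mult J a) as"
proof (induction as)
  case (Cons b as)
  then show ?case using plus_mult_commute[of "seq_ideal J as" b a] by simp
qed simp

lemma ideal_in_seq_ideal: "ideal_in J \<Longrightarrow> set as \<subseteq> S \<Longrightarrow> ideal_in (seq_ideal J as)"
  by (induction as) (auto intro: ideal_in_plus_mult)

lemma regular_list_iff:
  "regular_list J as \<longleftrightarrow> (\<forall>i < length as. regular_on (seq_ideal J (take i as)) (as ! i))"
proof (induction as arbitrary: J)
  case (Cons a as)
  show ?case
    by (simp add: Cons.IH All_less_Suc2 seq_ideal_Cons[symmetric] del: seq_ideal.simps(2))
qed simp

lemma plus_mult_least: "ideal_in M \<Longrightarrow> J \<subseteq> M \<Longrightarrow> a \<in> M \<Longrightarrow> plus_mult J a \<subseteq> M"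
  by (auto simp: plus_mult_def dest: ideal_inD(5) ideal_inD(3))

text \<open>Above degree \<open>length xs\<close> there are no chains, and every regular element
  gains one further degree. The assumption \<open>gen\<close> says that \<open>M\<close> lies in the
  ideal generated by \<open>xs\<close>, so elements of \<open>M\<close> act as zero on
  homology.\<close>

lemma regular_list_koszul_exact:
  assumes gen: "\<And>I. ideal_in I \<Longrightarrow> set xs \<subseteq> I \<Longrightarrow> M \<subseteq> I" and xs: "set xs \<subseteq> S"
    and "ideal_in J" "set as \<subseteq> M" "regular_list J as" "i > int (length xs) - int (length as)"
  shows "koszul_exact xs J i"
  using assms(3-)
proof (induction as arbitrary: J i)
  case Nil
  then show ?case by (intro koszul_exact_beyond) auto
next
  case (Cons a as)
  have "M \<subseteq> S" using gen[OF ideal_in_S xs] .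
  then have a: "a \<in> S" "a \<in> M" using Cons.prems by auto
  have "M \<subseteq> {a \<in> S. null_homotopic xs J a}"
    using gen[OF null_homotopic_ideal] null_homotopic_gen[OF Cons.prems(1) xs] Cons.prems(1) xs
    by blast
  then have "null_homotopic xs J a" using a by blast
  moreover have "koszul_exact xs (plus_mult J a) (i + 1)"
    using Cons.prems a by (intro Cons.IH ideal_in_plus_mult) auto
  ultimately show ?case using koszul_exact_lift[OF Cons.prems(1) xs a(1)] Cons.prems(3) by auto
qed

text \<open>As long as the top homology vanishes there is no socle, hence a regular element in
  \<open>M\<close>; dividing by it costs one degree of vanishing. The last conjunct later shows that
  the quotient by the sequence is nonzero.\<close>

lemma koszul_exact_regular_list:
  assumes acc: "acc_ideals"
    and M: "ideal_in M" "set xs \<subseteq> M"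
    and "ideal_in J" "J \<subseteq> M" "\<And>i. i > int (length xs) - int r \<Longrightarrow> koszul_exact xs J i"
  shows "\<exists>as. length as = r \<and> set as \<subseteq> M \<and> regular_list J as \<and> seq_ideal J as \<subseteq> M"
  using assms(4-)
proof (induction r arbitrary: J)
  case 0
  then show ?case by (intro exI[of _ "[]"]) auto
next
  case (Suc r)
  have xs: "set xs \<subseteq> S" using M ideal_inD(1) by blast
  have "\<exists>a \<in> M. regular_on J a"
  proof (rule exists_regular_element[OF acc Suc.prems(1) M(1)])
    fix v assume "v \<in> S" "\<And>a. a \<in> M \<Longrightarrow> a * v \<in> J"
    then show "v \<in> J"
      using koszul_exact_no_socle[OF Suc.prems(1) xs] Suc.prems(3)[of "int (length xs)"] M(2) by auto
  qed
  then obtain a where a: "a \<in> M" "regular_on J a" by blast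
  have aS: "a \<in> S" using a M ideal_inD(6) by blast
  have "\<exists>as. length as = r \<and> set as \<subseteq> M \<and> regular_list (plus_mult J a) as \<and>
      seq_ideal (plus_mult J a) as \<subseteq> M"
  proof (rule Suc.IH)
    show "ideal_in (plus_mult J a)" by (rule ideal_in_plus_mult[OF Suc.prems(1) aS])
    show "plus_mult J a \<subseteq> M" by (rule plus_mult_least[OF M(1) Suc.prems(2) a(1)])
    show "koszul_exact xs (plus_mult J a) i" if "i > int (length xs) - int r" for i
      using that by (intro koszul_exact_quotient[OF Suc.prems(1) xs aS a(2)] Suc.prems(3)) auto
  qed
  then obtain as where "length as = r" "set as \<subseteq> M" "regular_list (plus_mult J a) as"
    "seq_ideal (plus_mult J a) as \<subseteq> M" by blast
  then show ?case using a by (intro exI[of _ "a # as"]) (auto simp: seq_ideal_Cons simp del: seq_ideal.simps(2))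
qed

end

section \<open>Monomial ideals\<close>

lemma nat_seq_mono_subseq:
  fixes h :: "nat \<Rightarrow> nat"
  shows "\<exists>r :: nat \<Rightarrow> nat. strict_mono r \<and> mono (\<lambda>n. h (r n))"
proof -
  obtain r :: "nat \<Rightarrow> nat" where r: "strict_mono r" "monoseq (\<lambda>n. h (r n))" using seq_monosub[of h] by blast
  show ?thesis
  proof (cases "incseq (\<lambda>n. h (r n))")
    case True
    then show ?thesis using r(1) by blast
  next
    case False
    then have dec: "decseq (\<lambda>n. h (r n))" using r(2) by (simp add: monoseq_iff)
    obtain N where N: "\<And>n. h (r N) \<le> h (r n)"
      using ex_has_least_nat[of "\<lambda>_. True" 0 "\<lambda>n. h (r n)"] by auto
    have "h (r (n + N)) = h (r N)" for n
      using N[of "n + N"] dec by (simp add: decseq_def le_antisym)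
    then have "mono (\<lambda>n. h (r (n + N)))" by (simp add: mono_def)
    moreover have "strict_mono (\<lambda>n. r (n + N))" using r(1) by (simp add: strict_mono_def)
    ultimately show ?thesis by blast
  qed
qed

lemma dickson_subseq:
  fixes f :: "nat \<Rightarrow> 'v \<Rightarrow> nat"
  assumes "finite V"
  shows "\<exists>r :: nat \<Rightarrow> nat. strict_mono r \<and> (\<forall>v\<in>V. mono (\<lambda>n. f (r n) v))"
  using assms
proof (induction V rule: finite_induct)
  case empty
  show ?case by (intro exI[of _ "\<lambda>n. n"]) (simp add: strict_mono_def)
next
  case (insert x V)
  then obtain r :: "nat \<Rightarrow> nat" where r: "strict_mono r" "\<forall>v\<in>V. mono (\<lambda>n. f (r n) v)" by blast
  obtain q :: "nat \<Rightarrow> nat" where q: "strict_mono q" "mono (\<lambda>n. f (r (q n)) x)"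
    using nat_seq_mono_subseq[of "\<lambda>n. f (r n) x"] by blast
  have "strict_mono (\<lambda>n. r (q n))" using r(1) q(1) by (simp add: strict_mono_def)
  moreover have "mono (\<lambda>n. f (r (q n)) v)" if "v \<in> V" for v
    using r(2) that q(1) by (auto simp: mono_def strict_mono_less_eq)
  ultimately show ?case using q(2) by (intro exI[of _ "\<lambda>n. r (q n)"]) auto
qed

text \<open>Dickson's lemma: along a subsequence on which all exponents are weakly increasing, the
  first monomial divides the second.\<close>

lemma dickson:
  fixes f :: "nat \<Rightarrow> 'v \<Rightarrow>\<^sub>0 nat"
  assumes "finite V" "\<And>n. Poly_Mapping.keys (f n) \<subseteq> V"
  obtains i j s where "i < j" "f j = f i + s"
proof -
  obtain r :: "nat \<Rightarrow> nat" where r: "strict_mono r" "\<forall>v\<in>V. mono (\<lambda>n. Poly_Mapping.lookup (f (r n)) v)"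
    using dickson_subseq[OF assms(1), of "\<lambda>n. Poly_Mapping.lookup (f n)"] by blast
  have "Poly_Mapping.lookup (f (r 0)) v \<le> Poly_Mapping.lookup (f (r 1)) v" for v
  proof (cases "v \<in> V")
    case True
    then have "mono (\<lambda>n. Poly_Mapping.lookup (f (r n)) v)" using r(2) by blast
    then show ?thesis by (rule monoD) simp
  next
    case False
    then have "v \<notin> Poly_Mapping.keys (f (r 0))" using assms(2) by blast
    then show ?thesis by (simp add: in_keys_iff)
  qed
  then have "f (r 1) = f (r 0) + (f (r 1) - f (r 0))"
    by (intro poly_mapping_eqI) (simp add: lookup_add lookup_minus)
  moreover have "r 0 < r 1" using r(1) by (simp add: strict_mono_def)
  ultimately show ?thesis using that by blast
qed

lemma poly_mapping_nat_ge_0: "0 \<le> (s :: 'v::linorder \<Rightarrow>\<^sub>0 nat)"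
proof (cases "s = 0")
  case False
  then have ne: "Poly_Mapping.keys s \<noteq> {}" by simp
  define k where "k = Min (Poly_Mapping.keys s)"
  have "k \<in> Poly_Mapping.keys s" unfolding k_def using ne by (intro Min_in) auto
  moreover have "Poly_Mapping.lookup s k' = 0" if "k' < k" for k'
  proof -
    have "k' \<notin> Poly_Mapping.keys s"
      using that unfolding k_def by (meson Min_le finite_keys leD)
    then show ?thesis by (simp add: in_keys_iff)
  qed
  ultimately have "less_fun (Poly_Mapping.lookup 0) (Poly_Mapping.lookup s)"
    unfolding less_fun_def by (intro exI[of _ k]) (simp add: in_keys_iff)
  then have "0 < s" by (simp add: less_poly_mapping.rep_eq)
  then show ?thesis by simp
qed simp

text \<open>An infinite descent would contain \<open>f i\<close> dividing a later \<open>f j\<close>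
  by Dickson's lemma, and a multiple is never smaller in the monomial order.\<close>

lemma wf_monomials:
  assumes "finite V"
  shows "wf {(s, t :: 'v::linorder \<Rightarrow>\<^sub>0 nat). s < t \<and> Poly_Mapping.keys s \<subseteq> V \<and> Poly_Mapping.keys t \<subseteq> V}"
  unfolding wf_iff_no_infinite_down_chain
proof
  assume "\<exists>f. \<forall>i. (f (Suc i), f i) \<in> {(s, t :: 'v \<Rightarrow>\<^sub>0 nat). s < t \<and> Poly_Mapping.keys s \<subseteq> V \<and> Poly_Mapping.keys t \<subseteq> V}"
  then obtain f :: "nat \<Rightarrow> 'v \<Rightarrow>\<^sub>0 nat" where
    f: "\<And>i. f (Suc i) < f i" "\<And>i. Poly_Mapping.keys (f i) \<subseteq> V" by blast
  obtain i j s where ij: "i < j" "f j = f i + s" using dickson[OF assms f(2)] .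
  have "f j < f i" using lift_Suc_mono_less_iff[of "\<lambda>n. - n"] ij(1)
  proof (induction j)
    case (Suc j)
    then show ?case using f(1)[of j] by (cases "i = j") auto
  qed simp
  moreover have "f i \<le> f j" using add_left_mono[OF poly_mapping_nat_ge_0, of "f i" s] ij(2) by simp
  ultimately show False by simp
qed

text \<open>Subtraction of exponents is truncated, so the condition \<open>t = s + u\<close> must
  guard the coefficient at \<open>t - s\<close>.\<close>

lemma lookup_single_mult:
  fixes p :: "('v, 'k::field) mpoly"
  shows "Poly_Mapping.lookup (Poly_Mapping.single s c * p) t =
    (if \<exists>u. t = s + u then c * Poly_Mapping.lookup p (t - s) else 0)"
proof -
  have p: "p = (\<Sum>u\<in>Poly_Mapping.keys p. Poly_Mapping.single u (Poly_Mapping.lookup p u))"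
    by (intro poly_mapping_eqI) (auto simp: lookup_sum lookup_single when_def in_keys_iff sum.delta)
  have "Poly_Mapping.lookup (Poly_Mapping.single s c * p) t =
      (\<Sum>u\<in>Poly_Mapping.keys p. (c * Poly_Mapping.lookup p u when s + u = t))"
    by (subst p) (simp add: sum_distrib_left mult_single lookup_sum lookup_single)
  also have "\<dots> = (if \<exists>u. t = s + u then c * Poly_Mapping.lookup p (t - s) else 0)"
  proof (cases "\<exists>u. t = s + u")
    case True
    then obtain w where w: "t = s + w" by blast
    have "(\<Sum>u\<in>Poly_Mapping.keys p. (c * Poly_Mapping.lookup p u when s + u = t)) =
        (\<Sum>u\<in>Poly_Mapping.keys p. if u = w then c * Poly_Mapping.lookup p u else 0)"
      by (intro sum.cong) (auto simp: w when_def)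
    then show ?thesis using True by (auto simp: w sum.delta in_keys_iff)
  qed (auto simp: when_def intro!: sum.neutral)
  finally show ?thesis .
qed

lemma mpoly_sum_monomials:
  fixes p :: "('v, 'k::field) mpoly"
  shows "p = (\<Sum>u\<in>Poly_Mapping.keys p.
    Poly_Mapping.single 0 (Poly_Mapping.lookup p u) * Poly_Mapping.single u 1)"
  by (intro poly_mapping_eqI)
    (auto simp: mult_single lookup_sum lookup_single when_def in_keys_iff sum.delta)

abbreviation polys :: "'v set \<Rightarrow> ('v, 'k::field) mpoly set" where
  "polys V \<equiv> carrier (poly_ring V)"

lemma polys_iff: "p \<in> polys V \<longleftrightarrow> (\<forall>t\<in>Poly_Mapping.keys p. Poly_Mapping.keys t \<subseteq> V)"
  by (simp add: poly_ring_def)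

lemma poly_ring_simps [simp]:
  "x \<otimes>\<^bsub>poly_ring V\<^esub> y = x * y" "x \<oplus>\<^bsub>poly_ring V\<^esub> y = x + y"
  "\<one>\<^bsub>poly_ring V\<^esub> = 1" "\<zero>\<^bsub>poly_ring V\<^esub> = 0"
  by (simp_all add: poly_ring_def)

interpretation polys: subring_of_type "polys V" for V :: "'v set"
proof
  interpret cring "poly_ring V :: ('v, 'k::field) mpoly ring" by (rule cring_poly_ring)
  show "0 \<in> (polys V :: ('v, 'k) mpoly set)" "1 \<in> (polys V :: ('v, 'k) mpoly set)"
    using zero_closed one_closed by simp_all
  fix a b :: "('v, 'k) mpoly" assume "a \<in> polys V"
  then show "- a \<in> polys V" by (simp add: polys_iff)
  assume "b \<in> polys V"
  then show "a + b \<in> polys V" "a * b \<in> polys V"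
    using \<open>a \<in> polys V\<close> a_closed[of a b] m_closed[of a b] by simp_all
qed

lemma ideal_iff: "ideal I (poly_ring V) \<longleftrightarrow> polys.ideal_in V (I :: ('v, 'k::field) mpoly set)"
proof
  assume "ideal I (poly_ring V)"
  then interpret ideal I "poly_ring V" .
  show "polys.ideal_in V I"
    unfolding polys.ideal_in_def
  proof (intro conjI ballI)
    show "I \<subseteq> polys V" by (rule a_subset)
    show "0 \<in> I" using additive_subgroup.zero_closed[OF is_additive_subgroup] by simp
    show "a + b \<in> I" if "a \<in> I" "b \<in> I" for a b 
      using additive_subgroup.a_closed[OF is_additive_subgroup that] by simp
    show "s * a \<in> I" if "s \<in> polys V" "a \<in> I" for s a using I_l_closed[OF that(2,1)] by simp
  qed
next
  interpret R: cring "poly_ring V :: ('v, 'k) mpoly ring" by (rule cring_poly_ring)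
  assume I: "polys.ideal_in V I"
  note D = polys.ideal_inD[OF I]
  show "ideal I (poly_ring V)"
  proof (rule idealI)
    show "ring (poly_ring V :: ('v, 'k) mpoly ring)" by (rule R.ring_axioms)
    show "subgroup I (add_monoid (poly_ring V))"
    proof (rule R.add.subgroupI)
      show "I \<noteq> {}" using D(2) by blast
      fix a assume "a \<in> I"
      have "\<ominus>\<^bsub>poly_ring V\<^esub> a = - a"
        using D(6)[OF \<open>a \<in> I\<close>] polys.uminus_in by (intro R.minus_equality) auto
      then show "\<ominus>\<^bsub>poly_ring V\<^esub> a \<in> I" using polys.ideal_in_uminus[OF I \<open>a \<in> I\<close>] by simp
    qed (use D in auto)
  qed (use D in auto)
qed

text \<open>The exponent set carries all information, so intersections of ideals and colons by
  monomials become set operations; it is an ideal when \<open>A\<close> is closed under adding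
  exponents.\<close>

definition mono_ideal :: "'v set \<Rightarrow> ('v \<Rightarrow>\<^sub>0 nat) set \<Rightarrow> ('v, 'k::field) mpoly set" where
  "mono_ideal V A = {p \<in> polys V. Poly_Mapping.keys p \<subseteq> A}"

definition up_closed :: "('v \<Rightarrow>\<^sub>0 nat) set \<Rightarrow> bool" where
  "up_closed A \<longleftrightarrow> (\<forall>t\<in>A. \<forall>s. s + t \<in> A)"

lemma ideal_in_mono_ideal:
  assumes "up_closed A"
  shows "polys.ideal_in V (mono_ideal V A :: ('v, 'k::field) mpoly set)"
  unfolding polys.ideal_in_def
proof (intro conjI ballI)
  show "mono_ideal V A \<subseteq> (polys V :: ('v, 'k) mpoly set)" by (auto simp: mono_ideal_def)
  show "0 \<in> (mono_ideal V A :: ('v, 'k) mpoly set)" by (simp add: mono_ideal_def)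
  fix a b :: "('v, 'k) mpoly"
  assume b: "b \<in> mono_ideal V A"
  show "a + b \<in> mono_ideal V A" if "a \<in> mono_ideal V A"
    using that b keys_add[of a b] by (auto simp: mono_ideal_def)
  show "a * b \<in> mono_ideal V A" if "a \<in> polys V"
    using that b keys_mult[of a b] assms by (fastforce simp: mono_ideal_def up_closed_def)
qed

lemma single_in_polys: "Poly_Mapping.keys t \<subseteq> V \<Longrightarrow> Poly_Mapping.single t c \<in> polys V"
  by (simp add: polys_iff)

lemma const_in_polys: "Poly_Mapping.single 0 c \<in> polys V"
  by (simp add: polys_iff)

lemma mono_ideal_subset:
  fixes I :: "('v, 'k::field) mpoly set"
  assumes "polys.ideal_in V I"
    and "\<And>t. t \<in> A \<Longrightarrow> Poly_Mapping.keys t \<subseteq> V \<Longrightarrow> Poly_Mapping.single t 1 \<in> I"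
  shows "mono_ideal V A \<subseteq> I"
proof
  fix p :: "('v, 'k) mpoly" assume p: "p \<in> mono_ideal V A"
  have "(\<Sum>u\<in>Poly_Mapping.keys p.
    Poly_Mapping.single 0 (Poly_Mapping.lookup p u) * Poly_Mapping.single u 1) \<in> I"
    using p assms
    by (intro polys.ideal_in_sum[OF assms(1)] polys.ideal_inD(4)[OF assms(1)] const_in_polys)
      (auto simp: mono_ideal_def polys_iff)
  then show "p \<in> I" using mpoly_sum_monomials[of p] by simp
qed

lemma genideal_monomials:
  assumes "\<And>t. t \<in> T \<Longrightarrow> Poly_Mapping.keys t \<subseteq> V"
  shows "Idl\<^bsub>poly_ring V\<^esub> ((\<lambda>t. Poly_Mapping.single t 1) ` T) =
    (mono_ideal V {t. \<exists>s\<in>T. \<exists>r. t = r + s} :: ('v, 'k::field) mpoly set)"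
    (is "?L = mono_ideal V ?A")
proof
  interpret R: cring "poly_ring V :: ('v, 'k) mpoly ring" by (rule cring_poly_ring)
  have T: "(\<lambda>t. Poly_Mapping.single t 1) ` T \<subseteq> (polys V :: ('v, 'k) mpoly set)"
    using assms by (auto intro: single_in_polys)
  have idl: "polys.ideal_in V ?L"
    using R.genideal_ideal[OF T] by (simp add: ideal_iff)
  have "up_closed ?A" by (auto simp: up_closed_def) (metis add.assoc)
  then have "ideal (mono_ideal V ?A :: ('v, 'k) mpoly set) (poly_ring V)"
    using ideal_in_mono_ideal ideal_iff by blast
  moreover have "(\<lambda>t. Poly_Mapping.single t 1) ` T \<subseteq> (mono_ideal V ?A :: ('v, 'k) mpoly set)"
  proof
    fix x :: "('v, 'k) mpoly" assume "x \<in> (\<lambda>t. Poly_Mapping.single t 1) ` T"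
    then obtain t where t: "t \<in> T" "x = Poly_Mapping.single t 1" by blast
    then have "t = 0 + t" by simp
    then show "x \<in> mono_ideal V ?A" using t assms
      by (auto simp: mono_ideal_def intro!: single_in_polys bexI[of _ t] exI[of _ 0])
  qed
  ultimately show "?L \<subseteq> mono_ideal V ?A" by (rule R.genideal_minimal)
  show "mono_ideal V ?A \<subseteq> ?L"
  proof (rule mono_ideal_subset[OF idl])
    fix t assume "t \<in> ?A" and tV: "Poly_Mapping.keys t \<subseteq> V"
    then obtain s r where sr: "s \<in> T" "t = r + s" by blast
    have "Poly_Mapping.keys r \<subseteq> V"
      using tV unfolding sr(2) by (auto simp: in_keys_iff lookup_add subset_iff)
    then have "Poly_Mapping.single r 1 \<in> (polys V :: ('v, 'k) mpoly set)" by (rule single_in_polys)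
    moreover have "Poly_Mapping.single s 1 \<in> ?L"
      using R.genideal_self[OF T] sr(1) by blast
    ultimately have "Poly_Mapping.single r 1 * Poly_Mapping.single s 1 \<in> ?L"
      by (rule polys.ideal_inD(4)[OF idl])
    then show "Poly_Mapping.single t 1 \<in> ?L" by (simp add: mult_single sr(2))
  qed
qed

lemma var_ideal_eq:
  assumes "W \<subseteq> V"
  shows "(var_ideal V W :: ('v, 'k::field) mpoly set) = mono_ideal V {t. \<exists>v\<in>W. Poly_Mapping.lookup t v \<noteq> 0}"
proof -
  have "(pvar ` W :: ('v, 'k) mpoly set) = (\<lambda>t. Poly_Mapping.single t 1) ` (\<lambda>v. Poly_Mapping.single v 1) ` W"
    by (auto simp: pvar_def image_image)
  moreover have "{t. \<exists>s\<in>(\<lambda>v. Poly_Mapping.single v (1::nat)) ` W. \<exists>r. t = r + s} =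
      {t. \<exists>v\<in>W. Poly_Mapping.lookup t v \<noteq> 0}"
  proof (intro subset_antisym subsetI)
    fix t :: "'v \<Rightarrow>\<^sub>0 nat" assume "t \<in> {t. \<exists>s\<in>(\<lambda>v. Poly_Mapping.single v (1::nat)) ` W. \<exists>r. t = r + s}"
    then obtain v r where "v \<in> W" "t = r + Poly_Mapping.single v 1" by blast
    then show "t \<in> {t. \<exists>v\<in>W. Poly_Mapping.lookup t v \<noteq> 0}"
      by (auto simp: lookup_add intro!: bexI[of _ v])
  next
    fix t :: "'v \<Rightarrow>\<^sub>0 nat" assume "t \<in> {t. \<exists>v\<in>W. Poly_Mapping.lookup t v \<noteq> 0}"
    then obtain v where v: "v \<in> W" "Poly_Mapping.lookup t v \<noteq> 0" by blast
    then have "t = (t - Poly_Mapping.single v (1::nat)) + Poly_Mapping.single v 1"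
      by (intro poly_mapping_eqI) (auto simp: lookup_add lookup_minus lookup_single when_def)
    then show "t \<in> {t. \<exists>s\<in>(\<lambda>v. Poly_Mapping.single v (1::nat)) ` W. \<exists>r. t = r + s}"
      using v(1) by blast
  qed
  moreover have "Idl\<^bsub>poly_ring V\<^esub> ((\<lambda>t. Poly_Mapping.single t 1) ` (\<lambda>v. Poly_Mapping.single v 1) ` W) =
      (mono_ideal V {t. \<exists>s\<in>(\<lambda>v. Poly_Mapping.single v 1) ` W. \<exists>r. t = r + s} :: ('v, 'k) mpoly set)"
    by (rule genideal_monomials) (use assms in auto)
  ultimately show ?thesis by (simp only: var_ideal_def)
qed

section \<open>The Noetherian property and gradings by one variable\<close>

definition lead :: "('v::linorder, 'k::field) mpoly \<Rightarrow> ('v \<Rightarrow>\<^sub>0 nat)" where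
  "lead p = Max (Poly_Mapping.keys p)"

lemma lead_in: "p \<noteq> 0 \<Longrightarrow> lead p \<in> Poly_Mapping.keys p"
  unfolding lead_def by (intro Max_in) auto

lemma lead_ge: "t \<in> Poly_Mapping.keys p \<Longrightarrow> t \<le> lead p"
  unfolding lead_def by (intro Max_ge) auto

lemma lead_reduce:
  fixes p q :: "('v::linorder, 'k::field) mpoly"
  assumes "p \<noteq> 0" "q \<noteq> 0" "lead q = lead p + s"
  defines "r \<equiv> q - Poly_Mapping.single s (Poly_Mapping.lookup q (lead q) / Poly_Mapping.lookup p (lead p)) * p"
  assumes "r \<noteq> 0"
  shows "lead r < lead q"
proof -
  define c where "c = Poly_Mapping.lookup q (lead q) / Poly_Mapping.lookup p (lead p)"
  have r: "r = q - Poly_Mapping.single s c * p" by (simp add: r_def c_def)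
  have "t \<le> lead q \<and> t \<noteq> lead q" if t: "t \<in> Poly_Mapping.keys r" for t
  proof
    have "t \<in> Poly_Mapping.keys q \<or> t \<in> Poly_Mapping.keys (Poly_Mapping.single s c * p)"
      using t unfolding r by (auto simp: in_keys_iff lookup_minus)
    then show "t \<le> lead q"
    proof
      assume "t \<in> Poly_Mapping.keys (Poly_Mapping.single s c * p)"
      then obtain a where a: "a \<in> Poly_Mapping.keys p" "t = s + a"
        using keys_mult[of "Poly_Mapping.single s c" p] by (auto split: if_splits)
      then have "t \<le> s + lead p" using lead_ge[OF a(1)] by (simp add: add_left_mono)
      then show ?thesis using assms(3) by (simp add: add.commute)
    qed (rule lead_ge)
    have "Poly_Mapping.lookup p (lead p) \<noteq> 0" using lead_in[OF assms(1)] by (simp add: in_keys_iff)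
    moreover have "\<exists>u. lead q = s + u" "lead q - s = lead p"
      using assms(3) by (auto simp: add.commute intro: exI[of _ "lead p"])
    ultimately have "Poly_Mapping.lookup r (lead q) = 0"
      unfolding r by (simp add: lookup_minus lookup_single_mult c_def)
    then show "t \<noteq> lead q" using t by (auto simp: in_keys_iff)
  qed
  then show ?thesis using lead_in[OF assms(5)] by (simp add: less_le)
qed




text \<open>In each step of a strict chain pick a new element with minimal leading monomial. By
  Dickson's lemma an earlier leading monomial divides a later one; cancelling it leaves an element
  that is still new in the later step but has a smaller leading monomial.\<close>

lemma acc_polys:
  fixes V :: "'v::linorder set"
  assumes "finite V"
  shows "subring_of_type.acc_ideals (polys V :: ('v, 'k::field) mpoly set)"
  unfolding polys.acc_ideals_def
proof
  assume "\<exists>I. \<forall>n::nat. polys.ideal_in V (I n :: ('v, 'k) mpoly set) \<and> I n \<subset> I (Suc n)"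
  then obtain I :: "nat \<Rightarrow> ('v, 'k) mpoly set" where
    idl: "\<And>n. polys.ideal_in V (I n)" and I: "\<And>n. I n \<subset> I (Suc n)" by blast
  have mono: "I m \<subseteq> I n" if "m \<le> n" for m n
    by (rule lift_Suc_mono_le[of I, OF _ that]) (use I in blast)
  have nz: "p \<noteq> 0" if "p \<notin> I n" for p n using that polys.ideal_inD(2)[OF idl] by blast
  have keysV: "Poly_Mapping.keys (lead p) \<subseteq> V" if "p \<in> I n" "p \<noteq> 0" for p n
    using polys.ideal_inD(6)[OF idl that(1)] lead_in[OF that(2)] by (simp add: polys_iff)
  have "\<exists>p. p \<in> I (Suc n) - I n \<and> (\<forall>q \<in> I (Suc n) - I n. \<not> lead q < lead p)" for n
  proof -
    obtain p0 where p0: "p0 \<in> I (Suc n) - I n" using I[of n] by blast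
    obtain t where t: "t \<in> lead ` (I (Suc n) - I n)"
      "\<And>s. (s, t) \<in> {(s, t). s < t \<and> Poly_Mapping.keys s \<subseteq> V \<and> Poly_Mapping.keys t \<subseteq> V} \<Longrightarrow>
        s \<notin> lead ` (I (Suc n) - I n)"
      by (rule wfE_min[OF wf_monomials[OF assms], of "lead p0" "lead ` (I (Suc n) - I n)"])
        (use p0 in auto)
    then obtain p where p: "p \<in> I (Suc n) - I n" "t = lead p" by blast
    have "\<not> lead q < lead p" if q: "q \<in> I (Suc n) - I n" for q
      using t(2)[of "lead q"] q p keysV[of q "Suc n"] keysV[of p "Suc n"] nz[of q n] nz[of p n] by auto
    then show ?thesis using p(1) by blast
  qed
  then obtain p where p: "\<And>n. p n \<in> I (Suc n) - I n"
    "\<And>n q. q \<in> I (Suc n) - I n \<Longrightarrow> \<not> lead q < lead (p n)" by metis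
  have nzp: "p n \<noteq> 0" for n using nz p(1) by blast
  have "Poly_Mapping.keys (lead (p n)) \<subseteq> V" for n using keysV nzp p(1) by blast
  then obtain i j s where ij: "i < j" "lead (p j) = lead (p i) + s"
    using dickson[OF assms, of "\<lambda>n. lead (p n)"] by blast
  define m where "m = Poly_Mapping.single s (Poly_Mapping.lookup (p j) (lead (p j)) / Poly_Mapping.lookup (p i) (lead (p i)))"
  have "Poly_Mapping.keys s \<subseteq> V"
    using \<open>\<And>n. Poly_Mapping.keys (lead (p n)) \<subseteq> V\<close>[of j] unfolding ij(2)
    by (auto simp: in_keys_iff lookup_add subset_iff)
  then have "m \<in> polys V" unfolding m_def by (rule single_in_polys)
  moreover have "p i \<in> I j" using p(1)[of i] mono[of "Suc i" j] ij(1) by auto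
  ultimately have mp: "m * p i \<in> I j" by (rule polys.ideal_inD(4)[OF idl])
  have "p j - m * p i \<in> I (Suc j) - I j"
  proof
    show "p j - m * p i \<in> I (Suc j)"
      using p(1)[of j] mp mono[of j "Suc j"] by (intro polys.ideal_in_diff[OF idl]) auto
    show "p j - m * p i \<notin> I j"
    proof
      assume "p j - m * p i \<in> I j"
      then have "(p j - m * p i) + m * p i \<in> I j" using mp by (rule polys.ideal_inD(3)[OF idl])
      then show False using p(1)[of j] by simp
    qed
  qed
  moreover from this have "lead (p j - m * p i) < lead (p j)"
    using lead_reduce[OF nzp nzp ij(2)] nz unfolding m_def by blast
  ultimately show False using p(2) by blast
qed

section \<open>The grading by the degree in one variable\<close>

definition trunc :: "'v \<Rightarrow> nat \<Rightarrow> ('v, 'k::field) mpoly \<Rightarrow> ('v, 'k) mpoly" where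
  "trunc x D p = Abs_poly_mapping (\<lambda>t. if Poly_Mapping.lookup t x < D then Poly_Mapping.lookup p t else 0)"

lemma lookup_trunc:
  "Poly_Mapping.lookup (trunc x D p) t = (if Poly_Mapping.lookup t x < D then Poly_Mapping.lookup p t else 0)"
proof -
  have "finite {t. (if Poly_Mapping.lookup t x < D then Poly_Mapping.lookup p t else 0) \<noteq> 0}"
    by (rule finite_subset[of _ "Poly_Mapping.keys p"]) (auto simp: in_keys_iff split: if_splits)
  then show ?thesis unfolding trunc_def by simp
qed

text \<open>The quotient on division by the variable \<open>x\<close>; terms free of
  \<open>x\<close> form the remainder \<open>trunc x 1 p\<close>.\<close>

definition xquot :: "'v \<Rightarrow> ('v, 'k::field) mpoly \<Rightarrow> ('v, 'k) mpoly" where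
  "xquot x p = Abs_poly_mapping (\<lambda>t. Poly_Mapping.lookup p (t + Poly_Mapping.single x 1))"

lemma lookup_xquot:
  "Poly_Mapping.lookup (xquot x p) t = Poly_Mapping.lookup p (t + Poly_Mapping.single x 1)"
proof -
  have "{t. Poly_Mapping.lookup p (t + Poly_Mapping.single x 1) \<noteq> 0} =
      (\<lambda>t. t + Poly_Mapping.single x 1) -` Poly_Mapping.keys p"
    by (auto simp: in_keys_iff)
  moreover have "finite ((\<lambda>t. t + Poly_Mapping.single x (1::nat)) -` Poly_Mapping.keys p)"
    by (intro finite_vimageI) (auto simp: inj_def)
  ultimately show ?thesis unfolding xquot_def by simp
qed

lemma lookup_pvar_mult:
  "Poly_Mapping.lookup (pvar x * p) t =
    (if Poly_Mapping.lookup t x = 0 then 0 else Poly_Mapping.lookup p (t - Poly_Mapping.single x 1))"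
proof -
  have "(\<exists>u. t = Poly_Mapping.single x 1 + u) \<longleftrightarrow> Poly_Mapping.lookup t x \<noteq> 0"
  proof
    assume "\<exists>u. t = Poly_Mapping.single x 1 + u"
    then show "Poly_Mapping.lookup t x \<noteq> 0" by (auto simp: lookup_add)
  next
    assume "Poly_Mapping.lookup t x \<noteq> 0"
    then have "t = Poly_Mapping.single x 1 + (t - Poly_Mapping.single x 1)"
      by (intro poly_mapping_eqI) (auto simp: lookup_add lookup_minus lookup_single when_def)
    then show "\<exists>u. t = Poly_Mapping.single x 1 + u" by blast
  qed
  then show ?thesis unfolding pvar_def lookup_single_mult by simp
qed

lemma trunc_add: "trunc x D (p + q) = trunc x D p + trunc x D q"
  by (intro poly_mapping_eqI) (simp add: lookup_trunc lookup_add)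

lemma trunc_uminus: "trunc x D (- p) = - trunc x D p"
  by (intro poly_mapping_eqI) (simp add: lookup_trunc)

lemma trunc_0: "trunc x D 0 = 0"
  by (intro poly_mapping_eqI) (simp add: lookup_trunc)

lemma trunc_below_0: "trunc x 0 p = 0"
  by (intro poly_mapping_eqI) (simp add: lookup_trunc)

lemma trunc_pvar_mult: "y \<noteq> x \<Longrightarrow> trunc x D (pvar y * p) = pvar y * trunc x D p"
  by (intro poly_mapping_eqI) (simp add: lookup_trunc lookup_pvar_mult lookup_minus lookup_single)

lemma trunc_pvar_mult_same: "trunc x (Suc D) (pvar x * p) = pvar x * trunc x D p"
  by (intro poly_mapping_eqI)
    (auto simp: lookup_trunc lookup_pvar_mult lookup_minus lookup_single)

lemma trunc_1_pvar_mult: "trunc x 1 (pvar x * p) = 0"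
  using trunc_pvar_mult_same[of x 0 p] by (simp add: trunc_below_0)

lemma trunc_xquot:
  fixes p :: "('v, 'k::field) mpoly"
  shows "p = trunc x 1 p + pvar x * xquot x p"
proof (intro poly_mapping_eqI)
  fix t :: "'v \<Rightarrow>\<^sub>0 nat"
  have "t = t - Poly_Mapping.single x 1 + Poly_Mapping.single x 1" if "Poly_Mapping.lookup t x \<noteq> 0"
    using that by (intro poly_mapping_eqI) (auto simp: lookup_add lookup_minus lookup_single when_def)
  then show "Poly_Mapping.lookup p t = Poly_Mapping.lookup (trunc x 1 p + pvar x * xquot x p) t"
    by (auto simp: lookup_add lookup_trunc lookup_pvar_mult lookup_xquot)
qed

lemma keys_trunc: "Poly_Mapping.keys (trunc x D p) \<subseteq> Poly_Mapping.keys p"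
  by (auto simp: in_keys_iff lookup_trunc split: if_splits)

lemma trunc_in_polys: "p \<in> polys V \<Longrightarrow> trunc x D p \<in> polys V"
  using keys_trunc[of x D p] by (auto simp: polys_iff)

lemma trunc_in_mono_ideal: "p \<in> mono_ideal V A \<Longrightarrow> trunc x D p \<in> mono_ideal V A"
  using keys_trunc[of x D p] trunc_in_polys by (fastforce simp: mono_ideal_def)

lemma xquot_in_polys:
  assumes "p \<in> polys V"
  shows "xquot x p \<in> polys V"
  unfolding polys_iff
proof (intro ballI subsetI)
  fix t y assume t: "t \<in> Poly_Mapping.keys (xquot x p)" "y \<in> Poly_Mapping.keys t"
  then have "t + Poly_Mapping.single x 1 \<in> Poly_Mapping.keys p"
    by (simp add: in_keys_iff lookup_xquot)
  moreover have "y \<in> Poly_Mapping.keys (t + Poly_Mapping.single x 1)"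
    using t(2) by (simp add: in_keys_iff lookup_add)
  ultimately show "y \<in> V" using assms by (auto simp: polys_iff)
qed

lemma trunc_eq_self: "\<exists>D. \<forall>D'\<ge>D. trunc x D' p = p"
proof -
  define D where "D = Suc (Max (insert 0 ((\<lambda>t. Poly_Mapping.lookup t x) ` Poly_Mapping.keys p)))"
  have "Poly_Mapping.lookup t x < D" if "t \<in> Poly_Mapping.keys p" for t
    unfolding D_def using that by (intro le_imp_less_Suc Max_ge) auto
  then have "trunc x D' p = p" if "D' \<ge> D" for D'
    using that by (intro poly_mapping_eqI) (force simp: lookup_trunc in_keys_iff)
  then show ?thesis by blast
qed

lemma pvar_in_polys: "x \<in> V \<Longrightarrow> pvar x \<in> polys V"
  unfolding pvar_def by (intro single_in_polys) simp

lemma mono_ideal_colon_pvar: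
  assumes "x \<in> V"
  shows "p \<in> mono_ideal V {t. t + Poly_Mapping.single x 1 \<in> A} \<longleftrightarrow>
    p \<in> polys V \<and> pvar x * p \<in> mono_ideal V A"
proof -
  have "Poly_Mapping.keys (pvar x * p) = (\<lambda>t. t + Poly_Mapping.single x 1) ` Poly_Mapping.keys p"
  proof (intro subset_antisym subsetI)
    fix t assume t: "t \<in> Poly_Mapping.keys (pvar x * p)"
    then have "Poly_Mapping.lookup t x \<noteq> 0" "t - Poly_Mapping.single x 1 \<in> Poly_Mapping.keys p"
      by (auto simp: in_keys_iff lookup_pvar_mult split: if_splits)
    moreover from this(1) have "t = (t - Poly_Mapping.single x 1) + Poly_Mapping.single x 1"
      by (intro poly_mapping_eqI) (auto simp: lookup_add lookup_minus lookup_single when_def)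
    ultimately show "t \<in> (\<lambda>t. t + Poly_Mapping.single x 1) ` Poly_Mapping.keys p" by blast
  next
    fix t assume "t \<in> (\<lambda>t. t + Poly_Mapping.single x 1) ` Poly_Mapping.keys p"
    then show "t \<in> Poly_Mapping.keys (pvar x * p)"
      by (auto simp: in_keys_iff lookup_pvar_mult lookup_add)
  qed
  moreover have "pvar x * p \<in> polys V" if "p \<in> polys V"
    using that pvar_in_polys[OF assms] by (rule polys.mult_in[rotated])
  ultimately show ?thesis by (auto simp: mono_ideal_def)
qed

section \<open>Koszul homology of colon ideals\<close>

definition ftrunc :: "'v \<Rightarrow> nat \<Rightarrow> ('i \<Rightarrow> ('v, 'k::field) mpoly) \<Rightarrow> 'i \<Rightarrow> ('v, 'k) mpoly" where
  "ftrunc x D c = (\<lambda>L. trunc x D (c L))"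

lemma trunc_diff: "trunc x D (p - q) = trunc x D p - trunc x D q"
  using trunc_add[of x D p "- q"] by (simp add: trunc_uminus)

lemma ftrunc_simps:
  "lo (ftrunc x D c') = ftrunc x D (lo c')" "hi (ftrunc x D c') = ftrunc x D (hi c')"
  "ftrunc x D (bjoin u w) = bjoin (ftrunc x D u) (ftrunc x D w)"
  "ftrunc x D (c + e) = ftrunc x D c + ftrunc x D e"
  "ftrunc x D (- c) = - ftrunc x D c"
  "ftrunc x D (c - e) = ftrunc x D c - ftrunc x D e"
  "ftrunc x D 0 = 0"
  "y \<noteq> x \<Longrightarrow> ftrunc x D (smul (pvar y) c) = smul (pvar y) (ftrunc x D c)"
  "ftrunc x (Suc D) (smul (pvar x) c) = smul (pvar x) (ftrunc x D c)"
  "ftrunc x 1 (smul (pvar x) c) = 0"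
  "ftrunc x D (ftrunc x D c) = ftrunc x D c"
  using trunc_1_pvar_mult[of x]
  by (auto simp: ftrunc_def lo_def hi_def bjoin_def smul_def fun_eq_iff trunc_add trunc_uminus
      trunc_diff trunc_0 trunc_pvar_mult trunc_pvar_mult_same split: list.splits
      intro: poly_mapping_eqI simp: lookup_trunc)

lemma ftrunc_koszul_d:
  "x \<notin> set ys \<Longrightarrow> ftrunc x D (koszul_d (map pvar ys) c) = koszul_d (map pvar ys) (ftrunc x D c)"
proof (induction ys arbitrary: c)
  case (Cons y ys)
  then have "y \<noteq> x" by auto
  then show ?case using Cons by (simp add: ftrunc_simps(1-5) ftrunc_simps(8))
qed (simp add: ftrunc_simps)

lemma chain_ftrunc:
  assumes c: "c \<in> polys.chain V n i"
  shows "ftrunc x D c \<in> polys.chain V n i"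
proof -
  have "c L \<in> polys V" for L using c by (simp add: polys.chain_def polys.fn_in_def)
  then have "trunc x D (c L) \<in> polys V" for L by (rule trunc_in_polys)
  moreover have "length L = n \<and> int (count_list L True) = i" if "trunc x D (c L) \<noteq> 0" for L
  proof -
    have "c L \<noteq> 0" using that trunc_0 by metis
    then show ?thesis using c by (simp add: polys.chain_def)
  qed
  ultimately show ?thesis by (simp add: polys.chain_def polys.fn_in_def ftrunc_def)
qed

lemma fn_in_ftrunc: "polys.fn_in (mono_ideal V A) c \<Longrightarrow> polys.fn_in (mono_ideal V A) (ftrunc x D c)"
  unfolding polys.fn_in_def ftrunc_def by (intro allI trunc_in_mono_ideal) (rule spec)

definition fxquot :: "'v \<Rightarrow> ('i \<Rightarrow> ('v, 'k::field) mpoly) \<Rightarrow> 'i \<Rightarrow> ('v, 'k) mpoly" where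
  "fxquot x c = (\<lambda>L. xquot x (c L))"

lemma xquot_0: "xquot x 0 = 0"
  by (intro poly_mapping_eqI) (simp add: lookup_xquot)

lemma chain_fxquot:
  assumes c: "c \<in> polys.chain V n i"
  shows "fxquot x c \<in> polys.chain V n i"
proof -
  have "c L \<in> polys V" for L using c by (simp add: polys.chain_def polys.fn_in_def)
  then have "xquot x (c L) \<in> polys V" for L by (rule xquot_in_polys)
  moreover have "length L = n \<and> int (count_list L True) = i" if "xquot x (c L) \<noteq> 0" for L
  proof -
    have "c L \<noteq> 0" using that xquot_0 by metis
    then show ?thesis using c by (simp add: polys.chain_def)
  qed
  ultimately show ?thesis by (simp add: polys.chain_def polys.fn_in_def fxquot_def)
qed

lemma fxquot_decomp: "c = ftrunc x 1 c + smul (pvar x) (fxquot x c)"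
  using trunc_xquot by (auto simp: fun_eq_iff ftrunc_def fxquot_def smul_def)

text \<open>A chain is supported on the finitely many lists of length \<open>n\<close>, so one
  degree bound serves all its coefficients.\<close>

lemma chain_ftrunc_eq_self:
  assumes "c \<in> polys.chain V n i"
  shows "\<exists>D. ftrunc x D c = c"
proof -
  have "\<exists>D. \<forall>D'\<ge>D. trunc x D' (c L) = c L" for L by (rule trunc_eq_self)
  then obtain D where D: "\<And>L D'. D' \<ge> D L \<Longrightarrow> trunc x D' (c L) = c L" by metis
  define N where "N = Max (D ` {L. length L = n})"
  have fin: "finite {L :: bool list. length L = n}"
    using finite_lists_length_eq[of "UNIV :: bool set" n] by simp
  have "trunc x N (c L) = c L" for L
  proof (cases "length L = n")
    case True
    then have "D L \<le> N" unfolding N_def using fin by (intro Max_ge) auto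
    then show ?thesis by (rule D)
  next
    case False
    then have "c L = 0" using assms unfolding polys.chain_def by blast
    then show ?thesis by (simp add: trunc_0)
  qed
  then have "ftrunc x N c = c" by (simp add: ftrunc_def)
  then show ?thesis by blast
qed

text \<open>In the mapping cone sequence the cokernel of \<open>x\<close> on the homology of
  \<open>ys\<close> embeds into the homology of \<open>x\<close> and \<open>ys\<close>. So
  \<open>x\<close> acts surjectively in degree \<open>i\<close>, and as it raises the degree in
  \<open>x\<close>, a graded Nakayama argument by induction on \<open>D\<close> makes that homology
  zero.\<close>

lemma koszul_exact_drop_variable:
  fixes A :: "('v \<Rightarrow>\<^sub>0 nat) set" and V :: "'v set" and x :: 'v
  defines "J \<equiv> mono_ideal V A :: ('v, 'k::field) mpoly set"
  assumes A: "up_closed A" and x: "x \<in> V" "x \<notin> set ys" and ys: "set ys \<subseteq> V"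
    and ex: "polys.koszul_exact V (pvar x # map pvar ys) J i"
  shows "polys.koszul_exact V (map pvar ys) J i"
proof -
  have J: "polys.ideal_in V J" unfolding J_def by (rule ideal_in_mono_ideal[OF A])
  note ops = polys.fn_in_ops[OF J]
  let ?xs = "map pvar ys :: ('v, 'k) mpoly list"
  let ?d = "koszul_d ?xs"
  have xP: "pvar x \<in> (polys V :: ('v, 'k) mpoly set)" by (rule pvar_in_polys[OF x(1)])
  have main: "\<exists>e \<in> polys.chain V (length ?xs) (i + 1). polys.fn_in J (u - ?d e)"
    if "u \<in> polys.chain V (length ?xs) i" "ftrunc x D u = u" "polys.fn_in J (?d u)" for u D
    using that
  proof (induction D arbitrary: u)
    case 0
    have "u = 0" using 0(2) by (simp add: ftrunc_def fun_eq_iff trunc_below_0)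
    then have "u - ?d 0 = 0" by (simp only: koszul_d_0 diff_0_right)
    then have "polys.fn_in J (u - ?d 0)" by (simp only: ops(4))
    then show ?case using polys.chain_ops(4) by blast
  next
    case (Suc D)
    \<comment> \<open>A cycle \<open>u\<close> of \<open>ys\<close> becomes a cycle of the cone when
      placed in the \<open>lo\<close> half. A bounding chain \<open>E\<close> then writes
      \<open>u\<close> as a boundary plus \<open>x\<close> times the cycle
      \<open>hi E\<close>.\<close>
    have c: "bjoin u 0 \<in> polys.chain V (length (pvar x # ?xs)) i"
      using polys.chain_bjoin[OF Suc.prems(1) polys.chain_ops(4)] by simp
    have "koszul_d (pvar x # ?xs) (bjoin u 0) = bjoin (?d u) 0"
      by (simp add: smul_simps)
    then have "polys.fn_in J (koszul_d (pvar x # ?xs) (bjoin u 0))"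
      using Suc.prems(3) by (simp only: polys.fn_in_bjoin[OF J] ops simp_thms)
    then obtain E where E: "E \<in> polys.chain V (length (pvar x # ?xs)) (i + 1)"
      "polys.fn_in J (bjoin u 0 - koszul_d (pvar x # ?xs) E)"
      using ex c unfolding polys.koszul_exact_def by blast
    have lo: "polys.fn_in J (u - (?d (lo E) + smul (pvar x) (hi E)))"
      using polys.fn_in_lo[OF E(2)] by simp
    have hi: "polys.fn_in J (?d (hi E))"
      using polys.fn_in_hi[OF E(2)] by simp
    have loE: "lo E \<in> polys.chain V (length ?xs) (i + 1)"
      and hiE: "hi E \<in> polys.chain V (length ?xs) i"
      using polys.chain_lo[of E V "length ?xs" "i + 1"] polys.chain_hi[of E V "length ?xs" "i + 1"] E(1)
      by simp_all
    \<comment> \<open>Truncation bounds differ by one because \<open>w\<close> enters multiplied by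
      \<open>x\<close>; thus \<open>w\<close> falls under the induction hypothesis for
      \<open>D\<close>.\<close>
    define w where "w = ftrunc x D (hi E)"
    define e where "e = ftrunc x (Suc D) (lo E)"
    have w: "w \<in> polys.chain V (length ?xs) i" unfolding w_def by (rule chain_ftrunc[OF hiE])
    have e: "e \<in> polys.chain V (length ?xs) (i + 1)" unfolding e_def by (rule chain_ftrunc[OF loE])
    have "?d w = ftrunc x D (?d (hi E))" unfolding w_def by (simp only: ftrunc_koszul_d[OF x(2)])
    then have "polys.fn_in J (?d w)" using fn_in_ftrunc hi unfolding J_def by metis
    moreover have "ftrunc x D w = w" unfolding w_def by (rule ftrunc_simps(11))
    ultimately obtain g where g: "g \<in> polys.chain V (length ?xs) (i + 1)" "polys.fn_in J (w - ?d g)"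
      using Suc.IH[OF w] by blast
    have "ftrunc x (Suc D) (u - (?d (lo E) + smul (pvar x) (hi E))) = u - (?d e + smul (pvar x) w)"
      by (simp only: ftrunc_simps(4,6,9) ftrunc_koszul_d[OF x(2)] Suc.prems(2) e_def w_def)
    then have "polys.fn_in J (u - (?d e + smul (pvar x) w))"
      using fn_in_ftrunc lo unfolding J_def by metis
    then have "polys.fn_in J ((u - (?d e + smul (pvar x) w)) + smul (pvar x) (w - ?d g))"
      by (intro ops(1)[OF _ ops(5)[OF xP g(2)]])
    moreover have "(u - (?d e + smul (pvar x) w)) + smul (pvar x) (w - ?d g) =
        u - ?d (e + smul (pvar x) g)"
      by (simp add: koszul_d_add koszul_d_smul smul_simps)
    moreover have "e + smul (pvar x) g \<in> polys.chain V (length ?xs) (i + 1)"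
      by (intro polys.chain_ops e g(1) xP)
    ultimately show ?case by metis
  qed
  show ?thesis unfolding polys.koszul_exact_def
  proof (intro ballI impI)
    fix u assume u: "u \<in> polys.chain V (length ?xs) i" "polys.fn_in J (?d u)"
    obtain D where "ftrunc x D u = u" using chain_ftrunc_eq_self[OF u(1)] by blast
    then show "\<exists>e \<in> polys.chain V (length ?xs) (i + 1). polys.fn_in J (u - ?d e)"
      using main u by blast
  qed
qed

text \<open>A cycle \<open>c\<close> modulo \<open>J : x\<close> gives the cycle \<open>x c\<close>
  modulo \<open>J\<close>, which bounds some \<open>E\<close>. The task is to divide
  \<open>E\<close> by \<open>x\<close>: its part of degree zero in \<open>x\<close> is an
  obstruction, and it is removed with the vanishing for \<open>ys\<close> alone.\<close>

lemma koszul_exact_colon_variable: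
  fixes A :: "('v \<Rightarrow>\<^sub>0 nat) set" and V :: "'v set" and x :: 'v
  defines "J \<equiv> mono_ideal V A :: ('v, 'k::field) mpoly set"
  defines "J' \<equiv> mono_ideal V {t. t + Poly_Mapping.single x 1 \<in> A} :: ('v, 'k::field) mpoly set"
  assumes A: "up_closed A" and x: "x \<in> V" "x \<notin> set ys" and ys: "set ys \<subseteq> V"
    and ex: "polys.koszul_exact V (pvar x # map pvar ys) J i"
  shows "polys.koszul_exact V (pvar x # map pvar ys) J' i"
  unfolding polys.koszul_exact_def
proof (intro ballI impI)
  have J: "polys.ideal_in V J" unfolding J_def by (rule ideal_in_mono_ideal[OF A])
  note ops = polys.fn_in_ops[OF J]
  let ?xs = "map pvar ys :: ('v, 'k) mpoly list"
  let ?d = "koszul_d ?xs"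
  let ?X = "pvar x :: ('v, 'k) mpoly"
  have xP: "?X \<in> polys V" by (rule pvar_in_polys[OF x(1)])
  have xsP: "set ?xs \<subseteq> polys V" using ys by (auto intro!: pvar_in_polys)
  have ex': "polys.koszul_exact V ?xs J i"
    using koszul_exact_drop_variable[OF A x ys] ex unfolding J_def by blast
  have J'_iff: "polys.fn_in J' c \<longleftrightarrow> polys.fn_in (polys V) c \<and> polys.fn_in J (smul ?X c)"
    for c :: "bool list \<Rightarrow> _"
    unfolding J_def J'_def polys.fn_in_def smul_def mono_ideal_colon_pvar[OF x(1)] by blast
  fix c assume c: "c \<in> polys.chain V (length (?X # ?xs)) i"
    "polys.fn_in J' (koszul_d (?X # ?xs) c)"
  have "koszul_d (?X # ?xs) (smul ?X c) = smul ?X (koszul_d (?X # ?xs) c)"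
    by (rule koszul_d_smul)
  then have "polys.fn_in J (koszul_d (?X # ?xs) (smul ?X c))" using c(2) J'_iff by metis
  moreover have "smul ?X c \<in> polys.chain V (length (?X # ?xs)) i"
    by (rule polys.chain_ops(5)[OF xP c(1)])
  ultimately obtain E where E: "E \<in> polys.chain V (length (?X # ?xs)) (i + 1)"
    "polys.fn_in J (smul ?X c - koszul_d (?X # ?xs) E)"
    using ex unfolding polys.koszul_exact_def by blast
  define u w e g where "u = lo c" and "w = hi c" and "e = lo E" and "g = hi E"
  have lo: "polys.fn_in J (smul ?X u - (?d e + smul ?X g))"
    using polys.fn_in_lo[OF E(2)] by (simp add: u_def e_def g_def)
  have hi: "polys.fn_in J (smul ?X w + ?d g)"
    using polys.fn_in_hi[OF E(2)] by (simp add: w_def g_def)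
  have e: "e \<in> polys.chain V (length ?xs) (i + 1)" and g: "g \<in> polys.chain V (length ?xs) i"
    using polys.chain_lo[of E V "length ?xs" "i + 1"] polys.chain_hi[of E V "length ?xs" "i + 1"] E(1)
    by (simp_all add: e_def g_def)
  \<comment> \<open>In both relations the terms with factor \<open>x\<close> have no part of degree
    zero in \<open>x\<close>, so truncation shows that \<open>e0\<close> and \<open>g0\<close> are
    cycles of \<open>ys\<close> modulo \<open>J\<close>.\<close>
  define e0 e1 g0 g1 where "e0 = ftrunc x 1 e" and "e1 = fxquot x e"
    and "g0 = ftrunc x 1 g" and "g1 = fxquot x g"
  have e_eq: "e = e0 + smul ?X e1" and g_eq: "g = g0 + smul ?X g1"
    unfolding e0_def e1_def g0_def g1_def by (rule fxquot_decomp)+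
  have e1: "e1 \<in> polys.chain V (length ?xs) (i + 1)" unfolding e1_def by (rule chain_fxquot[OF e])
  have g1: "g1 \<in> polys.chain V (length ?xs) i" unfolding g1_def by (rule chain_fxquot[OF g])
  have g0: "g0 \<in> polys.chain V (length ?xs) i" unfolding g0_def by (rule chain_ftrunc[OF g])
  have "ftrunc x 1 (smul ?X u - (?d e + smul ?X g)) = - ?d e0"
    by (simp only: ftrunc_simps(4,6,10) ftrunc_koszul_d[OF x(2)] e0_def add_0_right diff_0)
  then have "polys.fn_in J (- ?d e0)" using fn_in_ftrunc lo unfolding J_def by metis
  then have "polys.fn_in J (- (- ?d e0))" by (rule ops(3))
  then have de0: "polys.fn_in J (?d e0)" by simp
  have "ftrunc x 1 (smul ?X w + ?d g) = ?d g0"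
    by (simp only: ftrunc_simps(4,6,10) ftrunc_koszul_d[OF x(2)] g0_def add_0_left)
  then have dg0: "polys.fn_in J (?d g0)" using fn_in_ftrunc hi unfolding J_def by metis
  then obtain h where h: "h \<in> polys.chain V (length ?xs) (i + 1)" "polys.fn_in J (g0 - ?d h)"
    using ex' g0 unfolding polys.koszul_exact_def by blast
  \<comment> \<open>This is \<open>E\<close> divided by \<open>x\<close>, without the cycles
    \<open>e0\<close> and \<open>g0\<close>. Dropping \<open>g0\<close> loses the term
    \<open>x g0\<close> in the \<open>lo\<close> half, which \<open>h\<close> restores since
    \<open>g0\<close> is the boundary of \<open>h\<close> modulo \<open>J\<close>.\<close>
  define E' where "E' = bjoin (e1 + h) g1"
  have E': "E' \<in> polys.chain V (length (?X # ?xs)) (i + 1)"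
    using polys.chain_bjoin[OF polys.chain_ops(1)[OF e1 h(1)], of g1] g1 by (simp add: E'_def)
  have c_eq: "bjoin u w = c" unfolding u_def w_def using c(1)
    by (intro polys.chain_bjoin_lo_hi) simp
  have "smul ?X (c - koszul_d (?X # ?xs) E') =
     bjoin (smul ?X (u - (?d (e1 + h) + smul ?X g1))) (smul ?X (w + ?d g1))"
    by (simp add: E'_def bjoin_simps flip: c_eq)
  moreover have "smul ?X (u - (?d (e1 + h) + smul ?X g1)) =
     (smul ?X u - (?d e + smul ?X g)) + ?d e0 + smul ?X (g0 - ?d h)"
    unfolding e_eq g_eq by (simp add: koszul_d_add koszul_d_smul smul_simps algebra_simps)
  moreover have "smul ?X (w + ?d g1) = (smul ?X w + ?d g) - ?d g0"
    unfolding g_eq by (simp add: koszul_d_add koszul_d_smul smul_simps)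
  ultimately have "smul ?X (c - koszul_d (?X # ?xs) E') =
     bjoin ((smul ?X u - (?d e + smul ?X g)) + ?d e0 + smul ?X (g0 - ?d h))
       ((smul ?X w + ?d g) - ?d g0)"
    by simp
  moreover have "polys.fn_in J ((smul ?X u - (?d e + smul ?X g)) + ?d e0 + smul ?X (g0 - ?d h))"
    by (intro ops(1) ops(5) lo de0 h(2) xP)
  moreover have "polys.fn_in J ((smul ?X w + ?d g) - ?d g0)"
    by (intro ops(2) hi dg0)
  ultimately have "polys.fn_in J (smul ?X (c - koszul_d (?X # ?xs) E'))"
    by (simp only: polys.fn_in_bjoin[OF J] simp_thms)
  moreover have "polys.fn_in (polys V) (c - koszul_d (?X # ?xs) E')"
    using polys.chain_fn_in[OF c(1)] polys.chain_fn_in[OF E'] xsP xP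
    by (intro polys.fn_in_ops(2)[OF polys.ideal_in_S] polys.fn_in_koszul_d[OF polys.ideal_in_S]) auto
  ultimately have "polys.fn_in J' (c - koszul_d (?X # ?xs) E')" using J'_iff by blast
  then show "\<exists>e \<in> polys.chain V (length (?X # ?xs)) (i + 1).
      polys.fn_in J' (c - koszul_d (?X # ?xs) e)"
    using E' by blast
qed

section \<open>Depth of colon ideals\<close>

lemma var_ideal_gen:
  assumes "polys.ideal_in V I" "pvar ` W \<subseteq> I" "W \<subseteq> V"
  shows "(var_ideal V W :: ('v, 'k::field) mpoly set) \<subseteq> I"
proof -
  interpret R: cring "poly_ring V :: ('v, 'k) mpoly ring" by (rule cring_poly_ring)
  show ?thesis unfolding var_ideal_def
    using assms by (intro R.genideal_minimal) (simp_all add: ideal_iff)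
qed

lemma up_closed_vars: "up_closed {t. \<exists>v\<in>W. Poly_Mapping.lookup t v \<noteq> (0::nat)}"
  by (auto simp: up_closed_def lookup_add)

lemma ideal_in_var_ideal: "W \<subseteq> V \<Longrightarrow> polys.ideal_in V (var_ideal V W :: ('v, 'k::field) mpoly set)"
  by (subst var_ideal_eq, assumption) (rule ideal_in_mono_ideal[OF up_closed_vars])

lemma pvar_in_var_ideal: "W \<subseteq> V \<Longrightarrow> v \<in> W \<Longrightarrow> pvar v \<in> var_ideal V W"
  unfolding var_ideal_eq mono_ideal_def
  by (auto simp: pvar_def intro!: single_in_polys bexI[of _ v])

lemma one_notin_var_ideal: "W \<subseteq> V \<Longrightarrow> 1 \<notin> var_ideal V W"
  by (simp add: var_ideal_eq mono_ideal_def)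

text \<open>Goes from a regular sequence to Koszul vanishing, across the colon, and back. The new
  sequence \<open>bs\<close> shares nothing with \<open>as\<close> but its length.\<close>

lemma regular_list_colon_variable:
  fixes A :: "('v::linorder \<Rightarrow>\<^sub>0 nat) set" and V :: "'v set" and x :: 'v
  defines "J \<equiv> mono_ideal V A :: ('v, 'k::field) mpoly set"
  defines "J' \<equiv> mono_ideal V {t. t + Poly_Mapping.single x 1 \<in> A} :: ('v, 'k::field) mpoly set"
  assumes V: "finite V" and A: "up_closed A" and x: "x \<in> V" and J': "J' \<subseteq> var_ideal V V"
    and as: "set as \<subseteq> var_ideal V V" "polys.regular_list V J as"
  shows "\<exists>bs. length bs = length as \<and> set bs \<subseteq> var_ideal V V \<and> polys.regular_list V J' bs \<and>
    polys.seq_ideal V J' bs \<subseteq> var_ideal V V"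
proof -
  \<comment> \<open>The Koszul complex is that of all variables, arranged with \<open>x\<close> at
    the head so that it is the mapping cone of \<open>x\<close>.\<close>
  obtain ys where ys: "set ys = V - {x}" using V finite_list[of "V - {x}"] by auto
  let ?xs = "pvar x # map pvar ys :: ('v, 'k) mpoly list"
  have set_xs: "set ?xs = pvar ` V" using ys x by auto
  have xsP: "set ?xs \<subseteq> polys V" unfolding set_xs using pvar_in_polys by auto
  have "up_closed {t. t + Poly_Mapping.single x 1 \<in> A}"
    using A by (simp add: up_closed_def add.assoc)
  then have idJ': "polys.ideal_in V J'" unfolding J'_def by (rule ideal_in_mono_ideal)
  have idJ: "polys.ideal_in V J" unfolding J_def by (rule ideal_in_mono_ideal[OF A])
  show ?thesis
  proof (rule polys.koszul_exact_regular_list[where xs = ?xs])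
    show "subring_of_type.acc_ideals (polys V :: ('v, 'k) mpoly set)" by (rule acc_polys[OF V])
    show "polys.ideal_in V (var_ideal V V :: ('v, 'k) mpoly set)"
      by (rule ideal_in_var_ideal) simp
    show "set ?xs \<subseteq> var_ideal V V" unfolding set_xs by (auto intro: pvar_in_var_ideal)
    show "polys.koszul_exact V ?xs J' i" if "i > int (length ?xs) - int (length as)" for i
    proof -
      have "polys.koszul_exact V ?xs J i"
      proof (rule polys.regular_list_koszul_exact[OF _ xsP idJ as that])
        show "var_ideal V V \<subseteq> I" if "polys.ideal_in V I" "set ?xs \<subseteq> I" for I
          using that by (intro var_ideal_gen) (simp_all only: set_xs subset_refl)
      qed
      then show ?thesis unfolding J_def J'_def
        by (intro koszul_exact_colon_variable A x) (use ys in auto)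
    qed
  qed (fact idJ' J')+
qed

lemma quot_module_coset:
  fixes J :: "('v, 'k::field) mpoly set"
  assumes "polys.ideal_in V J"
  defines "co \<equiv> a_r_coset (poly_ring V) J"
  shows "carrier (quot_module (poly_ring V) J) = co ` polys V"
    "\<zero>\<^bsub>quot_module (poly_ring V) J\<^esub> = co 0"
    "p \<in> polys V \<Longrightarrow> q \<in> polys V \<Longrightarrow> co p \<oplus>\<^bsub>quot_module (poly_ring V) J\<^esub> co q = co (p + q)"
    "r \<in> polys V \<Longrightarrow> p \<in> polys V \<Longrightarrow> r \<odot>\<^bsub>quot_module (poly_ring V) J\<^esub> co p = co (r * p)"
    "p \<in> polys V \<Longrightarrow> q \<in> polys V \<Longrightarrow> co p = co q \<longleftrightarrow> p - q \<in> J"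
proof -
  let ?R = "poly_ring V :: ('v, 'k) mpoly ring"
  interpret R: cring ?R by (rule cring_poly_ring)
  interpret I: ideal J ?R using assms(1) ideal_iff by blast
  interpret h: ring_hom_ring ?R "?R Quot J" "(+>\<^bsub>?R\<^esub>) J" by (rule I.rcos_ring_hom_ring)
  show "carrier (quot_module ?R J) = co ` polys V"
    by (auto simp: quot_module_def FactRing_def A_RCOSETS_def' co_def)
  show "\<zero>\<^bsub>quot_module ?R J\<^esub> = co 0"
    using h.hom_zero by (simp add: quot_module_def co_def)
  show "co p \<oplus>\<^bsub>quot_module ?R J\<^esub> co q = co (p + q)" if "p \<in> polys V" "q \<in> polys V"
    using h.hom_add[OF that] by (simp add: quot_module_def co_def)
  show "r \<odot>\<^bsub>quot_module ?R J\<^esub> co p = co (r * p)" if "r \<in> polys V" "p \<in> polys V"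
    using h.hom_mult[OF that] by (simp add: quot_module_def co_def)
  show "co p = co q \<longleftrightarrow> p - q \<in> J" if "p \<in> polys V" "q \<in> polys V"
  proof -
    have "\<ominus>\<^bsub>?R\<^esub> q = - q" using that polys.uminus_in by (intro R.minus_equality) auto
    then have "p \<ominus>\<^bsub>?R\<^esub> q = p - q" by (simp add: a_minus_def)
    then show ?thesis
      using R.quotient_eq_iff_same_a_r_cos[OF I.ideal_axioms that] by (simp add: co_def)
  qed
qed

lemma seq_ideal_superset: "J \<subseteq> polys.seq_ideal V J as"
proof (induction as)
  case (Cons a as)
  then show ?case using polys.plus_mult_superset by fastforce
qed simp

lemma seq_smult_quot:
  fixes J :: "('v, 'k::field) mpoly set"
  assumes J: "polys.ideal_in V J" and as: "set as \<subseteq> polys V"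
  shows "seq_smult (quot_module (poly_ring V) J) as =
    a_r_coset (poly_ring V) J ` polys.seq_ideal V J as"
  using as
proof (induction as)
  case Nil
  note C = quot_module_coset[OF J]
  have "a_r_coset (poly_ring V) J p = a_r_coset (poly_ring V) J 0" if "p \<in> J" for p
    using that polys.ideal_inD(6)[OF J that] by (simp add: C(5))
  then have "a_r_coset (poly_ring V) J ` J = (\<lambda>p. a_r_coset (poly_ring V) J 0) ` J"
    by (intro image_cong refl)
  also have "\<dots> = {a_r_coset (poly_ring V) J 0}" using polys.ideal_inD(2)[OF J] by blast
  finally show ?case by (simp only: seq_smult.simps polys.seq_ideal.simps C(2))
next
  case (Cons a as)
  note C = quot_module_coset[OF J]
  let ?co = "a_r_coset (poly_ring V) J" and ?M = "quot_module (poly_ring V) J"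
  have a: "a \<in> polys V" using Cons.prems by simp
  have K: "polys.ideal_in V (polys.seq_ideal V J as)"
    using Cons.prems by (intro polys.ideal_in_seq_ideal[OF J]) auto
  have eq: "a \<odot>\<^bsub>?M\<^esub> ?co p \<oplus>\<^bsub>?M\<^esub> ?co q = ?co (a * p + q)"
    if "p \<in> polys V" "q \<in> polys.seq_ideal V J as" for p q
    using that a polys.ideal_inD(6)[OF K] by (simp add: C(3,4))
  have "seq_smult ?M (a # as) =
      {a \<odot>\<^bsub>?M\<^esub> v \<oplus>\<^bsub>?M\<^esub> w | v w. v \<in> ?co ` polys V \<and> w \<in> ?co ` polys.seq_ideal V J as}"
    using Cons.IH Cons.prems by (simp only: seq_smult.simps C(1) list.set insert_subset simp_thms)
  also have "\<dots> = {a \<odot>\<^bsub>?M\<^esub> ?co p \<oplus>\<^bsub>?M\<^esub> ?co q | p q. p \<in> polys V \<and> q \<in> polys.seq_ideal V J as}"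
    by blast
  also have "\<dots> = {?co (a * p + q) | p q. p \<in> polys V \<and> q \<in> polys.seq_ideal V J as}"
  proof -
    have "x = a \<odot>\<^bsub>?M\<^esub> ?co p \<oplus>\<^bsub>?M\<^esub> ?co q \<and> p \<in> polys V \<and> q \<in> polys.seq_ideal V J as \<longleftrightarrow>
        x = ?co (a * p + q) \<and> p \<in> polys V \<and> q \<in> polys.seq_ideal V J as" for x p q
      using eq[of p q] by (cases "p \<in> polys V \<and> q \<in> polys.seq_ideal V J as") auto
    then show ?thesis by presburger
  qed
  also have "\<dots> = ?co ` polys.seq_ideal V J (a # as)"
    by (auto simp: polys.plus_mult_def)
  finally show ?case .
qed

lemma coset_mem_seq_smult:
  fixes J :: "('v, 'k::field) mpoly set"
  assumes J: "polys.ideal_in V J" and as: "set as \<subseteq> polys V" and p: "p \<in> polys V"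
  shows "a_r_coset (poly_ring V) J p \<in> seq_smult (quot_module (poly_ring V) J) as \<longleftrightarrow>
    p \<in> polys.seq_ideal V J as"
proof
  note K = polys.ideal_in_seq_ideal[OF J as]
  assume "a_r_coset (poly_ring V) J p \<in> seq_smult (quot_module (poly_ring V) J) as"
  then obtain q where q: "q \<in> polys.seq_ideal V J as"
    "a_r_coset (poly_ring V) J p = a_r_coset (poly_ring V) J q"
    unfolding seq_smult_quot[OF J as] by blast
  then have "p - q \<in> J" using quot_module_coset(5)[OF J p] polys.ideal_inD(6)[OF K] by blast
  then have "p - q \<in> polys.seq_ideal V J as" using seq_ideal_superset by blast
  then have "(p - q) + q \<in> polys.seq_ideal V J as" using q(1) by (rule polys.ideal_inD(3)[OF K])
  then show "p \<in> polys.seq_ideal V J as" by simp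
qed (simp add: seq_smult_quot[OF J as])

lemma regular_seq_quot_iff:
  fixes J :: "('v, 'k::field) mpoly set"
  assumes J: "polys.ideal_in V J" and as: "set as \<subseteq> polys V"
  shows "regular_seq (quot_module (poly_ring V) J) as \<longleftrightarrow>
    polys.regular_list V J as \<and> polys.seq_ideal V J as \<noteq> polys V"
proof -
  note C = quot_module_coset[OF J]
  let ?co = "a_r_coset (poly_ring V) J" and ?M = "quot_module (poly_ring V) J"
  have "(\<forall>v \<in> carrier ?M. (as ! i) \<odot>\<^bsub>?M\<^esub> v \<in> seq_smult ?M (take i as) \<longrightarrow>
       v \<in> seq_smult ?M (take i as)) \<longleftrightarrow>
      polys.regular_on V (polys.seq_ideal V J (take i as)) (as ! i)" if i: "i < length as" for i
  proof -
    have ai: "as ! i \<in> polys V" using as i by (auto simp: subset_iff)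
    have ti: "set (take i as) \<subseteq> polys V" using as by (auto dest: in_set_takeD)
    show ?thesis unfolding polys.regular_on_def C(1)
      using coset_mem_seq_smult[OF J ti] C(4)[OF ai] polys.mult_in[OF ai] by simp
  qed
  moreover have "seq_smult ?M as = carrier ?M \<longleftrightarrow> polys.seq_ideal V J as = polys V"
  proof
    assume eq: "seq_smult ?M as = carrier ?M"
    have "p \<in> polys.seq_ideal V J as" if p: "p \<in> polys V" for p
      using coset_mem_seq_smult[OF J as p] eq C(1) p by blast
    then show "polys.seq_ideal V J as = polys V"
      using polys.ideal_inD(1)[OF polys.ideal_in_seq_ideal[OF J as]] by blast
  next
    assume "polys.seq_ideal V J as = polys V"
    then show "seq_smult ?M as = carrier ?M" using seq_smult_quot[OF J as] C(1) by simp
  qed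
  ultimately show ?thesis unfolding regular_seq_def polys.regular_list_iff by blast
qed

lemma depth_colon_variable:
  fixes A :: "('v::linorder \<Rightarrow>\<^sub>0 nat) set" and V :: "'v set" and x :: 'v
  defines "J \<equiv> mono_ideal V A :: ('v, 'k::field) mpoly set"
  defines "J' \<equiv> mono_ideal V {t. t + Poly_Mapping.single x 1 \<in> A} :: ('v, 'k::field) mpoly set"
  assumes V: "finite V" and A: "up_closed A" and x: "x \<in> V" and J': "J' \<subseteq> var_ideal V V"
  shows "depth_quot V J \<le> depth_quot V J'"
  unfolding depth_quot_def depth_def
proof (rule Sup_least)
  let ?M = "var_ideal V V :: ('v, 'k) mpoly set"
  have M: "polys.ideal_in V ?M" by (rule ideal_in_var_ideal) simp
  have idJ: "polys.ideal_in V J" unfolding J_def by (rule ideal_in_mono_ideal[OF A])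
  have "up_closed {t. t + Poly_Mapping.single x 1 \<in> A}"
    using A by (simp add: up_closed_def add.assoc)
  then have idJ': "polys.ideal_in V J'" unfolding J'_def by (rule ideal_in_mono_ideal)
  fix d assume "d \<in> {enat (length xs) |xs. set xs \<subseteq> ?M \<and> regular_seq (quot_module (poly_ring V) J) xs}"
  then obtain as where as: "d = enat (length as)" "set as \<subseteq> ?M"
    "regular_seq (quot_module (poly_ring V) J) as" by blast
  have asP: "set as \<subseteq> polys V" using as(2) polys.ideal_inD(1)[OF M] by blast
  have "polys.regular_list V J as" using regular_seq_quot_iff[OF idJ asP] as(3) by blast
  then obtain bs where bs: "length bs = length as" "set bs \<subseteq> ?M"
    "polys.regular_list V J' bs" "polys.seq_ideal V J' bs \<subseteq> ?M"
    using regular_list_colon_variable[OF V A x] J' as(2) unfolding J_def J'_def by blast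
  have bsP: "set bs \<subseteq> polys V" using bs(2) polys.ideal_inD(1)[OF M] by blast
  have "polys.seq_ideal V J' bs \<noteq> polys V"
    using bs(4) one_notin_var_ideal[of V V] polys.one_in[of V] by blast
  then have "regular_seq (quot_module (poly_ring V) J') bs"
    using regular_seq_quot_iff[OF idJ' bsP] bs(3) by blast
  then show "d \<le> Sup {enat (length xs) |xs. set xs \<subseteq> ?M \<and> regular_seq (quot_module (poly_ring V) J') xs}"
    using bs(1,2) as(1) by (intro Sup_upper CollectI exI[of _ bs]) simp
qed

section \<open>Symbolic powers\<close>

text \<open>The order of the monomial \<open>t\<close> along the prime generated by
  \<open>W\<close>: the powers of that prime are cut out by lower bounds on it.\<close>

definition deg_in :: "'v set \<Rightarrow> ('v \<Rightarrow>\<^sub>0 nat) \<Rightarrow> nat" where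
  "deg_in W t = (\<Sum>v\<in>W. Poly_Mapping.lookup t v)"

lemma deg_in_add: "deg_in W (s + t) = deg_in W s + deg_in W t"
  by (simp add: deg_in_def lookup_add sum.distrib)

lemma deg_in_ge_1: "finite W \<Longrightarrow> 1 \<le> deg_in W t \<longleftrightarrow> (\<exists>v\<in>W. Poly_Mapping.lookup t v \<noteq> 0)"
  using sum_eq_0_iff[of W "Poly_Mapping.lookup t"] by (auto simp: deg_in_def Suc_le_eq simp flip: neq0_conv)

lemma up_closed_deg_in: "up_closed {t. \<forall>W\<in>C. k \<le> deg_in W t}"
  by (auto simp: up_closed_def deg_in_add intro: trans_le_add2)

lemma var_ideal_deg_in:
  assumes "finite W" "W \<subseteq> V"
  shows "(var_ideal V W :: ('v, 'k::field) mpoly set) = mono_ideal V {t. 1 \<le> deg_in W t}"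
  using var_ideal_eq[OF assms(2)] deg_in_ge_1[OF assms(1)] by simp

lemma ideal_prod_deg_in:
  assumes "finite W" "W \<subseteq> V"
  shows "ideal_prod (poly_ring V) (mono_ideal V {t. k \<le> deg_in W t}) (var_ideal V W) =
    (mono_ideal V {t. Suc k \<le> deg_in W t} :: ('v, 'k::field) mpoly set)"
    (is "ideal_prod ?R ?A ?B = ?C")
proof
  interpret R: cring ?R by (rule cring_poly_ring)
  have up: "up_closed {t. j \<le> deg_in W t}" for j using up_closed_deg_in[of "{W}" j] by simp
  have A: "polys.ideal_in V ?A" and C: "polys.ideal_in V ?C" by (rule ideal_in_mono_ideal[OF up])+
  have B: "polys.ideal_in V ?B" by (rule ideal_in_var_ideal[OF assms(2)])
  have P: "polys.ideal_in V (ideal_prod ?R ?A ?B)"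
    using R.ideal_prod_is_ideal[of ?A ?B] A B by (simp add: ideal_iff)
  show "ideal_prod ?R ?A ?B \<subseteq> ?C"
  proof
    fix p assume "p \<in> ideal_prod ?R ?A ?B"
    then show "p \<in> ?C"
    proof (induction rule: ideal_prod.induct)
      case (prod i j)
      have "i * j \<in> polys V"
        using polys.ideal_inD(6)[OF A prod(1)] polys.ideal_inD(6)[OF B prod(2)] by (rule polys.mult_in)
      moreover have "Suc k \<le> deg_in W t" if t: "t \<in> Poly_Mapping.keys (i * j)" for t
      proof -
        obtain a b where ab: "t = a + b" "a \<in> Poly_Mapping.keys i" "b \<in> Poly_Mapping.keys j"
          using subsetD[OF keys_mult t] by blast
        then have "k \<le> deg_in W a" "1 \<le> deg_in W b"
          using prod var_ideal_deg_in[OF assms] by (auto simp: mono_ideal_def)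
        then show ?thesis by (simp add: ab(1) deg_in_add)
      qed
      ultimately show ?case by (auto simp: mono_ideal_def)
    next
      case (sum s1 s2)
      then show ?case using polys.ideal_inD(3)[OF C] by simp
    qed
  qed
  show "?C \<subseteq> ideal_prod ?R ?A ?B"
  proof (rule mono_ideal_subset[OF P])
    fix t assume t: "t \<in> {t. Suc k \<le> deg_in W t}" "Poly_Mapping.keys t \<subseteq> V"
    then have "1 \<le> deg_in W t" by simp
    then obtain v where v: "v \<in> W" "Poly_Mapping.lookup t v \<noteq> 0"
      using deg_in_ge_1[OF assms(1)] by blast
    \<comment> \<open>A monomial of order at least \<open>Suc k\<close> is split by peeling off one
      variable of \<open>W\<close>, which lowers the order by exactly one.\<close>
    define s where "s = t - Poly_Mapping.single v 1"
    have ts: "t = s + Poly_Mapping.single v 1"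
      unfolding s_def using v(2)
      by (intro poly_mapping_eqI) (auto simp: lookup_add lookup_minus lookup_single when_def)
    have "deg_in W (Poly_Mapping.single v 1) = 1"
      using v(1) assms(1) by (simp add: deg_in_def lookup_single when_def sum.delta)
    then have "k \<le> deg_in W s" using t(1) by (simp add: ts deg_in_add)
    moreover have "Poly_Mapping.keys s \<subseteq> V"
      using t(2) by (auto simp: s_def in_keys_iff lookup_minus subset_iff)
    ultimately have "Poly_Mapping.single s 1 \<in> ?A"
      by (auto simp: mono_ideal_def intro!: single_in_polys)
    then have "Poly_Mapping.single s 1 \<otimes>\<^bsub>?R\<^esub> pvar v \<in> ideal_prod ?R ?A ?B"
      using pvar_in_var_ideal[OF assms(2) v(1)] by (rule ideal_prod.prod)
    then show "Poly_Mapping.single t 1 \<in> ideal_prod ?R ?A ?B"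
      by (simp add: pvar_def mult_single ts)
  qed
qed

lemma var_ideal_power:
  assumes "finite W" "W \<subseteq> V"
  shows "var_ideal V W [^]\<^bsub>ideals_set (poly_ring V)\<^esub> k =
    (mono_ideal V {t. k \<le> deg_in W t} :: ('v, 'k::field) mpoly set)"
proof (induction k)
  case 0
  show ?case by (simp add: nat_pow_def ideals_set_def mono_ideal_def)
next
  case (Suc k)
  then show ?case
    using ideal_prod_deg_in[OF assms, of k] by (simp add: nat_pow_def ideals_set_def)
qed

definition sqfree :: "'v set \<Rightarrow> 'v \<Rightarrow>\<^sub>0 nat" where
  "sqfree X = (\<Sum>v\<in>X. Poly_Mapping.single v 1)"

lemma lookup_sqfree: "finite X \<Longrightarrow> Poly_Mapping.lookup (sqfree X) v = (if v \<in> X then 1 else 0)"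
  by (simp add: sqfree_def lookup_sum lookup_single when_def sum.delta)

lemma keys_sqfree: "finite X \<Longrightarrow> Poly_Mapping.keys (sqfree X) = X"
  by (auto simp: in_keys_iff lookup_sqfree split: if_splits)

lemma deg_in_sqfree: "finite X \<Longrightarrow> finite W \<Longrightarrow> deg_in W (sqfree X) = card (W \<inter> X)"
  by (simp add: deg_in_def lookup_sqfree sum.If_cases)

lemma sqfree_in_var_ideal:
  assumes "finite V" "X \<subseteq> V" "W \<subseteq> V"
  shows "Poly_Mapping.single (sqfree X) 1 \<in> (var_ideal V W :: ('v, 'k::field) mpoly set) \<longleftrightarrow> X \<inter> W \<noteq> {}"
proof -
  have "finite X" using assms finite_subset by blast
  then show ?thesis using assms
    by (auto simp: var_ideal_eq mono_ideal_def lookup_sqfree intro!: single_in_polys)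
       (auto simp: keys_sqfree)
qed

text \<open>The product of the variables outside \<open>W\<close> is a test monomial: it detects
  which variable primes are contained in the prime of \<open>W\<close>.\<close>

lemma cosqfree_in_var_ideal:
  assumes "finite V" "W \<subseteq> V" "W' \<subseteq> V"
  shows "Poly_Mapping.single (sqfree (V - W)) 1 \<in> (var_ideal V W' :: ('v, 'k::field) mpoly set) \<longleftrightarrow> \<not> W' \<subseteq> W"
  using sqfree_in_var_ideal[OF assms(1) _ assms(3), of "V - W"] assms by blast

lemma var_ideal_subset_iff:
  assumes "finite V" "W \<subseteq> V" "W' \<subseteq> V"
  shows "(var_ideal V W :: ('v, 'k::field) mpoly set) \<subseteq> var_ideal V W' \<longleftrightarrow> W \<subseteq> W'"
proof
  assume "(var_ideal V W :: ('v, 'k) mpoly set) \<subseteq> var_ideal V W'"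
  then show "W \<subseteq> W'"
    using cosqfree_in_var_ideal[OF assms(1,3,2), where 'k='k]
      cosqfree_in_var_ideal[OF assms(1,3,3), where 'k='k] by blast
next
  assume "W \<subseteq> W'"
  then show "(var_ideal V W :: ('v, 'k) mpoly set) \<subseteq> var_ideal V W'"
    unfolding var_ideal_eq[OF assms(2)] var_ideal_eq[OF assms(3)] mono_ideal_def by blast
qed

definition antichain_in :: "'v set \<Rightarrow> 'v set set \<Rightarrow> bool" where
  "antichain_in V C \<longleftrightarrow> (\<forall>W\<in>C. W \<subseteq> V) \<and> (\<forall>W\<in>C. \<forall>W'\<in>C. W \<subseteq> W' \<longrightarrow> W = W')"

text \<open>The test monomial of \<open>W\<close> lies outside the common intersection, so it is
  missed by some prime of the other family, whose variables then lie in \<open>W\<close>.\<close>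

lemma antichain_refines:
  fixes V :: "'v set"
  assumes V: "finite V" and CV: "\<And>W. W \<in> C \<Longrightarrow> W \<subseteq> V" and W: "W \<in> D" "W \<subseteq> V"
    and eq: "polys V \<inter> \<Inter>(var_ideal V ` C) = (polys V \<inter> \<Inter>(var_ideal V ` D) :: ('v, 'k::field) mpoly set)"
  shows "\<exists>W'\<in>C. W' \<subseteq> W"
proof -
  let ?m = "Poly_Mapping.single (sqfree (V - W)) 1 :: ('v, 'k) mpoly"
  have "?m \<notin> var_ideal V W" using cosqfree_in_var_ideal[OF V W(2) W(2)] by blast
  then have "?m \<notin> polys V \<inter> \<Inter>(var_ideal V ` D)" using W(1) by blast
  moreover have "?m \<in> polys V" using V by (intro single_in_polys) (simp add: keys_sqfree)
  ultimately obtain W' where "W' \<in> C" "?m \<notin> var_ideal V W'" using eq by blast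
  then show ?thesis using cosqfree_in_var_ideal[OF V W(2) CV] by blast
qed

text \<open>Irredundancy makes any competing family an antichain as well. Two families with the same
  intersection refine each other, and between antichains the sandwich of \<open>W''\<close> in
  \<open>W'\<close> in \<open>W\<close> collapses to equalities.\<close>

lemma the_irredundant_var_decomp:
  fixes V :: "'v set"
  assumes V: "finite V" and C: "antichain_in V C"
    and I: "I = (polys V \<inter> \<Inter>(var_ideal V ` C) :: ('v, 'k::field) mpoly set)"
  shows "(THE \<P>. irredundant_var_decomp V I \<P>) = var_ideal V ` C"
proof (rule the_equality)
  let ?v = "var_ideal V :: 'v set \<Rightarrow> ('v, 'k) mpoly set"
  have CV: "W \<subseteq> V" if "W \<in> C" for W using C that by (auto simp: antichain_in_def)
  have "C \<subseteq> Pow V" using CV by blast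
  then have "finite C" using V finite_subset by blast
  moreover have "I \<noteq> polys V \<inter> \<Inter>(?v ` C - {?v W})" if W: "W \<in> C" for W
  proof -
    let ?m = "Poly_Mapping.single (sqfree (V - W)) 1 :: ('v, 'k) mpoly"
    have "?m \<notin> I"
      using cosqfree_in_var_ideal[OF V CV[OF W] CV[OF W], where 'k='k] W unfolding I by blast
    moreover have "?m \<in> polys V" using V by (intro single_in_polys) (simp add: keys_sqfree)
    moreover have "?m \<in> ?v W'" if "W' \<in> C" "?v W' \<noteq> ?v W" for W'
    proof -
      have "\<not> W' \<subseteq> W" using that W C unfolding antichain_in_def by blast
      then show ?thesis using cosqfree_in_var_ideal[OF V CV[OF W] CV[OF that(1)], where 'k='k] by blast
    qed
    ultimately show ?thesis by blast
  qed
  moreover have "\<forall>P\<in>?v ` C. \<exists>W\<subseteq>V. P = ?v W" using CV by blast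
  ultimately show "irredundant_var_decomp V I (?v ` C)"
    unfolding irredundant_var_decomp_def using I by simp
  fix \<P> :: "('v, 'k) mpoly set set" assume irr: "irredundant_var_decomp V I \<P>"
  define D where "D = {W. W \<subseteq> V \<and> ?v W \<in> \<P>}"
  have irrD: "\<forall>P\<in>\<P>. \<exists>W\<subseteq>V. P = ?v W" "I = polys V \<inter> \<Inter>\<P>"
    "\<forall>P\<in>\<P>. I \<noteq> polys V \<inter> \<Inter>(\<P> - {P})"
    using irr unfolding irredundant_var_decomp_def by - (elim conjE, assumption)+
  have P: "\<P> = ?v ` D"
  proof (intro subset_antisym subsetI)
    fix P assume P: "P \<in> \<P>"
    then obtain W where "W \<subseteq> V" "P = ?v W" using irrD(1) by metis
    then show "P \<in> ?v ` D" using P unfolding D_def by (intro image_eqI[of _ _ W]) simp_all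
  qed (auto simp: D_def)
  have eq: "polys V \<inter> \<Inter>(?v ` C) = polys V \<inter> \<Inter>(?v ` D)"
    using irrD(2) unfolding I P .
  have DV: "W \<subseteq> V" if "W \<in> D" for W using that D_def by blast
  have anti: "W = W'" if W: "W \<in> D" "W' \<in> D" "W \<subseteq> W'" for W W'
  proof (rule ccontr)
    assume "W \<noteq> W'"
    then have "\<not> ?v W' \<subseteq> ?v W" "?v W \<subseteq> ?v W'"
      using var_ideal_subset_iff[OF V DV DV, where 'k='k] W by blast+
    then have "\<Inter>(\<P> - {?v W'}) = \<Inter>\<P>" using P W by blast
    then have "I = polys V \<inter> \<Inter>(\<P> - {?v W'})" using irrD(2) by simp
    then show False using irrD(3) P W(2) by blast
  qed
  have "C = D"
  proof (intro subset_antisym subsetI)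
    fix W assume W: "W \<in> C"
    obtain W' where W': "W' \<in> D" "W' \<subseteq> W"
      using antichain_refines[OF V DV W CV[OF W] eq[symmetric]] by blast
    obtain W'' where W'': "W'' \<in> C" "W'' \<subseteq> W'"
      using antichain_refines[OF V CV W'(1) DV[OF W'(1)] eq] by blast
    have "W'' = W" using C W W'' W'(2) unfolding antichain_in_def by blast
    then show "W \<in> D" using W' W'' by simp
  next
    fix W assume W: "W \<in> D"
    obtain W' where W': "W' \<in> C" "W' \<subseteq> W"
      using antichain_refines[OF V CV W DV[OF W] eq] by blast
    obtain W'' where W'': "W'' \<in> D" "W'' \<subseteq> W'"
      using antichain_refines[OF V DV W'(1) CV[OF W'(1)] eq[symmetric]] by blast
    have "W'' = W" using anti[of W'' W] W W'' W'(2) by blast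
    then show "W \<in> C" using W' W'' by simp
  qed
  then show "\<P> = ?v ` C" using P by simp
qed

lemma mono_ideal_deg_in_Inter:
  assumes "\<And>W. W \<in> C \<Longrightarrow> finite W \<and> W \<subseteq> V"
  shows "(polys V \<inter> \<Inter>(var_ideal V ` C) :: ('v, 'k::field) mpoly set) =
    mono_ideal V {t. \<forall>W\<in>C. 1 \<le> deg_in W t}"
  using assms by (auto simp: var_ideal_deg_in mono_ideal_def)

lemma symbolic_power_deg_in:
  fixes V :: "'v set"
  assumes V: "finite V" and C: "antichain_in V C"
    and I: "I = (mono_ideal V {t. \<forall>W\<in>C. 1 \<le> deg_in W t} :: ('v, 'k::field) mpoly set)"
  shows "symbolic_power V I k = mono_ideal V {t. \<forall>W\<in>C. k \<le> deg_in W t}"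
proof -
  have CV: "finite W \<and> W \<subseteq> V" if "W \<in> C" for W
    using C that V finite_subset by (auto simp: antichain_in_def)
  have "(THE \<P>. irredundant_var_decomp V I \<P>) = var_ideal V ` C"
    by (rule the_irredundant_var_decomp[OF V C]) (simp add: I mono_ideal_deg_in_Inter CV)
  then have "symbolic_power V I k =
      polys V \<inter> (\<Inter>W\<in>C. var_ideal V W [^]\<^bsub>ideals_set (poly_ring V)\<^esub> k)"
    unfolding symbolic_power_def by simp
  also have "\<dots> = polys V \<inter> (\<Inter>W\<in>C. mono_ideal V {t. k \<le> deg_in W t})"
    using var_ideal_power[where 'k='k and V=V] CV by simp
  also have "\<dots> = mono_ideal V {t. \<forall>W\<in>C. k \<le> deg_in W t}"
    by (auto simp: mono_ideal_def)
  finally show ?thesis .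
qed

lemma depth_colon_monomial:
  fixes A :: "('v::linorder \<Rightarrow>\<^sub>0 nat) set" and V :: "'v set"
  assumes V: "finite V" and A: "up_closed A" and X: "X \<subseteq> V"
    and "(mono_ideal V {t. t + sqfree X \<in> A} :: ('v, 'k::field) mpoly set) \<subseteq> var_ideal V V"
  shows "depth_quot V (mono_ideal V A :: ('v, 'k::field) mpoly set) \<le>
    depth_quot V (mono_ideal V {t. t + sqfree X \<in> A} :: ('v, 'k) mpoly set)"
proof -
  have "finite X" using V X finite_subset by blast
  then show ?thesis using assms(3,4)
  proof (induction X rule: finite_induct)
    case empty
    then show ?case by (simp add: sqfree_def)
  next
    case (insert x X)
    let ?B = "{t. t + sqfree X \<in> A}"
    have B: "up_closed ?B" using A by (simp add: up_closed_def add.assoc)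
    have eq: "{t. t + sqfree (insert x X) \<in> A} = {t. t + Poly_Mapping.single x 1 \<in> ?B}"
      using insert.hyps by (simp add: sqfree_def add.assoc)
    \<comment> \<open>The intermediate colon lies inside the final one, so properness of the final
      colon supplies the properness needed at each step.\<close>
    have "?B \<subseteq> {t. t + sqfree (insert x X) \<in> A}"
      unfolding eq using B by (auto simp: up_closed_def add.commute)
    then have "(mono_ideal V ?B :: ('v, 'k) mpoly set) \<subseteq> mono_ideal V {t. t + sqfree (insert x X) \<in> A}"
      by (auto simp: mono_ideal_def)
    then have "depth_quot V (mono_ideal V A :: ('v, 'k) mpoly set) \<le>
        depth_quot V (mono_ideal V ?B :: ('v, 'k) mpoly set)"
      using insert.prems by (intro insert.IH) auto
    also have "\<dots> \<le> depth_quot V (mono_ideal V {t. t + Poly_Mapping.single x 1 \<in> ?B} :: ('v, 'k) mpoly set)"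
      using insert.prems by (intro depth_colon_variable V B) (simp_all only: eq insert_subset)
    finally show ?case by (simp only: eq)
  qed
qed

text \<open>The colon by the squarefree monomial on \<open>X\<close> lowers the symbolic power by one.\<close>

lemma depth_symbolic_power_Suc:
  fixes V :: "'v::linorder set"
  assumes V: "finite V" and C: "antichain_in V C" and ne: "C \<noteq> {}"
    and X: "X \<subseteq> V" "\<And>W. W \<in> C \<Longrightarrow> card (W \<inter> X) = 1"
    and I: "I = (mono_ideal V {t. \<forall>W\<in>C. 1 \<le> deg_in W t} :: ('v, 'k::field) mpoly set)"
    and k: "k \<ge> 1"
  shows "depth_quot V (symbolic_power V I (Suc k)) \<le> depth_quot V (symbolic_power V I k)"
proof -
  let ?A = "\<lambda>k. {t. \<forall>W\<in>C. k \<le> deg_in W t}"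
  have CV: "finite W \<and> W \<subseteq> V" if "W \<in> C" for W
    using C that V finite_subset by (auto simp: antichain_in_def)
  have fX: "finite X" using V X(1) finite_subset by blast
  \<comment> \<open>Since \<open>X\<close> meets each \<open>W\<close> exactly once, multiplication
    by its monomial raises every order by exactly one.\<close>
  have eq: "{t. t + sqfree X \<in> ?A (Suc k)} = ?A k"
    using X(2) CV fX by (auto simp: deg_in_add deg_in_sqfree)
  obtain W where W: "W \<in> C" using ne by blast
  \<comment> \<open>Properness of the colon: \<open>k\<close> is positive and some \<open>W\<close>
    exists, so the monomial \<open>1\<close> is excluded.\<close>
  have "?A k \<subseteq> {t. \<exists>v\<in>V. Poly_Mapping.lookup t v \<noteq> 0}"
  proof
    fix t assume "t \<in> ?A k"
    then have "1 \<le> deg_in W t" using W k by auto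
    then show "t \<in> {t. \<exists>v\<in>V. Poly_Mapping.lookup t v \<noteq> 0}" using deg_in_ge_1 CV[OF W] by blast
  qed
  then have "(mono_ideal V (?A k) :: ('v, 'k) mpoly set) \<subseteq> var_ideal V V"
    by (auto simp: var_ideal_eq mono_ideal_def)
  then have "depth_quot V (mono_ideal V (?A (Suc k)) :: ('v, 'k) mpoly set) \<le>
      depth_quot V (mono_ideal V (?A k) :: ('v, 'k) mpoly set)"
    using depth_colon_monomial[OF V up_closed_deg_in X(1), of C "Suc k", where 'k='k] unfolding eq by blast
  then show ?thesis by (simp only: symbolic_power_deg_in[OF V C I])
qed

section \<open>Heights of ideals generated by variables\<close>

definition restrict_keys :: "('v \<Rightarrow>\<^sub>0 nat) set \<Rightarrow> ('v, 'k::field) mpoly \<Rightarrow> ('v, 'k) mpoly" where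
  "restrict_keys B p = Abs_poly_mapping (\<lambda>t. if t \<in> B then Poly_Mapping.lookup p t else 0)"

lemma lookup_restrict_keys:
  "Poly_Mapping.lookup (restrict_keys B p) t = (if t \<in> B then Poly_Mapping.lookup p t else 0)"
proof -
  have "finite {t. (if t \<in> B then Poly_Mapping.lookup p t else 0) \<noteq> 0}"
    by (rule finite_subset[of _ "Poly_Mapping.keys p"]) (auto simp: in_keys_iff split: if_splits)
  then show ?thesis unfolding restrict_keys_def by simp
qed

lemma keys_restrict_keys: "Poly_Mapping.keys (restrict_keys B p) = Poly_Mapping.keys p \<inter> B"
  by (auto simp: in_keys_iff lookup_restrict_keys split: if_splits)

lemma restrict_keys_split: "p = restrict_keys B p + restrict_keys (- B) p"
  by (intro poly_mapping_eqI) (simp add: lookup_add lookup_restrict_keys)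

text \<open>Modulo the ideal, only the terms free of \<open>W\<close> matter. If both factors have a
  nonzero such part, the product of the parts is nonzero and free of \<open>W\<close>, so it cannot
  lie in the ideal.\<close>

lemma primeideal_var_ideal:
  fixes V :: "'v::linorder set"
  assumes W: "W \<subseteq> V"
  shows "primeideal (var_ideal V W :: ('v, 'k::field) mpoly set) (poly_ring V)"
proof (rule primeidealI)
  let ?P = "var_ideal V W :: ('v, 'k) mpoly set"
  let ?B = "{t. \<exists>v\<in>W. Poly_Mapping.lookup t v \<noteq> (0::nat)}"
  have P: "polys.ideal_in V ?P" by (rule ideal_in_var_ideal[OF W])
  show "ideal ?P (poly_ring V)" using P by (simp only: ideal_iff)
  show "cring (poly_ring V :: ('v, 'k) mpoly ring)" by (rule cring_poly_ring)
  show "polys V \<noteq> ?P" using one_notin_var_ideal[OF W] polys.one_in by blast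
  fix p q :: "('v, 'k) mpoly"
  assume p: "p \<in> polys V" and q: "q \<in> polys V" and "p \<otimes>\<^bsub>poly_ring V\<^esub> q \<in> ?P"
  then have pq: "p * q \<in> ?P" by simp
  show "p \<in> ?P \<or> q \<in> ?P"
  proof (rule ccontr)
    assume n: "\<not> (p \<in> ?P \<or> q \<in> ?P)"
    have part: "restrict_keys ?B r \<in> ?P" "restrict_keys (- ?B) r \<in> polys V" if "r \<in> polys V" for r :: "('v, 'k) mpoly"
      using that by (auto simp: var_ideal_eq[OF W] mono_ideal_def polys_iff keys_restrict_keys)
    have nz: "restrict_keys (- ?B) r \<noteq> 0" if "r \<in> polys V" "r \<notin> ?P" for r :: "('v, 'k) mpoly"
      using that part(1)[OF that(1)] restrict_keys_split[of r ?B] by auto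
    define p1 p2 q1 q2 where "p1 = restrict_keys (- ?B) p" and "p2 = restrict_keys ?B p"
      and "q1 = restrict_keys (- ?B) q" and "q2 = restrict_keys ?B q"
    have sp: "p = p2 + p1" "q = q2 + q1"
      unfolding p1_def p2_def q1_def q2_def by (rule restrict_keys_split)+
    have mem: "p2 \<in> ?P" "q2 \<in> ?P" "p1 \<in> polys V" "q1 \<in> polys V"
      unfolding p1_def p2_def q1_def q2_def using part p q by blast+
    have "p1 * q1 \<noteq> 0"
      using nz[OF p] nz[OF q] n unfolding p1_def q1_def by simp
    then obtain t where t: "t \<in> Poly_Mapping.keys (p1 * q1)" by (metis all_not_in_conv keys_eq_empty)
    then obtain a b where ab: "t = a + b" "a \<in> Poly_Mapping.keys p1" "b \<in> Poly_Mapping.keys q1"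
      using subsetD[OF keys_mult t] by blast
    then have "t \<notin> ?B" by (auto simp: p1_def q1_def keys_restrict_keys lookup_add)
    moreover have "p1 * q1 = p * q - (q * p2 + p1 * q2)"
      unfolding sp by (simp add: algebra_simps)
    then have "p1 * q1 \<in> ?P"
      using pq mem q polys.ideal_inD(3,4)[OF P] polys.ideal_in_diff[OF P] by metis
    then have "t \<in> ?B" using t by (auto simp: var_ideal_eq[OF W] mono_ideal_def)
    ultimately show False by blast
  qed
qed

lemma keys_single_mult:
  "Poly_Mapping.keys (Poly_Mapping.single s 1 * p) = (\<lambda>t. s + t) ` Poly_Mapping.keys (p :: ('v, 'k::field) mpoly)"
proof (intro subset_antisym subsetI)
  fix t assume "t \<in> Poly_Mapping.keys (Poly_Mapping.single s 1 * p)"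
  then obtain u where "t = s + u" "Poly_Mapping.lookup p (t - s) \<noteq> 0"
    by (auto simp: in_keys_iff lookup_single_mult split: if_splits)
  then show "t \<in> (\<lambda>t. s + t) ` Poly_Mapping.keys p" by (auto simp: in_keys_iff)
next
  fix t assume "t \<in> (\<lambda>t. s + t) ` Poly_Mapping.keys p"
  then show "t \<in> Poly_Mapping.keys (Poly_Mapping.single s 1 * p)"
    by (auto simp: in_keys_iff lookup_single_mult)
qed

text \<open>The prime is the annihilator of the class of the product of all variables outside
  \<open>W\<close>. That monomial already meets every other member of the antichain, so only
  membership in the prime of \<open>W\<close> remains to be achieved by the multiplier.\<close>

lemma var_ideal_assoc_prime:
  fixes V :: "'v::linorder set"
  assumes V: "finite V" and C: "antichain_in V C" and W: "W \<in> C"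
    and I: "I = (mono_ideal V {t. \<forall>W\<in>C. 1 \<le> deg_in W t} :: ('v, 'k::field) mpoly set)"
  shows "var_ideal V W \<in> assoc_primes (poly_ring V) (quot_module (poly_ring V) I)"
proof -
  have CV: "finite X \<and> X \<subseteq> V" if "X \<in> C" for X
    using C that V finite_subset by (auto simp: antichain_in_def)
  have idI: "polys.ideal_in V I" unfolding I by (rule ideal_in_mono_ideal[OF up_closed_deg_in])
  let ?s = "sqfree (V - W)"
  let ?m = "Poly_Mapping.single ?s 1 :: ('v, 'k) mpoly"
  have fin: "finite (V - W)" using V by simp
  have m: "?m \<in> polys V" by (intro single_in_polys) (simp add: keys_sqfree[OF fin])
  note Q = quot_module_coset[OF idI]
  have up: "(\<forall>X\<in>C. 1 \<le> deg_in X (?s + t)) \<longleftrightarrow> 1 \<le> deg_in W t" for t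
  proof
    assume "\<forall>X\<in>C. 1 \<le> deg_in X (?s + t)"
    then have "1 \<le> deg_in W (?s + t)" using W by blast
    moreover have "W \<inter> (V - W) = {}" by blast
    then have "deg_in W ?s = 0" using deg_in_sqfree[OF fin] CV[OF W] by simp
    ultimately show "1 \<le> deg_in W t" by (simp add: deg_in_add)
  next
    assume t: "1 \<le> deg_in W t"
    show "\<forall>X\<in>C. 1 \<le> deg_in X (?s + t)"
    proof
      fix X assume X: "X \<in> C"
      show "1 \<le> deg_in X (?s + t)"
      proof (cases "X = W")
        case True
        then show ?thesis using t by (simp add: deg_in_add)
      next
        case False
        then have "\<not> X \<subseteq> W" using C X W unfolding antichain_in_def by blast
        then have "X \<inter> (V - W) \<noteq> {}" using CV[OF X] by blast
        moreover have "finite (X \<inter> (V - W))" using fin by simp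
        ultimately have "1 \<le> card (X \<inter> (V - W))" by (simp add: Suc_le_eq card_gt_0_iff)
        then show ?thesis using deg_in_sqfree[OF fin] CV[OF X] by (simp add: deg_in_add)
      qed
    qed
  qed
  have "r * ?m \<in> I \<longleftrightarrow> r \<in> var_ideal V W" if r: "r \<in> polys V" for r
  proof -
    have "r * ?m \<in> I \<longleftrightarrow> (\<forall>t\<in>Poly_Mapping.keys r. \<forall>X\<in>C. 1 \<le> deg_in X (?s + t))"
      unfolding I mono_ideal_def using polys.mult_in[OF r m]
      by (simp add: mult.commute[of r] keys_single_mult image_subset_iff)
    also have "\<dots> \<longleftrightarrow> r \<in> var_ideal V W"
      unfolding up using r CV[OF W] by (auto simp: var_ideal_deg_in mono_ideal_def)
    finally show ?thesis .
  qed
  then have "r \<odot>\<^bsub>quot_module (poly_ring V) I\<^esub> a_r_coset (poly_ring V) I ?m =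
      \<zero>\<^bsub>quot_module (poly_ring V) I\<^esub> \<longleftrightarrow> r \<in> var_ideal V W" if "r \<in> polys V" for r
    using that m by (simp add: Q(2,4,5) polys.mult_in)
  moreover have "(var_ideal V W :: ('v, 'k) mpoly set) \<subseteq> polys V"
    using polys.ideal_inD(1)[OF ideal_in_var_ideal] CV[OF W] by blast
  ultimately have "var_ideal V W = {r \<in> polys V. r \<odot>\<^bsub>quot_module (poly_ring V) I\<^esub>
      a_r_coset (poly_ring V) I ?m = \<zero>\<^bsub>quot_module (poly_ring V) I\<^esub>}"
    by (intro subset_antisym subsetI) auto
  moreover have "a_r_coset (poly_ring V) I ?m \<in> carrier (quot_module (poly_ring V) I)"
    using m by (simp only: Q(1) imageI)
  ultimately show ?thesis
    unfolding assoc_primes_def using primeideal_var_ideal CV[OF W] by blast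
qed

lemma height_var_ideal_ge:
  fixes V :: "'v::linorder set"
  assumes V: "finite V" and W: "W \<subseteq> V"
  shows "enat (card W) \<le> height (poly_ring V) (var_ideal V W :: ('v, 'k::field) mpoly set)"
proof -
  obtain ws where ws: "set ws = W" "distinct ws" "length ws = card W"
    using finite_distinct_list[of W] V W finite_subset distinct_card by metis
  let ?P = "\<lambda>j. var_ideal V (set (take j ws)) :: ('v, 'k) mpoly set"
  let ?Ps = "map ?P [0..<card W]"
  have sub: "set (take j ws) \<subseteq> V" for j using set_take_subset[of j ws] ws(1) W by blast
  have strict: "?P i \<subset> ?P j" if "i < j" "j \<le> card W" for i j
  proof -
    have "card (set (take i ws)) < card (set (take j ws))"
      using that ws by (simp add: distinct_card)
    then have "\<not> set (take j ws) \<subseteq> set (take i ws)"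
      by (meson List.finite_set card_mono leD)
    moreover have "set (take i ws) \<subseteq> set (take j ws)" using that(1) by (simp add: set_take_subset_set_take)
    ultimately show ?thesis
      using var_ideal_subset_iff[OF V sub sub, where 'k='k] by blast
  qed
  have "?Ps @ [var_ideal V W] = map ?P [0..<Suc (card W)]" using ws by simp
  moreover have "sorted_wrt (\<subset>) (map ?P [0..<Suc (card W)])"
    unfolding sorted_wrt_iff_nth_less
  proof (intro allI impI)
    fix i j assume "i < j" "j < length (map ?P [0..<Suc (card W)])"
    then have ij: "i < j" "j < Suc (card W)" "i < Suc (card W)" by simp_all
    then have "map ?P [0..<Suc (card W)] ! i = ?P i" "map ?P [0..<Suc (card W)] ! j = ?P j"
      by (simp_all del: upt_Suc)
    then show "map ?P [0..<Suc (card W)] ! i \<subset> map ?P [0..<Suc (card W)] ! j"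
      using strict[of i j] ij by simp
  qed
  ultimately have "sorted_wrt (\<subset>) (?Ps @ [var_ideal V W])" by simp
  moreover have "\<forall>Q\<in>set ?Ps. primeideal Q (poly_ring V)" using primeideal_var_ideal[OF sub] by auto
  moreover have "length ?Ps = card W" by simp
  ultimately show ?thesis unfolding height_def
    by (intro Sup_upper CollectI exI[of _ ?Ps]) simp
qed

section \<open>The upper bound for heights by counting dimensions\<close>

lemma homogeneous_system:
  fixes a :: "'i \<Rightarrow> 'b \<Rightarrow> 'k::field"
  assumes "finite B" "finite I" "card B < card I"
  shows "\<exists>c. (\<exists>i\<in>I. c i \<noteq> 0) \<and> (\<forall>b\<in>B. (\<Sum>i\<in>I. c i * a i b) = 0)"
  using assms
proof (induction B arbitrary: I a rule: finite_induct)
  case empty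
  then have "I \<noteq> {}" by auto
  then show ?case by (intro exI[of _ "\<lambda>_. 1"]) auto
next
  case (insert b B)
  show ?case
  proof (cases "\<forall>i\<in>I. a i b = 0")
    case True
    obtain c where "\<exists>i\<in>I. c i \<noteq> 0" "\<forall>b\<in>B. (\<Sum>i\<in>I. c i * a i b) = 0"
      using insert.IH[of I a] insert.prems insert.hyps by auto
    then show ?thesis using True by (intro exI[of _ c]) (auto intro!: sum.neutral)
  next
    case False
    then obtain j where j: "j \<in> I" "a j b \<noteq> 0" by blast
    define I' where "I' = I - {j}"
    have I': "finite I'" "card B < card I'" "j \<notin> I'" "I = insert j I'"
      using insert.prems insert.hyps j(1) by (auto simp: I'_def)
    obtain c where c: "\<exists>i\<in>I'. c i \<noteq> 0" "\<forall>b'\<in>B. (\<Sum>i\<in>I'. c i * (a i b' - a i b / a j b * a j b')) = 0"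
      using insert.IH[of I' "\<lambda>i b'. a i b' - a i b / a j b * a j b'"] I' by blast
    \<comment> \<open>The value of the pivot unknown \<open>j\<close> that solves the equation
      \<open>b\<close>; substituting it into the other equations gives the reduced
      coefficients.\<close>
    define d where "d = - (\<Sum>i\<in>I'. c i * (a i b / a j b))"
    have sum: "(\<Sum>i\<in>I. (c(j := d)) i * a i b') = (\<Sum>i\<in>I'. c i * (a i b' - a i b / a j b * a j b'))" for b'
    proof -
      have "(\<Sum>i\<in>I. (c(j := d)) i * a i b') = d * a j b' + (\<Sum>i\<in>I'. (c(j := d)) i * a i b')"
        using I' by simp
      also have "(\<Sum>i\<in>I'. (c(j := d)) i * a i b') = (\<Sum>i\<in>I'. c i * a i b')"
        using I'(3) by (intro sum.cong) auto
      also have "d * a j b' = - (\<Sum>i\<in>I'. c i * (a i b / a j b) * a j b')"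
        by (simp add: d_def sum_distrib_right)
      finally show ?thesis
        by (simp add: right_diff_distrib sum_subtractf mult.assoc)
    qed
    have "(\<Sum>i\<in>I. (c(j := d)) i * a i b) = 0" unfolding sum using j(2) by simp
    moreover have "\<exists>i\<in>I. (c(j := d)) i \<noteq> 0" using c(1) I'(3,4) by auto
    ultimately show ?thesis using c(2) sum by (intro exI[of _ "c(j := d)"]) auto
  qed
qed

text \<open>Linear independence over \<open>K\<close> in \<open>S/P\<close>, with scalars embedded
  as constant polynomials.\<close>

definition indep_mod :: "('v, 'k::field) mpoly set \<Rightarrow> 'i set \<Rightarrow> ('i \<Rightarrow> ('v, 'k) mpoly) \<Rightarrow> bool" where
  "indep_mod P I f \<longleftrightarrow>
    (\<forall>c. (\<Sum>i\<in>I. Poly_Mapping.single 0 (c i) * f i) \<in> P \<longrightarrow> (\<forall>i\<in>I. c i = 0))"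

lemma indep_mod_card_le:
  assumes "finite I" "indep_mod P I f" "0 \<in> P" "finite B" "\<And>i. i \<in> I \<Longrightarrow> Poly_Mapping.keys (f i) \<subseteq> B"
  shows "card I \<le> card B"
proof (rule ccontr)
  assume "\<not> ?thesis"
  then obtain c where c: "\<exists>i\<in>I. c i \<noteq> 0"
    "\<forall>b\<in>B. (\<Sum>i\<in>I. c i * Poly_Mapping.lookup (f i) b) = 0"
    using homogeneous_system[OF assms(4,1), of "\<lambda>i b. Poly_Mapping.lookup (f i) b"] by auto
  have "(\<Sum>i\<in>I. Poly_Mapping.single 0 (c i) * f i) = 0"
  proof (rule poly_mapping_eqI)
    fix t
    have "Poly_Mapping.lookup (Poly_Mapping.single 0 (c i) * f i) t = c i * Poly_Mapping.lookup (f i) t" for i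
      by (simp add: lookup_single_mult)
    then have "Poly_Mapping.lookup (\<Sum>i\<in>I. Poly_Mapping.single 0 (c i) * f i) t =
        (\<Sum>i\<in>I. c i * Poly_Mapping.lookup (f i) t)"
      by (simp add: lookup_sum)
    also have "\<dots> = 0"
    proof (cases "t \<in> B")
      case False
      then have "Poly_Mapping.lookup (f i) t = 0" if "i \<in> I" for i
        using assms(5)[OF that] by (auto simp: in_keys_iff)
      then show ?thesis by simp
    qed (use c(2) in blast)
    finally show "Poly_Mapping.lookup (\<Sum>i\<in>I. Poly_Mapping.single 0 (c i) * f i) t = Poly_Mapping.lookup 0 t"
      by simp
  qed
  then show False using assms(2,3) c(1) unfolding indep_mod_def by auto
qed

text \<open>In a relation modulo \<open>P\<close> only the terms with \<open>e = 0\<close> survive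
  modulo \<open>Q\<close>, so their coefficients vanish. The rest is divisible by \<open>b\<close>,
  which cancels since \<open>P\<close> is prime and \<open>b\<close> lies outside it.\<close>

lemma indep_mod_powers:
  fixes f :: "'i \<Rightarrow> ('v, 'k::field) mpoly"
  assumes P: "primeideal P (poly_ring V)" and Q: "primeideal Q (poly_ring V)" and PQ: "P \<subseteq> Q"
    and b: "b \<in> Q - P" and f: "finite I" "\<And>i. i \<in> I \<Longrightarrow> f i \<in> polys V" "indep_mod Q I f"
  shows "indep_mod P ({..<N} \<times> I) (\<lambda>(e, i). b ^ e * f i)"
proof -
  interpret P: primeideal P "poly_ring V" by fact
  interpret Q: primeideal Q "poly_ring V" by fact
  have idP: "polys.ideal_in V P" and idQ: "polys.ideal_in V Q"
    using P.ideal_axioms Q.ideal_axioms by (simp_all add: ideal_iff)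
  have bS: "b \<in> polys V" using b polys.ideal_inD(6)[OF idQ] by blast
  have bp: "b ^ e \<in> polys V" for e by (induction e) (auto intro: polys.mult_in bS)
  have main: "\<forall>e<N. \<forall>i\<in>I. c e i = 0"
    if "(\<Sum>e<N. \<Sum>i\<in>I. Poly_Mapping.single 0 (c e i) * (b ^ e * f i)) \<in> P" for c
    using that
  proof (induction N arbitrary: c)
    case (Suc N)
    let ?s0 = "\<Sum>i\<in>I. Poly_Mapping.single 0 (c 0 i) * f i"
    let ?r = "\<Sum>e<N. \<Sum>i\<in>I. Poly_Mapping.single 0 (c (Suc e) i) * (b ^ e * f i)"
    have s0S: "?s0 \<in> polys V" 
      using f(2) by (intro polys.ideal_in_sum[OF polys.ideal_in_S] polys.mult_in const_in_polys)
    have rS: "?r \<in> polys V"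
      using f(2) bp by (intro polys.ideal_in_sum[OF polys.ideal_in_S] polys.mult_in const_in_polys)
    have "(\<Sum>e<Suc N. \<Sum>i\<in>I. Poly_Mapping.single 0 (c e i) * (b ^ e * f i)) = ?s0 + b * ?r"
      by (simp add: sum.lessThan_Suc_shift sum_distrib_left mult_ac del: sum.lessThan_Suc)
    then have inP: "?s0 + b * ?r \<in> P" using Suc.prems by simp
    moreover have "b * ?r \<in> Q" using b rS polys.ideal_inD(5)[OF idQ] by blast
    ultimately have "(?s0 + b * ?r) - b * ?r \<in> Q" using PQ polys.ideal_in_diff[OF idQ] by blast
    then have "?s0 \<in> Q" by simp
    then have c0: "\<forall>i\<in>I. c 0 i = 0" using f(3) unfolding indep_mod_def by blast
    then have "?s0 = 0" by simp
    then have "b * ?r \<in> P" using inP by simp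
    then have "?r \<in> P" using P.I_prime[OF bS rS] b by simp
    then have "\<forall>e<N. \<forall>i\<in>I. c (Suc e) i = 0" by (rule Suc.IH)
    then show ?case using c0 by (auto simp: less_Suc_eq_0_disj)
  qed simp
  show ?thesis unfolding indep_mod_def
  proof (intro allI impI)
    fix c assume "(\<Sum>i\<in>{..<N} \<times> I. Poly_Mapping.single 0 (c i) * (case i of (e, i) \<Rightarrow> b ^ e * f i)) \<in> P"
    moreover have "(\<Sum>i\<in>{..<N} \<times> I. Poly_Mapping.single 0 (c i) * (case i of (e, i) \<Rightarrow> b ^ e * f i)) =
        (\<Sum>e<N. \<Sum>i\<in>I. Poly_Mapping.single 0 (c (e, i)) * (b ^ e * f i))"
      unfolding sum.cartesian_product by (intro sum.cong) auto
    ultimately show "\<forall>i\<in>{..<N} \<times> I. c i = 0" using main[of "\<lambda>e i. c (e, i)"] by auto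
  qed
qed

lemma indep_mod_reindex:
  assumes "bij_betw h J I" "indep_mod P I f"
  shows "indep_mod P J (f \<circ> h)"
  unfolding indep_mod_def
proof (intro allI impI ballI)
  fix c j assume c: "(\<Sum>i\<in>J. Poly_Mapping.single 0 (c i) * (f \<circ> h) i) \<in> P" and j: "j \<in> J"
  define c' where "c' i = c (the_inv_into J h i)" for i
  have inv: "the_inv_into J h (h i) = i" if "i \<in> J" for i
    using assms(1) that by (intro the_inv_into_f_f) (auto simp: bij_betw_def)
  have "(\<Sum>i\<in>I. Poly_Mapping.single 0 (c' i) * f i) = (\<Sum>i\<in>J. Poly_Mapping.single 0 (c' (h i)) * f (h i))"
    using sum.reindex_bij_betw[OF assms(1), of "\<lambda>i. Poly_Mapping.single 0 (c' i) * f i"] by simp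
  also have "\<dots> = (\<Sum>i\<in>J. Poly_Mapping.single 0 (c i) * (f \<circ> h) i)"
    by (intro sum.cong) (auto simp: c'_def inv)
  finally have "\<forall>i\<in>I. c' i = 0" using c assms(2) unfolding indep_mod_def by auto
  moreover have "h j \<in> I" using assms(1) j by (auto simp: bij_betw_def)
  ultimately show "c j = 0" using inv[OF j] by (auto simp: c'_def)
qed

text \<open>Each exponent is bounded separately, not the total degree, so that the available
  monomials form a box with an exact power as cardinality.\<close>

definition expo_le :: "nat \<Rightarrow> ('v, 'k::field) mpoly \<Rightarrow> bool" where
  "expo_le d p \<longleftrightarrow> (\<forall>t\<in>Poly_Mapping.keys p. \<forall>v. Poly_Mapping.lookup t v \<le> d)"

lemma expo_le_mono: "expo_le d p \<Longrightarrow> d \<le> d' \<Longrightarrow> expo_le d' p"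
  unfolding expo_le_def by (meson le_trans)

lemma expo_le_mult: "expo_le d p \<Longrightarrow> expo_le d' q \<Longrightarrow> expo_le (d + d') (p * q)"
  unfolding expo_le_def
proof (intro ballI allI)
  fix t v assume *: "\<forall>t\<in>Poly_Mapping.keys p. \<forall>v. Poly_Mapping.lookup t v \<le> d"
    "\<forall>t\<in>Poly_Mapping.keys q. \<forall>v. Poly_Mapping.lookup t v \<le> d'" "t \<in> Poly_Mapping.keys (p * q)"
  obtain a b where "t = a + b" "a \<in> Poly_Mapping.keys p" "b \<in> Poly_Mapping.keys q"
    using subsetD[OF keys_mult *(3)] by blast
  then show "Poly_Mapping.lookup t v \<le> d + d'" using * by (auto simp: lookup_add add_mono)
qed

lemma expo_le_power: "expo_le d p \<Longrightarrow> expo_le (e * d) (p ^ e)"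
proof (induction e)
  case (Suc e)
  then show ?case using expo_le_mult[of d p "e * d" "p ^ e"] by simp
qed (simp add: expo_le_def)

lemma expo_le_exists: "\<exists>d. expo_le d p"
proof -
  define d where "d = Max (insert 0 (\<Union>t\<in>Poly_Mapping.keys p. Poly_Mapping.lookup t ` Poly_Mapping.keys t))"
  have "Poly_Mapping.lookup t v \<le> d" if t: "t \<in> Poly_Mapping.keys p" for t v
  proof (cases "v \<in> Poly_Mapping.keys t")
    case True
    then show ?thesis unfolding d_def using t by (intro Max_ge) auto
  qed (simp add: in_keys_iff)
  then show ?thesis unfolding expo_le_def by blast
qed

definition box :: "'v set \<Rightarrow> nat \<Rightarrow> ('v \<Rightarrow>\<^sub>0 nat) set" where
  "box X N = {t. Poly_Mapping.keys t \<subseteq> X \<and> (\<forall>v\<in>X. Poly_Mapping.lookup t v < N)}"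

lemma card_box:
  assumes "finite X"
  shows "finite (box X N) \<and> card (box X N) = N ^ card X"
proof -
  let ?g = "\<lambda>h. Abs_poly_mapping (\<lambda>v. if v \<in> X then h v else (0::nat))"
  have lk: "Poly_Mapping.lookup (?g h) v = (if v \<in> X then h v else 0)" for h v
  proof -
    have "finite {v. (if v \<in> X then h v else 0) \<noteq> (0::nat)}"
      by (rule finite_subset[OF _ assms]) (auto split: if_splits)
    then show ?thesis by simp
  qed
  have "bij_betw ?g (X \<rightarrow>\<^sub>E {..<N}) (box X N)"
  proof (rule bij_betw_byWitness[where f' = "\<lambda>t. restrict (Poly_Mapping.lookup t) X"])
    show "\<forall>h\<in>X \<rightarrow>\<^sub>E {..<N}. restrict (Poly_Mapping.lookup (?g h)) X = h"
      by (auto simp: lk fun_eq_iff restrict_def PiE_def extensional_def)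
    show "\<forall>t\<in>box X N. ?g (restrict (Poly_Mapping.lookup t) X) = t"
      by (auto simp: box_def lk intro!: poly_mapping_eqI) (auto simp: in_keys_iff)
    show "?g ` (X \<rightarrow>\<^sub>E {..<N}) \<subseteq> box X N"
      by (auto simp: box_def lk in_keys_iff split: if_splits)
    show "(\<lambda>t. restrict (Poly_Mapping.lookup t) X) ` box X N \<subseteq> X \<rightarrow>\<^sub>E {..<N}"
      by (auto simp: box_def)
  qed
  then show ?thesis
    using bij_betw_same_card bij_betw_finite finite_PiE[OF assms, of "\<lambda>_. {..<N}"] card_PiE[OF assms, of "\<lambda>_. {..<N}"]
    by fastforce
qed

text \<open>Descending a chain of primes, each step multiplies the size of an independent family by
  \<open>N\<close> while the exponents stay linear in \<open>N\<close>.\<close>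

lemma indep_family_of_chain:
  fixes V :: "'v::linorder set"
  assumes V: "finite V" and W: "W \<subseteq> V"
    and "\<forall>Q\<in>set Ps. primeideal Q (poly_ring V)"
    and "sorted_wrt (\<subset>) (Ps @ [var_ideal V W :: ('v, 'k::field) mpoly set])"
  shows "\<exists>d. \<forall>N. \<exists>f. indep_mod (hd (Ps @ [var_ideal V W :: ('v, 'k) mpoly set]))
      {..<N ^ (card V - card W + length Ps)} f \<and>
      (\<forall>i < N ^ (card V - card W + length Ps). f i \<in> polys V \<and> expo_le (N * d) (f i))"
  using assms(3,4)
proof (induction Ps)
  case Nil
  let ?P = "var_ideal V W :: ('v, 'k) mpoly set"
  show ?case
  proof (rule exI[of _ 1], rule allI)
    fix N
    \<comment> \<open>The base family consists of the monomials in the variables outside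
      \<open>W\<close> with exponents below \<open>N\<close>; no nonzero combination of them lies in
      the prime of \<open>W\<close>.\<close>
    let ?B = "box (V - W) N"
    have finB: "finite ?B" and cardB: "card ?B = N ^ (card V - card W)"
      using card_box[of "V - W" N] V W by (auto simp: card_Diff_subset finite_subset)
    obtain h where h: "bij_betw h {..<N ^ (card V - card W)} ?B"
      using ex_bij_betw_nat_finite[OF finB] cardB by (auto simp: atLeast0LessThan)
    let ?f = "\<lambda>t. Poly_Mapping.single t 1 :: ('v, 'k) mpoly"
    have "indep_mod ?P ?B ?f"
      unfolding indep_mod_def
    proof (intro allI impI ballI, rule ccontr)
      fix c t assume c: "(\<Sum>t\<in>?B. Poly_Mapping.single 0 (c t) * ?f t) \<in> ?P" and t: "t \<in> ?B" "c t \<noteq> 0"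
      have "Poly_Mapping.lookup (\<Sum>t\<in>?B. Poly_Mapping.single 0 (c t) * ?f t) t = c t"
        using t(1) finB by (simp add: lookup_sum mult_single lookup_single when_def sum.delta)
      then have "t \<in> Poly_Mapping.keys (\<Sum>t\<in>?B. Poly_Mapping.single 0 (c t) * ?f t)"
        using t(2) by (simp add: in_keys_iff)
      then obtain v where "v \<in> W" "Poly_Mapping.lookup t v \<noteq> 0"
        using c unfolding var_ideal_eq[OF W] mono_ideal_def by blast
      then have "v \<in> W \<inter> Poly_Mapping.keys t" by (simp add: in_keys_iff)
      then show False using t(1) unfolding box_def by blast
    qed
    then have "indep_mod ?P {..<N ^ (card V - card W)} (?f \<circ> h)" by (rule indep_mod_reindex[OF h])
    moreover have "(?f \<circ> h) i \<in> polys V \<and> expo_le (N * 1) ((?f \<circ> h) i)"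
      if "i < N ^ (card V - card W)" for i
    proof -
      have hi: "h i \<in> ?B" using h that by (auto simp: bij_betw_def)
      then have "Poly_Mapping.lookup (h i) v \<le> N" for v
      proof (cases "v \<in> Poly_Mapping.keys (h i)")
        case True
        then have "v \<in> V - W" using hi unfolding box_def by blast
        then show ?thesis using hi by (simp add: box_def less_imp_le)
      qed (simp add: in_keys_iff)
      moreover have "Poly_Mapping.keys (h i) \<subseteq> V" using hi by (auto simp: box_def)
      ultimately show ?thesis by (auto simp: expo_le_def intro: single_in_polys)
    qed
    ultimately show "\<exists>f. indep_mod (hd ([] @ [?P])) {..<N ^ (card V - card W + length ([] :: ('v, 'k) mpoly set list))} f \<and>
      (\<forall>i < N ^ (card V - card W + length ([] :: ('v, 'k) mpoly set list)). f i \<in> polys V \<and> expo_le (N * 1) (f i))"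
      by (intro exI[of _ "?f \<circ> h"]) simp
  qed
next
  case (Cons P Ps)
  let ?L = "Ps @ [var_ideal V W :: ('v, 'k) mpoly set]"
  let ?k = "card V - card W + length Ps"
  define Q where "Q = hd ?L"
  have QL: "Q \<in> set ?L" unfolding Q_def by (intro hd_in_set) simp
  have P: "primeideal P (poly_ring V)" using Cons.prems(1) by simp
  have Q: "primeideal Q (poly_ring V)"
    using QL Cons.prems(1) primeideal_var_ideal[OF W] by auto
  have "\<forall>X\<in>set ?L. P \<subset> X" using Cons.prems(2) by auto
  then have "P \<subset> Q" using QL by blast
  then obtain b where b: "b \<in> Q - P" by blast
  obtain db where db: "expo_le db b" using expo_le_exists by blast
  obtain d where d: "\<And>N. \<exists>f. indep_mod Q {..<N ^ ?k} f \<and>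
      (\<forall>i < N ^ ?k. f i \<in> polys V \<and> expo_le (N * d) (f i))"
    using Cons.IH Cons.prems unfolding Q_def by auto
  have bS: "b ^ e \<in> polys V" for e
  proof -
    have "polys.ideal_in V Q" using Q primeideal.axioms(1) ideal_iff by blast
    then have "b \<in> polys V" using b polys.ideal_inD(6) by blast
    then show ?thesis by (induction e) (auto intro: polys.mult_in)
  qed
  show ?case
  proof (intro exI[of _ "db + d"] allI)
    fix N
    obtain f where f: "indep_mod Q {..<N ^ ?k} f"
      "\<And>i. i < N ^ ?k \<Longrightarrow> f i \<in> polys V \<and> expo_le (N * d) (f i)" using d[of N] by blast
    let ?I = "{..<N} \<times> {..<N ^ ?k}"
    let ?g = "\<lambda>(e, i). b ^ e * f i"
    have g: "indep_mod P ?I ?g"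
      using indep_mod_powers[OF P Q _ b _ _ f(1)] f(2) \<open>P \<subset> Q\<close> by auto
    have "card ?I = N ^ (card V - card W + length (P # Ps))" by simp
    then obtain h where h: "bij_betw h {..<N ^ (card V - card W + length (P # Ps))} ?I"
      using ex_bij_betw_nat_finite[of ?I] by (auto simp: atLeast0LessThan)
    have "indep_mod P {..<N ^ (card V - card W + length (P # Ps))} (?g \<circ> h)"
      by (rule indep_mod_reindex[OF h g])
    moreover have "(?g \<circ> h) i \<in> polys V \<and> expo_le (N * (db + d)) ((?g \<circ> h) i)"
      if "i < N ^ (card V - card W + length (P # Ps))" for i
    proof -
      have "h i \<in> ?I" using h that by (auto simp: bij_betw_def)
      then obtain e j where ej: "h i = (e, j)" "e < N" "j < N ^ ?k" by auto
      have "expo_le (e * db + N * d) (b ^ e * f j)"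
        using f(2)[OF ej(3)] by (intro expo_le_mult expo_le_power db) auto
      moreover have "e * db + N * d \<le> N * (db + d)" using ej(2) by (simp add: distrib_left)
      ultimately have "expo_le (N * (db + d)) (b ^ e * f j)" by (rule expo_le_mono)
      then show ?thesis using f(2)[OF ej(3)] bS by (auto simp: ej(1) intro: polys.mult_in)
    qed
    ultimately show "\<exists>f. indep_mod (hd ((P # Ps) @ [var_ideal V W :: ('v, 'k) mpoly set]))
        {..<N ^ (card V - card W + length (P # Ps))} f \<and>
      (\<forall>i < N ^ (card V - card W + length (P # Ps)). f i \<in> polys V \<and> expo_le (N * (db + d)) (f i))"
      by (intro exI[of _ "?g \<circ> h"]) auto
  qed
qed

text \<open>A chain of length \<open>r\<close> below the prime yields
  \<open>N ^ (n - card W + r)\<close> independent polynomials with exponents at most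
  \<open>N * d\<close>, but only \<open>(N * d + 1) ^ n\<close> monomials are available. Growth in
  \<open>N\<close> forces \<open>r\<close> to be at most \<open>card W\<close>.\<close>

lemma height_var_ideal_le:
  fixes V :: "'v::linorder set"
  assumes V: "finite V" and W: "W \<subseteq> V"
  shows "height (poly_ring V) (var_ideal V W :: ('v, 'k::field) mpoly set) \<le> enat (card W)"
  unfolding height_def
proof (rule Sup_least)
  let ?P = "var_ideal V W :: ('v, 'k) mpoly set"
  fix x assume "x \<in> {enat (length Ps) |Ps. (\<forall>Q\<in>set Ps. primeideal Q (poly_ring V)) \<and> sorted_wrt (\<subset>) (Ps @ [?P])}"
  then obtain Ps where Ps: "x = enat (length Ps)" "\<forall>Q\<in>set Ps. primeideal Q (poly_ring V)"
    "sorted_wrt (\<subset>) (Ps @ [?P])" by blast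
  let ?n = "card V" and ?Q = "hd (Ps @ [?P])"
  have "?Q \<in> set (Ps @ [?P])" by (intro hd_in_set) simp
  then have "primeideal ?Q (poly_ring V)" using Ps(2) primeideal_var_ideal[OF W] by auto
  then have "polys.ideal_in V ?Q" using primeideal.axioms(1) ideal_iff by blast
  then have zero: "0 \<in> ?Q" by (rule polys.ideal_inD(2))
  obtain d where d: "\<And>N. \<exists>f. indep_mod ?Q {..<N ^ (?n - card W + length Ps)} f \<and>
      (\<forall>i < N ^ (?n - card W + length Ps). f i \<in> polys V \<and> expo_le (N * d) (f i))"
    using indep_family_of_chain[OF V W Ps(2,3)] by blast
  have bound: "N ^ (?n - card W + length Ps) \<le> (N * d + 1) ^ ?n" for N
  proof -
    obtain f where f: "indep_mod ?Q {..<N ^ (?n - card W + length Ps)} f"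
      "\<And>i. i < N ^ (?n - card W + length Ps) \<Longrightarrow> f i \<in> polys V \<and> expo_le (N * d) (f i)"
      using d[of N] by blast
    have "Poly_Mapping.keys (f i) \<subseteq> box V (N * d + 1)" if "i < N ^ (?n - card W + length Ps)" for i
      using f(2)[OF that] by (auto simp: box_def polys_iff expo_le_def less_Suc_eq_le)
    then have "card {..<N ^ (?n - card W + length Ps)} \<le> card (box V (N * d + 1))"
      using card_box[OF V] by (intro indep_mod_card_le[OF _ f(1) zero]) auto
    then show ?thesis using card_box[OF V, of "N * d + 1"] by simp
  qed
  have "length Ps \<le> card W"
  proof (rule ccontr)
    assume "\<not> ?thesis"
    then have le: "Suc ?n \<le> ?n - card W + length Ps" by simp
    \<comment> \<open>The count would give \<open>N ^ (n + 1)\<close> at most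
      \<open>N ^ n * (d + 1) ^ n\<close>; this \<open>N\<close> is just large enough to refute
      it.\<close>
    define N where "N = Suc ((d + 1) ^ ?n)"
    have "N ^ Suc ?n \<le> N ^ (?n - card W + length Ps)"
      using le by (intro power_increasing) (auto simp: N_def)
    also have "\<dots> \<le> (N * d + 1) ^ ?n" by (rule bound)
    also have "\<dots> \<le> (N * (d + 1)) ^ ?n" by (intro power_mono) (auto simp: N_def)
    also have "\<dots> = N ^ ?n * (d + 1) ^ ?n" by (rule power_mult_distrib)
    finally have "N ^ ?n * N \<le> N ^ ?n * (d + 1) ^ ?n" by (simp add: mult.commute)
    then have "N \<le> (d + 1) ^ ?n" by (simp add: N_def)
    then show False by (simp add: N_def)
  qed
  then show "x \<le> enat (card W)" using Ps(1) by simp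
qed

lemma height_var_ideal:
  fixes V :: "'v::linorder set"
  assumes "finite V" "W \<subseteq> V"
  shows "height (poly_ring V) (var_ideal V W :: ('v, 'k::field) mpoly set) = enat (card W)"
  using height_var_ideal_le[OF assms] height_var_ideal_ge[OF assms] by (rule antisym)

section \<open>Ideals of weak homomorphisms\<close>

text \<open>Vertex covers of the hypergraph whose edges are the graphs of weak homomorphisms; its
  inclusion-minimal covers generate the primes of the decomposition.\<close>

definition hom_cover :: "'a pair_pre_digraph \<Rightarrow> 'b pair_pre_digraph \<Rightarrow> ('a \<times> 'b) set \<Rightarrow> bool" where
  "hom_cover G H W \<longleftrightarrow> W \<subseteq> hom_vars G H \<and> (\<forall>\<phi>\<in>WHom G H. \<exists>i\<in>pverts G. (i, \<phi> i) \<in> W)"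

definition min_covers :: "'a pair_pre_digraph \<Rightarrow> 'b pair_pre_digraph \<Rightarrow> ('a \<times> 'b) set set" where
  "min_covers G H = {W. hom_cover G H W \<and> (\<forall>W'. hom_cover G H W' \<longrightarrow> W' \<subseteq> W \<longrightarrow> W' = W)}"

lemma hom_cover_contains_min:
  assumes "finite (hom_vars G H)" "hom_cover G H W"
  shows "\<exists>W'\<in>min_covers G H. W' \<subseteq> W"
proof -
  have "{W. hom_cover G H W} \<subseteq> Pow (hom_vars G H)" by (auto simp: hom_cover_def)
  then have "finite {W. hom_cover G H W}" using assms(1) finite_subset by blast
  then obtain M where "M \<in> {W. hom_cover G H W}" "M \<subseteq> W"
    "\<forall>b\<in>{W. hom_cover G H W}. b \<subseteq> M \<longrightarrow> M = b"
    using finite_has_minimal2[of "{W. hom_cover G H W}" W] assms(2) by auto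
  then show ?thesis unfolding min_covers_def by blast
qed

lemma antichain_min_covers: "antichain_in (hom_vars G H) (min_covers G H)"
  unfolding antichain_in_def min_covers_def hom_cover_def by blast

lemma mono_ideal_cong:
  assumes "\<And>t. Poly_Mapping.keys t \<subseteq> V \<Longrightarrow> t \<in> A \<longleftrightarrow> t \<in> B"
  shows "mono_ideal V A = mono_ideal V B"
  using assms by (auto simp: mono_ideal_def polys_iff subset_iff)

lemma hom_monom_eq:
  assumes "finite (pverts G)"
  shows "(hom_monom G \<phi> :: ('a \<times> 'b, 'k::field) mpoly) =
    Poly_Mapping.single (sqfree ((\<lambda>i. (i, \<phi> i)) ` pverts G)) 1"
proof -
  have "(\<Prod>i\<in>A. pvar (i, \<phi> i) :: ('a \<times> 'b, 'k) mpoly) =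
      Poly_Mapping.single (\<Sum>i\<in>A. Poly_Mapping.single (i, \<phi> i) 1) 1" if "finite A" for A
    using that by (induction A rule: finite_induct) (simp_all add: pvar_def mult_single)
  then have "(hom_monom G \<phi> :: ('a \<times> 'b, 'k) mpoly) =
      Poly_Mapping.single (\<Sum>i\<in>pverts G. Poly_Mapping.single (i, \<phi> i) 1) 1"
    unfolding hom_monom_def using assms by blast
  moreover have "sqfree ((\<lambda>i. (i, \<phi> i)) ` pverts G) =
      (\<Sum>i\<in>pverts G. Poly_Mapping.single (i, \<phi> i) (1::nat))"
    unfolding sqfree_def by (subst sum.reindex) (auto simp: inj_on_def)
  ultimately show ?thesis by simp
qed

lemma WHom_in_vars: "\<phi> \<in> WHom G H \<Longrightarrow> i \<in> pverts G \<Longrightarrow> (i, \<phi> i) \<in> hom_vars G H"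
  by (auto simp: WHom_def hom_vars_def)

text \<open>Duality of edges and covers: a monomial lies in the ideal if and only if its support
  contains an edge, that is, if and only if its support meets every minimal cover.\<close>

lemma hom_ideal_eq:
  assumes fin: "finite (pverts G)" "finite (pverts H)"
  shows "(hom_ideal G H :: ('a \<times> 'b, 'k::field) mpoly set) =
    mono_ideal (hom_vars G H) {t. \<forall>W\<in>min_covers G H. 1 \<le> deg_in W t}"
proof -
  let ?V = "hom_vars G H"
  let ?gr = "\<lambda>\<phi>. (\<lambda>i. (i, \<phi> i)) ` pverts G"
  let ?T = "(\<lambda>\<phi>. sqfree (?gr \<phi>)) ` WHom G H"
  have finV: "finite ?V" using fin by (simp add: hom_vars_def)
  have fing: "finite (?gr \<phi>)" for \<phi> :: "'a \<Rightarrow> 'b" using fin by simp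
  have keysT: "Poly_Mapping.keys t \<subseteq> ?V" if "t \<in> ?T" for t
    using that WHom_in_vars[of _ G H] by (auto simp: keys_sqfree[OF fing])
  have "(hom_ideal G H :: ('a \<times> 'b, 'k) mpoly set) =
      Idl\<^bsub>poly_ring ?V\<^esub> ((\<lambda>t. Poly_Mapping.single t 1) ` ?T)"
    unfolding hom_ideal_def image_image hom_monom_eq[OF fin(1)] ..
  also have "\<dots> = mono_ideal ?V {t. \<exists>s\<in>?T. \<exists>r. t = r + s}"
    by (rule genideal_monomials[OF keysT])
  also have "\<dots> = mono_ideal ?V {t. \<forall>W\<in>min_covers G H. 1 \<le> deg_in W t}"
  proof (rule mono_ideal_cong)
    fix t :: "'a \<times> 'b \<Rightarrow>\<^sub>0 nat" assume tV: "Poly_Mapping.keys t \<subseteq> ?V"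
    have finW: "finite W" if "W \<in> min_covers G H" for W
      using that finV finite_subset by (auto simp: min_covers_def hom_cover_def)
    show "t \<in> {t. \<exists>s\<in>?T. \<exists>r. t = r + s} \<longleftrightarrow> t \<in> {t. \<forall>W\<in>min_covers G H. 1 \<le> deg_in W t}"
    proof
      assume "t \<in> {t. \<exists>s\<in>?T. \<exists>r. t = r + s}"
      then obtain \<phi> r where \<phi>: "\<phi> \<in> WHom G H" "t = r + sqfree (?gr \<phi>)" by blast
      have "1 \<le> deg_in W t" if W: "W \<in> min_covers G H" for W
      proof -
        obtain i where i: "i \<in> pverts G" "(i, \<phi> i) \<in> W"
          using W \<phi>(1) by (auto simp: min_covers_def hom_cover_def)
        then have "Poly_Mapping.lookup t (i, \<phi> i) \<noteq> 0"
          by (auto simp: \<phi>(2) lookup_add lookup_sqfree[OF fing])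
        then show ?thesis using deg_in_ge_1[OF finW[OF W]] i(2) by blast
      qed
      then show "t \<in> {t. \<forall>W\<in>min_covers G H. 1 \<le> deg_in W t}" by blast
    next
      assume t: "t \<in> {t. \<forall>W\<in>min_covers G H. 1 \<le> deg_in W t}"
      have "\<exists>\<phi>\<in>WHom G H. ?gr \<phi> \<subseteq> Poly_Mapping.keys t"
      proof (rule ccontr)
        assume no: "\<not> ?thesis"
        \<comment> \<open>If the support of \<open>t\<close> contains no edge, its complement is a
          cover, and a minimal cover inside it has order zero on \<open>t\<close>.\<close>
        have "hom_cover G H (?V - Poly_Mapping.keys t)"
          unfolding hom_cover_def
        proof (intro conjI ballI)
          fix \<phi> assume \<phi>: "\<phi> \<in> WHom G H"
          then obtain i where "i \<in> pverts G" "(i, \<phi> i) \<notin> Poly_Mapping.keys t" using no by blast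
          then show "\<exists>i\<in>pverts G. (i, \<phi> i) \<in> ?V - Poly_Mapping.keys t"
            using WHom_in_vars[OF \<phi>] by blast
        qed blast
        then obtain W where W: "W \<in> min_covers G H" "W \<subseteq> ?V - Poly_Mapping.keys t"
          using hom_cover_contains_min[OF finV] by blast
        then have "1 \<le> deg_in W t" using t by blast
        then obtain v where "v \<in> W" "Poly_Mapping.lookup t v \<noteq> 0"
          using deg_in_ge_1[OF finW[OF W(1)]] by blast
        moreover have "v \<in> Poly_Mapping.keys t" using calculation by (simp add: in_keys_iff)
        ultimately show False using W(2) by blast
      qed
      then obtain \<phi> where \<phi>: "\<phi> \<in> WHom G H" "?gr \<phi> \<subseteq> Poly_Mapping.keys t" by blast
      have "1 \<le> Poly_Mapping.lookup t v" if "v \<in> ?gr \<phi>" for v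
      proof -
        have "v \<in> Poly_Mapping.keys t" using that \<phi>(2) by (rule subsetD[rotated])
        then show ?thesis by (simp add: in_keys_iff)
      qed
      then have "t = (t - sqfree (?gr \<phi>)) + sqfree (?gr \<phi>)"
        by (intro poly_mapping_eqI) (simp add: lookup_add lookup_minus lookup_sqfree[OF fing])
      then show "t \<in> {t. \<exists>s\<in>?T. \<exists>r. t = r + s}" using \<phi>(1) by blast
    qed
  qed
  finally show ?thesis .
qed

text \<open>A single column met once by every minimal cover suffices. The comparison with
  \<open>I\<close> itself is the case \<open>k = 1\<close>, as the first symbolic power is
  \<open>I\<close>.\<close>

lemma depth_symbolic_power_hom_ideal:
  fixes G :: "'a::linorder pair_pre_digraph" and H :: "'b::linorder pair_pre_digraph"
  assumes fin: "finite (pverts G)" "finite (pverts H)" and ne: "pverts G \<noteq> {}"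
    and j: "j \<in> pverts H"
    and X: "\<And>W. W \<in> min_covers G H \<Longrightarrow> card (W \<inter> pverts G \<times> {j}) = 1"
  defines "V \<equiv> hom_vars G H" and "I \<equiv> hom_ideal G H :: ('a \<times> 'b, 'k::field) mpoly set"
  shows "depth_quot V (symbolic_power V I 2) \<le> depth_quot V I"
    "k \<ge> 1 \<Longrightarrow> depth_quot V (symbolic_power V I (k + 1)) \<le> depth_quot V (symbolic_power V I k)"
proof -
  have finV: "finite V" unfolding V_def using fin by (simp add: hom_vars_def)
  have I: "I = mono_ideal V {t. \<forall>W\<in>min_covers G H. 1 \<le> deg_in W t}"
    unfolding V_def I_def by (rule hom_ideal_eq[OF fin])
  have anti: "antichain_in V (min_covers G H)" unfolding V_def by (rule antichain_min_covers)
  have "hom_cover G H V"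
    unfolding hom_cover_def V_def using WHom_in_vars[of _ G H] ne by blast
  then have neC: "min_covers G H \<noteq> {}"
    using hom_cover_contains_min[of G H V] finV unfolding V_def by blast
  have XV: "pverts G \<times> {j} \<subseteq> V" using j by (auto simp: V_def hom_vars_def)
  show step: "depth_quot V (symbolic_power V I (k + 1)) \<le> depth_quot V (symbolic_power V I k)"
    if "k \<ge> 1" for k
    using depth_symbolic_power_Suc[OF finV anti neC XV X I that] by simp
  have "symbolic_power V I 1 = I"
    using symbolic_power_deg_in[OF finV anti I, of 1] I by simp
  then show "depth_quot V (symbolic_power V I 2) \<le> depth_quot V I"
    using step[of 1] by (simp add: numeral_2_eq_2)
qed

section \<open>Minimal covers meet a column exactly once\<close>

lemma const_WHom:
  assumes "pair_digraph G" "j \<in> pverts H"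
  shows "(\<lambda>i\<in>pverts G. j) \<in> WHom G H"
proof -
  interpret pair_digraph G by fact
  have "x \<in> pverts G" "y \<in> pverts G" if "(x, y) \<in> parcs G" for x y
    using that arc_fst_in_verts[of "(x, y)"] arc_snd_in_verts[of "(x, y)"] by auto
  then show ?thesis using assms(2) by (auto simp: WHom_def)
qed

text \<open>Equal heights give all minimal covers the size of one contained in a row, hence at most
  one element per column on average, while each column is met at least once.\<close>

lemma unmixed_column_card:
  fixes G :: "'a::linorder pair_pre_digraph" and H :: "'b::linorder pair_pre_digraph"
  assumes G: "pair_digraph G" "pverts G \<noteq> {}" and fin: "finite (pverts G)" "finite (pverts H)"
    and unm: "unmixed (poly_ring (hom_vars G H)) (hom_ideal G H :: ('a \<times> 'b, 'k::field) mpoly set)"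
    and W: "W \<in> min_covers G H" and j: "j \<in> pverts H"
  shows "card (W \<inter> pverts G \<times> {j}) = 1"
proof -
  let ?V = "hom_vars G H" and ?I = "hom_ideal G H :: ('a \<times> 'b, 'k) mpoly set"
  have finV: "finite ?V" using fin by (simp add: hom_vars_def)
  have WV: "W \<subseteq> ?V" if "W \<in> min_covers G H" for W
    using that by (auto simp: min_covers_def hom_cover_def)
  obtain i0 where i0: "i0 \<in> pverts G" using G(2) by blast
  \<comment> \<open>A row is a cover because every map takes some value at
    \<open>i0\<close>.\<close>
  have "hom_cover G H ({i0} \<times> pverts H)"
    using i0 by (auto simp: hom_cover_def hom_vars_def WHom_def)
  then obtain R where R: "R \<in> min_covers G H" "R \<subseteq> {i0} \<times> pverts H"
    using hom_cover_contains_min[OF finV] by blast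
  have "card R \<le> card ({i0} \<times> pverts H)" using R(2) fin by (intro card_mono) auto
  then have cardR: "card R \<le> card (pverts H)" by (simp add: card_cartesian_product)
  have "height (poly_ring ?V) (var_ideal ?V W :: ('a \<times> 'b, 'k) mpoly set) = height (poly_ring ?V) (var_ideal ?V R :: ('a \<times> 'b, 'k) mpoly set)"
    using unm var_ideal_assoc_prime[OF finV antichain_min_covers _ hom_ideal_eq[OF fin], where 'k='k] W R(1)
    unfolding unmixed_def by blast
  then have "card W = card R"
    using height_var_ideal[OF finV WV[OF W], where 'k='k] height_var_ideal[OF finV WV[OF R(1)], where 'k='k]
    by simp
  then have cardW: "card W \<le> card (pverts H)" using cardR by simp
  let ?c = "\<lambda>j. card (W \<inter> pverts G \<times> {j})"
  have finW: "finite W" using WV[OF W] finV finite_subset by blast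
  have ge: "1 \<le> ?c j" if "j \<in> pverts H" for j
  proof -
    have "\<exists>i\<in>pverts G. (i, (\<lambda>i\<in>pverts G. j) i) \<in> W"
      using W const_WHom[OF G(1) that] unfolding min_covers_def hom_cover_def by blast
    then have "W \<inter> pverts G \<times> {j} \<noteq> {}" by auto
    then show ?thesis using finW by (simp add: Suc_le_eq card_gt_0_iff)
  qed
  have "W = (\<Union>j\<in>pverts H. W \<inter> pverts G \<times> {j})"
    using WV[OF W] by (auto simp: hom_vars_def)
  then have "card W = card (\<Union>j\<in>pverts H. W \<inter> pverts G \<times> {j})" by simp
  also have "\<dots> = (\<Sum>j\<in>pverts H. ?c j)"
    using fin finW by (intro card_UN_disjoint) auto
  finally have sum: "(\<Sum>j\<in>pverts H. ?c j) \<le> card (pverts H)" using cardW by simp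
  show ?thesis
  proof (rule ccontr)
    assume "?c j \<noteq> 1"
    then have "1 < ?c j" using ge[OF j] by simp
    then have "(\<Sum>j\<in>pverts H. 1) < (\<Sum>j\<in>pverts H. ?c j)"
      using fin(2) j ge by (intro sum_strict_mono_ex1) auto
    then show False using sum by simp
  qed
qed

text \<open>The vertices reached by a path through vertices \<open>q\<^sub>1, \<dots>, q\<^sub>j\<close>, in this order, with
  \<open>(q\<^sub>i, i) \<in> W\<close>.\<close>

fun reached :: "'a pair_pre_digraph \<Rightarrow> ('a \<times> nat) set \<Rightarrow> nat \<Rightarrow> 'a set" where
  "reached G W 0 = pverts G"
| "reached G W (Suc j) = {p. \<exists>q\<in>reached G W j. (q, Suc j) \<in> W \<and> (q, p) \<in> (parcs G)\<^sup>*}"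

lemma reached_closed:
  assumes "pair_digraph G" "p \<in> reached G W j" "(p, q) \<in> parcs G"
  shows "q \<in> reached G W j"
proof (cases j)
  case 0
  interpret pair_digraph G by fact
  show ?thesis using arc_snd_in_verts[OF assms(3)] 0 by simp
next
  case (Suc i)
  then obtain r where "r \<in> reached G W i" "(r, j) \<in> W" "(r, p) \<in> (parcs G)\<^sup>*"
    using assms(2) by auto
  then show ?thesis using assms(3) Suc by (auto intro: rtrancl_into_rtrancl)
qed

lemma reached_chain:
  assumes "p \<in> reached G W j"
  shows "\<exists>c. (\<forall>i\<in>{1..j}. (c i, i) \<in> W) \<and> (\<forall>i\<in>{1..<j}. (c i, c (Suc i)) \<in> (parcs G)\<^sup>*) \<and>
    (j \<ge> 1 \<longrightarrow> (c j, p) \<in> (parcs G)\<^sup>*)"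
  using assms
proof (induction j arbitrary: p)
  case (Suc j)
  then obtain q where q: "q \<in> reached G W j" "(q, Suc j) \<in> W" "(q, p) \<in> (parcs G)\<^sup>*" by auto
  from Suc.IH[OF q(1)] obtain c where c: "\<forall>i\<in>{1..j}. (c i, i) \<in> W"
    "\<forall>i\<in>{1..<j}. (c i, c (Suc i)) \<in> (parcs G)\<^sup>*" "j \<ge> 1 \<longrightarrow> (c j, q) \<in> (parcs G)\<^sup>*" by blast
  have "\<forall>i\<in>{1..Suc j}. ((c(Suc j := q)) i, i) \<in> W" using c(1) q(2) by auto
  moreover have "\<forall>i\<in>{1..<Suc j}. ((c(Suc j := q)) i, (c(Suc j := q)) (Suc i)) \<in> (parcs G)\<^sup>*"
    using c(2,3) by (auto simp: less_Suc_eq)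
  ultimately show ?case using q(3) by (intro exI[of _ "c(Suc j := q)"]) simp
qed simp

text \<open>If the stages ran out by \<open>m\<close>, sending a vertex to the first stage that
  misses it would be a weak homomorphism not covered by \<open>W\<close>. It is monotone along arcs
  because each stage is closed under them.\<close>

lemma cover_reached_nonempty:
  assumes G: "pair_digraph G" and m: "m \<ge> 1" and W: "hom_cover G (D_graph m) W"
  shows "reached G W m \<noteq> {}"
proof
  assume empty: "reached G W m = {}"
  interpret pair_digraph G by fact
  define \<phi> where "\<phi> = (\<lambda>p\<in>pverts G. LEAST j. p \<notin> reached G W j)"
  have ph: "p \<notin> reached G W (\<phi> p)" "\<phi> p \<le> m" "\<And>i. i < \<phi> p \<Longrightarrow> p \<in> reached G W i"
    if "p \<in> pverts G" for p
  proof -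
    have eq: "\<phi> p = (LEAST j. p \<notin> reached G W j)" using that by (simp add: \<phi>_def)
    have pm: "p \<notin> reached G W m" using empty by simp
    show "p \<notin> reached G W (\<phi> p)" unfolding eq by (rule LeastI[of "\<lambda>j. p \<notin> reached G W j", OF pm])
    show "\<phi> p \<le> m" unfolding eq by (rule Least_le[of "\<lambda>j. p \<notin> reached G W j", OF pm])
    show "p \<in> reached G W i" if "i < \<phi> p" for i
      using not_less_Least[of i "\<lambda>j. p \<notin> reached G W j"] that unfolding eq by blast
  qed
  have pos: "1 \<le> \<phi> p" if "p \<in> pverts G" for p
    using ph(1)[OF that] that by (cases "\<phi> p") auto
  have "\<phi> x \<le> \<phi> y" if xy: "(x, y) \<in> parcs G" for x y
  proof (rule ccontr)
    assume "\<not> ?thesis"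
    moreover have "x \<in> pverts G" "y \<in> pverts G"
      using arc_fst_in_verts[OF xy] arc_snd_in_verts[OF xy] by auto
    ultimately have "x \<in> reached G W (\<phi> y)" "y \<notin> reached G W (\<phi> y)" using ph by auto
    then show False using reached_closed[OF G _ xy] by blast
  qed
  moreover have "x \<in> pverts G" "y \<in> pverts G" if "(x, y) \<in> parcs G" for x y
    using arc_fst_in_verts[OF that] arc_snd_in_verts[OF that] by auto
  moreover have "\<phi> \<in> pverts G \<rightarrow>\<^sub>E {1..m}" using ph(2) pos by (auto simp: \<phi>_def)
  ultimately have "\<phi> \<in> WHom G (D_graph m)"
    using ph(2) pos by (auto simp: WHom_def D_graph_def le_less)
  \<comment> \<open>A covered pair \<open>(p, \<phi> p)\<close> contradicts the choice of
    \<open>\<phi> p\<close>: the vertex is in the preceding stage and its pair is in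
    \<open>W\<close>, so it enters stage \<open>\<phi> p\<close> by the empty path.\<close>
  then obtain p where p: "p \<in> pverts G" "(p, \<phi> p) \<in> W" using W unfolding hom_cover_def by blast
  obtain i where i: "\<phi> p = Suc i" using pos[OF p(1)] by (cases "\<phi> p") auto
  then have "p \<in> reached G W i" using ph(3)[OF p(1)] by simp
  then have "p \<in> reached G W (\<phi> p)" using p(2) i by auto
  then show False using ph(1)[OF p(1)] by blast
qed

text \<open>A weak homomorphism into \<open>D_graph m\<close> is weakly increasing along the chain.
  Avoiding the value \<open>i\<close> at each \<open>c i\<close> would push it above
  \<open>i\<close> step by step, and finally above \<open>m\<close>.\<close>

lemma chain_is_cover:
  assumes m: "m \<ge> 1" and cV: "\<And>i. i \<in> {1..m} \<Longrightarrow> c i \<in> pverts G"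
    and c: "\<And>i. i \<in> {1..<m} \<Longrightarrow> (c i, c (Suc i)) \<in> (parcs G)\<^sup>*"
  shows "hom_cover G (D_graph m) ((\<lambda>i. (c i, i)) ` {1..m})"
  unfolding hom_cover_def
proof (intro conjI ballI)
  show "(\<lambda>i. (c i, i)) ` {1..m} \<subseteq> hom_vars G (D_graph m)"
    using cV by (auto simp: hom_vars_def D_graph_def)
  fix \<phi> assume \<phi>: "\<phi> \<in> WHom G (D_graph m)"
  have range: "\<phi> x \<in> {1..m}" if "x \<in> pverts G" for x
    using \<phi> that by (auto simp: WHom_def D_graph_def)
  have arc: "\<phi> x \<le> \<phi> y" if "(x, y) \<in> parcs G" for x y
    using \<phi> that by (auto simp: WHom_def D_graph_def)
  have mono: "\<phi> x \<le> \<phi> y" if "(x, y) \<in> (parcs G)\<^sup>*" for x y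
    using that by (induction rule: rtrancl_induct) (auto dest: arc)
  show "\<exists>i\<in>pverts G. (i, \<phi> i) \<in> (\<lambda>i. (c i, i)) ` {1..m}"
  proof (rule ccontr)
    assume no: "\<not> ?thesis"
    have ne: "\<phi> (c i) \<noteq> i" if "i \<in> {1..m}" for i
    proof
      assume "\<phi> (c i) = i"
      then have "(c i, \<phi> (c i)) \<in> (\<lambda>i. (c i, i)) ` {1..m}" using that by force
      then show False using no cV[OF that] by blast
    qed
    have "1 \<le> i \<Longrightarrow> i \<le> m \<Longrightarrow> i < \<phi> (c i)" for i
    proof (induction i rule: nat_induct_at_least)
      case base
      then show ?case using range[OF cV[of 1]] ne[of 1] by simp
    next
      case (Suc i)
      then have "i < \<phi> (c i)" "\<phi> (c i) \<le> \<phi> (c (Suc i))" using mono c[of i] by auto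
      then show ?case using ne[of "Suc i"] Suc by simp
    qed
    then have "m < \<phi> (c m)" using m by simp
    then show False using range[OF cV[of m]] m by simp
  qed
qed

text \<open>Every cover contains a chain that is itself a cover, so a minimal cover is such a chain
  and has one element in each column.\<close>

lemma D_graph_column_card:
  assumes G: "pair_digraph G" and m: "m \<ge> 1" and W: "W \<in> min_covers G (D_graph m)"
  shows "card (W \<inter> pverts G \<times> {1}) = 1"
proof -
  have cov: "hom_cover G (D_graph m) W" using W by (simp add: min_covers_def)
  obtain p where p: "p \<in> reached G W m" using cover_reached_nonempty[OF G m cov] by blast
  obtain c where c: "\<forall>i\<in>{1..m}. (c i, i) \<in> W" "\<forall>i\<in>{1..<m}. (c i, c (Suc i)) \<in> (parcs G)\<^sup>*"
    using reached_chain[OF p] by (elim exE conjE)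
  have cV: "c i \<in> pverts G" if "i \<in> {1..m}" for i
    using c(1) that cov by (auto simp: hom_cover_def hom_vars_def)
  have "hom_cover G (D_graph m) ((\<lambda>i. (c i, i)) ` {1..m})"
    using c(2) by (intro chain_is_cover[OF m cV]) auto
  moreover have "(\<lambda>i. (c i, i)) ` {1..m} \<subseteq> W" using c(1) by auto
  ultimately have "W = (\<lambda>i. (c i, i)) ` {1..m}"
    using W unfolding min_covers_def by auto
  moreover have "(\<lambda>i. (c i, i)) ` {1..m} \<inter> pverts G \<times> {1} = {(c 1, 1)}"
    using m cV[of 1] by auto
  ultimately show ?thesis by simp
qed

theorem theorem3p18:
  shows "(\<forall>(n::nat) (m::nat) G H.
      simple_digraph_on {1..n} G \<longrightarrow> simple_digraph_on {1..m} H \<longrightarrow>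
      (let V = hom_vars G H;
           I = (hom_ideal G H :: (nat \<times> nat, 'k::field) mpoly set)
       in unmixed (poly_ring V) I \<longrightarrow>
          depth_quot V I \<ge> depth_quot V (symbolic_power V I 2) \<and>
          (\<forall>k \<ge> 2. depth_quot V (symbolic_power V I k) \<ge>
                   depth_quot V (symbolic_power V I (k + 1)))))
    \<and> (\<forall>(n::nat) (m::nat) G.
      simple_digraph_on {1..n} G \<longrightarrow> m \<ge> 1 \<longrightarrow>
      (let V = hom_vars G (D_graph m);
           I = (hom_ideal G (D_graph m) :: (nat \<times> nat, 'k) mpoly set)
       in depth_quot V I \<ge> depth_quot V (symbolic_power V I 2) \<and>
          (\<forall>k \<ge> 2. depth_quot V (symbolic_power V I k) \<ge>
                   depth_quot V (symbolic_power V I (k + 1)))))"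
  unfolding Let_def
proof (intro conjI allI impI)
  fix n m G H
  assume G: "simple_digraph_on {1..n::nat} G" and H: "simple_digraph_on {1..m::nat} H"
    and unm: "unmixed (poly_ring (hom_vars G H)) (hom_ideal G H :: (nat \<times> nat, 'k) mpoly set)"
  have GH: "pair_digraph G" "pverts G \<noteq> {}" "finite (pverts G)" "finite (pverts H)" "pverts H \<noteq> {}"
    using G H by (auto simp: simple_digraph_on_def)
  then obtain j where j: "j \<in> pverts H" by blast
  have X: "card (W \<inter> pverts G \<times> {j}) = 1" if "W \<in> min_covers G H" for W
    using unmixed_column_card[OF GH(1-4) unm that j] .
  note D = depth_symbolic_power_hom_ideal[OF GH(3,4,2) j X, where 'k='k]
  show "depth_quot (hom_vars G H) (symbolic_power (hom_vars G H) (hom_ideal G H :: (nat \<times> nat, 'k) mpoly set) 2)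
      \<le> depth_quot (hom_vars G H) (hom_ideal G H :: (nat \<times> nat, 'k) mpoly set)"
    by (rule D(1))
  fix k :: nat assume "2 \<le> k"
  then have "1 \<le> k" by simp
  then show "depth_quot (hom_vars G H) (symbolic_power (hom_vars G H) (hom_ideal G H :: (nat \<times> nat, 'k) mpoly set) (k + 1))
      \<le> depth_quot (hom_vars G H) (symbolic_power (hom_vars G H) (hom_ideal G H :: (nat \<times> nat, 'k) mpoly set) k)"
    by (rule D(2)[rotated])
next
  fix n m G
  assume G: "simple_digraph_on {1..n::nat} G" and m: "1 \<le> (m::nat)"
  let ?H = "D_graph m"
  have GH: "pair_digraph G" "pverts G \<noteq> {}" "finite (pverts G)" "finite (pverts ?H)"
    using G by (auto simp: simple_digraph_on_def D_graph_def)
  have j: "1 \<in> pverts ?H" using m by (simp add: D_graph_def)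
  have X: "card (W \<inter> pverts G \<times> {1}) = 1" if "W \<in> min_covers G ?H" for W
    using D_graph_column_card[OF GH(1) m that] .
  note D = depth_symbolic_power_hom_ideal[OF GH(3,4,2) j X, where 'k='k]
  show "depth_quot (hom_vars G ?H) (symbolic_power (hom_vars G ?H) (hom_ideal G ?H :: (nat \<times> nat, 'k) mpoly set) 2)
      \<le> depth_quot (hom_vars G ?H) (hom_ideal G ?H :: (nat \<times> nat, 'k) mpoly set)"
    by (rule D(1))
  fix k :: nat assume "2 \<le> k"
  then have "1 \<le> k" by simp
  then show "depth_quot (hom_vars G ?H) (symbolic_power (hom_vars G ?H) (hom_ideal G ?H :: (nat \<times> nat, 'k) mpoly set) (k + 1))
      \<le> depth_quot (hom_vars G ?H) (symbolic_power (hom_vars G ?H) (hom_ideal G ?H :: (nat \<times> nat, 'k) mpoly set) k)"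
    by (rule D(2)[rotated])
qed

end
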